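(* Let $X$ be a Banach space and $1<p<\infty$. The following are equivalent: (1) $X$ has the $DPP_{p}$; (2) every weakly $p$-summable sequence in $X$ is $\rho$-null; (3) every weakly convergent sequence in $X^{*}$ is $\rho^{*}_{p}$-convergent.
   Context: Banach spaces are real or complex; an operator is a continuous linear map; $B_Z$ is the closed unit ball of $Z$; $p^*$ is the conjugate exponent of $p$. A sequence $(x_n)_n$ in $X$ is weakly $p$-summable, written $(x_n)_n\in l_p^w(X)$, if $\sup\{(\sum_{n=1}^{\infty}|\langle x^*,x_n\rangle|^p)^{1/p}:x^*\in B_{X^*}\}<\infty$; it is unconditionally $p$-summable, written $(x_n)_n\in l_p^u(X)$, if moreover $\sup\{(\sum_{n=m}^{\infty}|\langle x^*,x_n\rangle|^p)^{1/p}:x^*\in B_{X^*}\}\to 0$ as $m\to\infty$. An operator $T:X\to Y$ is unconditionally $p$-converging if $(Tx_n)_n\in l_p^u(Y)$ for every $(x_n)_n\in l_p^w(X)$; it is weakly compact if $T(B_X)$ is relatively weakly compact in $Y$. $X$ has the Dunford-Pettis property of order $p$ ($DPP_p$) if for every Banach space $Y$, every weakly compact operator $T:X\to Y$ is unconditionally $p$-converging. The topology $\rho$ (the Right topology) on $X$ is the restriction to $X$ of the Mackey topology $\tau(X^{**},X^* )$, i.e. the locally convex topology on $X$ generated by the seminorms $q_F(x)=\sup_{x^*\in F}|\langle x^*,x\rangle|$, where $F$ ranges over the weakly compact subsets of $B_{X^*}$; $\rho$-null means convergent to $0$ in $\rho$. A set $F\subset X$ is relatively weakly $p$-compact if $F\subset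 S(B_{l_{p^*}})$ for some operator $S:l_{p^*}\to X$. The topology $\rho_p^*$ on $X^*$ is the locally convex topology generated by the seminorms $q_F(x^* )=\sup_{x\in F}|\langle x^*,x\rangle|$, where $F$ ranges over the relatively weakly $p$-compact subsets of $X$. *)

theory Defs
  imports "HOL-Analysis.Analysis" "HOL-Library.Equipollence"
begin

section \<open>The scalar field\<close>

text \<open>
  Real and complex Banach spaces are treated uniformly: the scalar field is a type of the following
  class, whose instances are, up to isometric isomorphism, exactly the types of real and of complex
  numbers.
\<close>

class real_or_complex = real_normed_field +
  assumes real_or_complex:
    "(\<forall>z. \<exists>a. z = a *\<^sub>R 1) \<or>
     (\<exists>j. j * j = - 1 \<and> (\<forall>z. \<exists>a b. z = a *\<^sub>R 1 + b *\<^sub>R j))"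

instance real :: real_or_complex
  by standard simp

instance complex :: real_or_complex
proof
  have "z = Re z *\<^sub>R 1 + Im z *\<^sub>R \<i>" for z
    by (simp add: complex_eq_iff)
  then show "(\<forall>z::complex. \<exists>a. z = a *\<^sub>R 1) \<or>
      (\<exists>j::complex. j * j = - 1 \<and> (\<forall>z. \<exists>a b. z = a *\<^sub>R 1 + b *\<^sub>R j))"
    using i_squared by blast
qed

section \<open>Banach spaces on a carrier set\<close>

text \<open>
  The statement quantifies over all Banach spaces inside a definition and needs spaces such as
  duals and biduals over either scalar field.  Spaces are therefore records with an explicit
  carrier; nothing is required of the operations outside the carrier.
\<close>

record ('k, 'v) nspace =
  pts :: "'v set"
  vadd :: "'v \<Rightarrow> 'v \<Rightarrow> 'v"
  vzero :: 'v
  vscale :: "'k \<Rightarrow> 'v \<Rightarrow> 'v"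
  vnorm :: "'v \<Rightarrow> real"

definition vminus :: "('k::real_or_complex, 'v) nspace \<Rightarrow> 'v \<Rightarrow> 'v \<Rightarrow> 'v" where
  "vminus X x y = vadd X x (vscale X (- 1) y)"

locale normed_vspace =
  fixes X :: "('k::real_or_complex, 'v) nspace"
  assumes add_closed: "\<lbrakk>x \<in> pts X; y \<in> pts X\<rbrakk> \<Longrightarrow> vadd X x y \<in> pts X"
    and zero_closed: "vzero X \<in> pts X"
    and scale_closed: "x \<in> pts X \<Longrightarrow> vscale X c x \<in> pts X"
    and add_assoc: "\<lbrakk>x \<in> pts X; y \<in> pts X; z \<in> pts X\<rbrakk> \<Longrightarrow>
          vadd X (vadd X x y) z = vadd X x (vadd X y z)"
    and add_commute: "\<lbrakk>x \<in> pts X; y \<in> pts X\<rbrakk> \<Longrightarrow> vadd X x y = vadd X y x"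
    and add_zero: "x \<in> pts X \<Longrightarrow> vadd X x (vzero X) = x"
    and add_inverse: "x \<in> pts X \<Longrightarrow> \<exists>y\<in>pts X. vadd X x y = vzero X"
    and scale_one: "x \<in> pts X \<Longrightarrow> vscale X 1 x = x"
    and scale_scale: "x \<in> pts X \<Longrightarrow> vscale X a (vscale X b x) = vscale X (a * b) x"
    and scale_add_right: "\<lbrakk>x \<in> pts X; y \<in> pts X\<rbrakk> \<Longrightarrow>
          vscale X a (vadd X x y) = vadd X (vscale X a x) (vscale X a y)"
    and scale_add_left: "x \<in> pts X \<Longrightarrow>
          vscale X (a + b) x = vadd X (vscale X a x) (vscale X b x)"
    and norm_nonneg: "x \<in> pts X \<Longrightarrow> 0 \<le> vnorm X x"
    and norm_eq_zero: "x \<in> pts X \<Longrightarrow> vnorm X x = 0 \<longleftrightarrow> x = vzero X"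
    and norm_scale: "x \<in> pts X \<Longrightarrow> vnorm X (vscale X c x) = norm c * vnorm X x"
    and norm_triangle: "\<lbrakk>x \<in> pts X; y \<in> pts X\<rbrakk> \<Longrightarrow>
          vnorm X (vadd X x y) \<le> vnorm X x + vnorm X y"

text \<open>Set to 0 outside the carrier, because \<^locale>\<open>Metric_space\<close> asks for symmetry and
  nonnegativity on the whole type.\<close>

definition vdist :: "('k::real_or_complex, 'v) nspace \<Rightarrow> 'v \<Rightarrow> 'v \<Rightarrow> real" where
  "vdist X x y = (if x \<in> pts X \<and> y \<in> pts X then vnorm X (vminus X x y) else 0)"

definition norm_topology :: "('k::real_or_complex, 'v) nspace \<Rightarrow> 'v topology" where
  "norm_topology X = Metric_space.mtopology (pts X) (vdist X)"

locale banach_space = normed_vspace +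
  assumes complete: "Metric_space.mcomplete (pts X) (vdist X)"

definition unit_ball :: "('k::real_or_complex, 'v) nspace \<Rightarrow> 'v set" where
  "unit_ball X = {x \<in> pts X. vnorm X x \<le> 1}"

definition operator ::
    "('k::real_or_complex, 'v) nspace \<Rightarrow> ('k, 'w) nspace \<Rightarrow> ('v \<Rightarrow> 'w) \<Rightarrow> bool" where
  "operator X Y T \<longleftrightarrow>
     T \<in> pts X \<rightarrow> pts Y \<and>
     (\<forall>x\<in>pts X. \<forall>y\<in>pts X. T (vadd X x y) = vadd Y (T x) (T y)) \<and>
     (\<forall>c. \<forall>x\<in>pts X. T (vscale X c x) = vscale Y c (T x)) \<and>
     continuous_map (norm_topology X) (norm_topology Y) T"

definition scalars :: "('k::real_or_complex, 'k) nspace" where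
  "scalars = \<lparr>pts = UNIV, vadd = (+), vzero = 0, vscale = (*), vnorm = norm\<rparr>"

text \<open>Functionals are normalised to vanish outside the carrier, so that two functionals are equal
  iff they agree on the space.\<close>

definition dual :: "('k::real_or_complex, 'v) nspace \<Rightarrow> ('k, 'v \<Rightarrow> 'k) nspace" where
  "dual X =
     \<lparr>pts = {f. operator X scalars f \<and> (\<forall>x. x \<notin> pts X \<longrightarrow> f x = 0)},
      vadd = (\<lambda>f g x. f x + g x), vzero = (\<lambda>x. 0), vscale = (\<lambda>c f x. c * f x),
      vnorm = (\<lambda>f. SUP x\<in>unit_ball X. norm (f x))\<rparr>"

section \<open>Weak topologies and weakly compact operators\<close>

definition weak_topology :: "('k::real_or_complex, 'v) nspace \<Rightarrow> 'v topology" where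
  "weak_topology X =
     topology_generated_by {{x \<in> pts X. f x \<in> U} | f U. f \<in> pts (dual X) \<and> open U}"

definition weakly_compact_operator ::
    "('k::real_or_complex, 'v) nspace \<Rightarrow> ('k, 'w) nspace \<Rightarrow> ('v \<Rightarrow> 'w) \<Rightarrow> bool" where
  "weakly_compact_operator X Y T \<longleftrightarrow>
     operator X Y T \<and>
     compactin (weak_topology Y) (weak_topology Y closure_of (T ` unit_ball X))"

section \<open>Summability of sequences\<close>

definition lp_norm :: "real \<Rightarrow> (nat \<Rightarrow> 'k::real_or_complex) \<Rightarrow> ennreal" where
  "lp_norm p a =
     (if summable (\<lambda>n. norm (a n) powr p)
      then ennreal ((\<Sum>n. norm (a n) powr p) powr (1 / p)) else \<infinity>)"

definition lp_space :: "real \<Rightarrow> ('k::real_or_complex, nat \<Rightarrow> 'k) nspace" where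
  "lp_space p =
     \<lparr>pts = {a. lp_norm p a < \<infinity>},
      vadd = (\<lambda>a b n. a n + b n), vzero = (\<lambda>n. 0), vscale = (\<lambda>c a n. c * a n),
      vnorm = (\<lambda>a. enn2real (lp_norm p a))\<rparr>"

definition conjugate_exponent :: "real \<Rightarrow> real" where
  "conjugate_exponent p = p / (p - 1)"

definition weakly_p_summable ::
    "real \<Rightarrow> ('k::real_or_complex, 'v) nspace \<Rightarrow> (nat \<Rightarrow> 'v) \<Rightarrow> bool" where
  "weakly_p_summable p X x \<longleftrightarrow>
     range x \<subseteq> pts X \<and> (SUP f\<in>unit_ball (dual X). lp_norm p (\<lambda>n. f (x n))) < \<infinity>"

definition unconditionally_p_summable ::
    "real \<Rightarrow> ('k::real_or_complex, 'v) nspace \<Rightarrow> (nat \<Rightarrow> 'v) \<Rightarrow> bool" where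
  "unconditionally_p_summable p X x \<longleftrightarrow>
     weakly_p_summable p X x \<and>
     (\<lambda>m. SUP f\<in>unit_ball (dual X). lp_norm p (\<lambda>n. f (x (m + n)))) \<longlonglongrightarrow> 0"

definition unconditionally_p_converging ::
    "real \<Rightarrow> ('k::real_or_complex, 'v) nspace \<Rightarrow> ('k, 'w) nspace \<Rightarrow> ('v \<Rightarrow> 'w) \<Rightarrow> bool" where
  "unconditionally_p_converging p X Y T \<longleftrightarrow>
     operator X Y T \<and>
     (\<forall>x. weakly_p_summable p X x \<longrightarrow> unconditionally_p_summable p Y (\<lambda>n. T (x n)))"

section \<open>The Dunford-Pettis property of order p\<close>

text \<open>
  A HOL formula cannot quantify over types.  The type argument \<open>'w\<close> is the universe in which the
  carriers of the spaces \<open>Y\<close> live; statements about \<open>DPP\<close> should leave it arbitrary, subject only to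
  being large enough to hold a copy of \<open>X\<close>.
\<close>

definition DPP ::
    "'w itself \<Rightarrow> real \<Rightarrow> ('k::real_or_complex, 'v) nspace \<Rightarrow> bool" where
  "DPP (_ :: 'w itself) p X \<longleftrightarrow>
     (\<forall>(Y :: ('k, 'w) nspace) T. banach_space Y \<and> weakly_compact_operator X Y T \<longrightarrow>
        unconditionally_p_converging p X Y T)"

section \<open>Topologies of uniform convergence\<close>

definition seminorm_topology ::
    "('k::real_or_complex, 'v) nspace \<Rightarrow> ('v \<Rightarrow> real) set \<Rightarrow> 'v topology" where
  "seminorm_topology X Q =
     topology_generated_by
       {{y \<in> pts X. q (vminus X y x) < \<epsilon>} | q x \<epsilon>. q \<in> Q \<and> x \<in> pts X \<and> 0 < \<epsilon>}"

text \<open>In the next two topologies the empty set \<open>F\<close> is left out since \<open>Sup {}\<close> is unspecified on the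
  reals; it would only contribute the zero seminorm.\<close>

definition right_topology :: "('k::real_or_complex, 'v) nspace \<Rightarrow> 'v topology" where
  "right_topology X =
     seminorm_topology X {(\<lambda>x. SUP f\<in>F. norm (f x)) | F.
       F \<noteq> {} \<and> F \<subseteq> unit_ball (dual X) \<and> compactin (weak_topology (dual X)) F}"

definition relatively_weakly_p_compact ::
    "real \<Rightarrow> ('k::real_or_complex, 'v) nspace \<Rightarrow> 'v set \<Rightarrow> bool" where
  "relatively_weakly_p_compact p X F \<longleftrightarrow>
     (\<exists>S. operator (lp_space (conjugate_exponent p)) X S \<and>
          F \<subseteq> S ` unit_ball (lp_space (conjugate_exponent p)))"

definition rho_star_topology ::
    "real \<Rightarrow> ('k::real_or_complex, 'v) nspace \<Rightarrow> ('v \<Rightarrow> 'k) topology" where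
  "rho_star_topology p X =
     seminorm_topology (dual X) {(\<lambda>f. SUP x\<in>F. norm (f x)) | F.
       F \<noteq> {} \<and> relatively_weakly_p_compact p X F}"

end

theory Submission
  imports Defs
begin

text \<open>
  The bridge between the three conditions is the duality between sequences \<open>x\<close> in \<open>X\<close> and operators
  \<open>S\<close> from \<open>l\<^sub>q\<close> to \<open>X\<close>, where \<open>q\<close> is the conjugate exponent: \<open>S\<close> sends the unit vectors to a weakly
  \<open>p\<close>-summable sequence (\<open>operator_unit_vectors_summable\<close>), and every weakly \<open>p\<close>-summable sequence
  arises in this way (\<open>summing_operator_exists\<close>).  The conditions are proved equivalent in a cycle.

  Let \<open>X\<close> have the Dunford-Pettis property of order \<open>p\<close> and let \<open>f\<^sub>k\<close> converge weakly to \<open>g\<close> in the dual.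
  The operator \<open>x \<mapsto> (f\<^sub>k x - g x)\<^sub>k\<close> into the bounded sequences is weakly compact, because its extension
  to the bidual has values in the null sequences and is continuous from the weak-star to the weak
  topology, so that the image of the unit ball lies in the image of a weak-star compact set
  (\<open>weakly_null_functionals_operator\<close>).  Hence it is unconditionally \<open>p\<close>-converging.  Read in the
  coordinate functionals, this says that for a weakly \<open>p\<close>-summable sequence \<open>x\<close> the tails of
  \<open>\<Sum>\<^sub>n |(f\<^sub>k - g) x\<^sub>n|\<^sup>p\<close> are small uniformly in \<open>k\<close> (\<open>DPP_uniform_tails\<close>).  If \<open>x\<close> is the image of the unit
  vectors under \<open>S\<close>, then Hoelder's inequality bounds the tail of \<open>(f\<^sub>k - g) (S a)\<close> uniformly for \<open>a\<close> in
  the unit ball, and the finitely many remaining terms tend to 0.  So \<open>f\<^sub>k\<close> converges to \<open>g\<close> uniformly on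
  relatively weakly \<open>p\<close>-compact sets.

  Let weakly convergent sequences in the dual be \<open>\<rho>\<^sub>p\<^sup>*\<close>-convergent, and let \<open>x\<close> be weakly \<open>p\<close>-summable.
  If \<open>x\<close> were not \<open>\<rho>\<close>-null, there would be functionals \<open>f\<^sub>k\<close> in a weakly compact set with \<open>f\<^sub>k x\<^sub>n\<^sub>k\<close> bounded
  away from 0.  By the theorem of Eberlein and Smulian (\<open>weakly_compact_imp_sequentially\<close>) some
  subsequence converges weakly, hence to some \<open>h\<close> uniformly on the range of \<open>x\<close>, which is relatively
  weakly \<open>p\<close>-compact; as \<open>h x\<^sub>n\<close> tends to 0, this is a contradiction.

  Let weakly \<open>p\<close>-summable sequences be \<open>\<rho>\<close>-null, let \<open>T\<close> be weakly compact and \<open>x\<close> weakly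
  \<open>p\<close>-summable.  If \<open>T x\<close> is not unconditionally \<open>p\<close>-summable, there are disjoint finite blocks of
  indices and functionals \<open>f\<^sub>k\<close> in the dual ball whose \<open>p\<close>-sums over the \<open>k\<close>-th block exceed some fixed
  positive number.  The extremal coefficients of Hoelder's inequality turn each block into one vector
  \<open>z\<^sub>k\<close>.  The sequence \<open>z\<close> is again weakly \<open>p\<close>-summable, while \<open>f\<^sub>k (T z\<^sub>k)\<close> stays away from 0.  By Gantmacher's
  theorem the functionals \<open>f \<circ> T\<close> with \<open>f\<close> in the dual ball form a weakly compact set, so that
  \<open>z\<close> is not \<open>\<rho>\<close>-null, which is absurd.
\<close>

section \<open>Scalars\<close>

text \<open>On the unit circle the powers of \<open>d w\<close> are bounded, so \<open>norm (d w) \<le> 1\<close>; the same bound for the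
  inverse of \<open>w\<close> gives equality.\<close>

lemma complex_copy_norm:
  fixes d :: "complex \<Rightarrow> 'k::real_normed_field"
  assumes add: "\<And>a b. d (a + b) = d a + d b" and mult: "\<And>a b. d (a * b) = d a * d b"
    and real: "\<And>r. d (of_real r) = of_real r"
  shows "norm (d z) = norm z"
proof -
  have d1: "d 1 = 1" using real[of 1] by simp
  have pow: "d (w ^ n) = d w ^ n" for w n by (induction n) (auto simp: d1 mult)
  have bound: "norm (d w) \<le> (1 + norm (d \<i>)) * norm w" for w
  proof -
    have "w = of_real (Re w) + of_real (Im w) * \<i>" by (simp add: complex_eq_iff)
    then have "d w = of_real (Re w) + of_real (Im w) * d \<i>" using add mult real by metis
    then have "norm (d w) \<le> \<bar>Re w\<bar> + \<bar>Im w\<bar> * norm (d \<i>)"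
      by (metis norm_mult norm_of_real norm_triangle_ineq)
    also have "\<dots> \<le> norm w + norm w * norm (d \<i>)"
      by (intro add_mono mult_right_mono abs_Re_le_cmod abs_Im_le_cmod) auto
    finally show ?thesis by (simp add: algebra_simps)
  qed
  have le: "norm (d w) \<le> 1" if w: "norm w = 1" for w
  proof (rule ccontr)
    assume "\<not> norm (d w) \<le> 1"
    then obtain n where "1 + norm (d \<i>) < norm (d w) ^ n"
      using real_arch_pow[of "norm (d w)" "1 + norm (d \<i>)"] by auto
    moreover have "norm (d w) ^ n \<le> 1 + norm (d \<i>)"
      using bound[of "w ^ n"] w by (simp add: pow norm_power)
    ultimately show False by simp
  qed
  have one: "norm (d w) = 1" if w: "norm w = 1" for w
  proof -
    have "w * inverse w = 1" using w by (intro right_inverse) auto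
    then have "d w * d (inverse w) = 1" using mult d1 by metis
    then have "norm (d w) * norm (d (inverse w)) = 1" by (metis norm_mult norm_one)
    moreover have "norm (d w) \<le> 1" "norm (d (inverse w)) \<le> 1"
      using le w by (auto simp: norm_inverse)
    ultimately show ?thesis
      by (smt (verit, best) mult_left_le norm_ge_zero mult_cancel_left1)
  qed
  show ?thesis
  proof (cases "z = 0")
    case True then show ?thesis using real[of 0] by simp
  next
    case False
    have z: "z = of_real (norm z) * (z / of_real (norm z))" using False by simp
    have "norm (z / of_real (norm z)) = 1" using False by (simp add: norm_divide)
    then have "norm (d (z / of_real (norm z))) = 1" by (rule one)
    then have "norm (d (of_real (norm z) * (z / of_real (norm z)))) = norm z"
      by (simp only: mult real norm_mult norm_of_real) simp
    then show ?thesis using z by simp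
  qed
qed

text \<open>The type class describes its instances only up to isomorphism.  Real parts, conjugation and
  compactness are obtained by viewing the scalars inside the complex plane.\<close>

lemma exists_complex_embedding:
  "\<exists>e :: 'k::real_or_complex \<Rightarrow> complex. (\<forall>a b. e (a + b) = e a + e b) \<and> (\<forall>a b. e (a * b) = e a * e b) \<and>
     (\<forall>r. e (of_real r) = of_real r) \<and> (\<forall>z. norm (e z) = norm z) \<and> (range e = \<real> \<or> range e = UNIV)"
  using real_or_complex[where 'a='k]
proof
  assume *: "\<forall>z::'k. \<exists>a. z = a *\<^sub>R 1"
  define r where "r = (\<lambda>z::'k. SOME a. z = a *\<^sub>R 1)"
  have r: "z = of_real (r z)" for z
    using * someI_ex[of "\<lambda>a. z = a *\<^sub>R 1"] unfolding r_def of_real_def by blast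
  have r1: "r (of_real a) = a" for a
    using r[of "of_real a"] by simp
  have e: "r (a + b) = r a + r b" "r (a * b) = r a * r b" "\<bar>r a\<bar> = norm a" for a b
    using r[of a] r[of b] r1 by (metis of_real_add, metis of_real_mult, metis norm_of_real)
  have "range r = UNIV" using r1 by (metis surjI)
  then have "range (\<lambda>z. complex_of_real (r z)) = \<real>"
    unfolding Reals_def by (metis image_image)
  then show ?thesis
    by (intro exI[of _ "\<lambda>z. complex_of_real (r z)"]) (simp add: e r1)
next
  assume "\<exists>j::'k. j * j = - 1 \<and> (\<forall>z. \<exists>a b. z = a *\<^sub>R 1 + b *\<^sub>R j)"
  then obtain j :: 'k where j: "j * j = - 1" and rep: "\<And>z. \<exists>a b. z = of_real a + of_real b * j"
    unfolding of_real_def by auto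
  define d where "d = (\<lambda>w. of_real (Re w) + of_real (Im w) * j)"
  have dadd: "d (a + b) = d a + d b" for a b by (simp add: d_def algebra_simps)
  have dmult: "d (a * b) = d a * d b" for a b
  proof -
    have "d a * d b = of_real (Re a * Re b) + of_real (Re a * Im b + Im a * Re b) * j
             + of_real (Im a * Im b) * (j * j)"
      by (simp add: d_def algebra_simps)
    then show ?thesis by (simp add: d_def j algebra_simps)
  qed
  have dreal: "d (of_real r) = of_real r" for r by (simp add: d_def)
  have dnorm: "norm (d z) = norm z" for z using complex_copy_norm[of d, OF dadd dmult dreal] .
  have dneg: "d (- a) = - d a" for a by (simp add: d_def)
  have inj: "inj d"
  proof (rule injI)
    fix a b assume "d a = d b"
    then have "d (a - b) = 0" using dadd[of a "- b"] dneg by simp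
    then show "a = b" using dnorm[of "a - b"] by simp
  qed
  have surj: "surj d"
  proof (rule surjI)
    fix z :: 'k
    obtain a b where "z = of_real a + of_real b * j" using rep by blast
    then have "d (Complex a b) = z" by (simp add: d_def)
    then show "d (inv d z) = z" by (metis f_inv_into_f rangeI)
  qed
  have inv: "inv d (d w) = w" "d (inv d z) = z" for w z
    using inj surj by (auto simp: surj_f_inv_f)
  show ?thesis
  proof (intro exI[of _ "inv d"] conjI allI disjI2)
    show "inv d (a + b) = inv d a + inv d b" for a b by (metis inv dadd)
    show "inv d (a * b) = inv d a * inv d b" for a b by (metis inv dmult)
    show "inv d (of_real r) = of_real r" for r by (metis inv dreal)
    show "norm (inv d z) = norm z" for z by (metis inv dnorm)
    show "range (inv d) = UNIV" using inv(1) by (metis surjI)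
  qed
qed

definition emb :: "'k::real_or_complex \<Rightarrow> complex" where
  "emb = (SOME e. (\<forall>a b. e (a + b) = e a + e b) \<and> (\<forall>a b. e (a * b) = e a * e b) \<and>
     (\<forall>r. e (of_real r) = of_real r) \<and> (\<forall>z. norm (e z) = norm z) \<and> (range e = \<real> \<or> range e = UNIV))"

lemma
  fixes a b :: "'k::real_or_complex"
  shows emb_add: "emb (a + b) = emb a + emb b"
  and emb_mult: "emb (a * b) = emb a * emb b"
  and emb_of_real [simp]: "emb (of_real r :: 'k) = of_real r"
  and norm_emb [simp]: "norm (emb a) = norm a"
  and range_emb: "range (emb :: 'k::real_or_complex \<Rightarrow> complex) = \<real> \<or> range (emb :: 'k \<Rightarrow> complex) = UNIV"
proof -
  note * = someI_ex[OF exists_complex_embedding[where 'k='k], folded emb_def]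
  show "emb (a + b) = emb a + emb b" by (rule *[THEN conjunct1, THEN spec, THEN spec])
  show "emb (a * b) = emb a * emb b" by (rule *[THEN conjunct2, THEN conjunct1, THEN spec, THEN spec])
  show "emb (of_real r :: 'k) = of_real r" by (rule *[THEN conjunct2, THEN conjunct2, THEN conjunct1, THEN spec])
  show "norm (emb a) = norm a"
    by (rule *[THEN conjunct2, THEN conjunct2, THEN conjunct2, THEN conjunct1, THEN spec])
  show "range (emb :: 'k \<Rightarrow> complex) = \<real> \<or> range (emb :: 'k \<Rightarrow> complex) = UNIV"
    by (rule *[THEN conjunct2, THEN conjunct2, THEN conjunct2, THEN conjunct2])
qed

lemma emb_0 [simp]: "emb 0 = 0"
  using emb_of_real[of 0] by simp

lemma emb_minus: "emb (- a) = - emb a"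
  using emb_add[of a "- a"] by (simp add: eq_neg_iff_add_eq_0 add.commute)

lemma emb_diff: "emb (a - b) = emb a - emb b"
  using emb_add[of a "- b"] by (simp add: emb_minus)

lemma emb_sum: "emb (\<Sum>i\<in>A. f i) = (\<Sum>i\<in>A. emb (f i))"
  by (induction A rule: infinite_finite_induct) (auto simp: emb_add)

lemma inj_emb: "emb a = emb b \<longleftrightarrow> a = b"
proof
  assume "emb a = emb b"
  then have "norm (emb (a - b)) = 0" by (simp add: emb_diff)
  then show "a = b" by simp
qed simp

lemma dist_emb: "dist (emb a) (emb b) = dist a b"
  by (metis dist_norm emb_diff norm_emb)

lemma closed_range_emb: "closed (range (emb :: 'k::real_or_complex \<Rightarrow> complex))"
  using range_emb[where 'k='k] closed_complex_Reals by (metis closed_UNIV)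

lemma tendsto_emb_iff: "((\<lambda>i. emb (f i)) \<longlongrightarrow> emb l) F \<longleftrightarrow> (f \<longlongrightarrow> l) F"
  by (simp add: tendsto_iff dist_emb)

lemma continuous_on_emb_iff: "continuous_on S (\<lambda>x. emb (f x)) \<longleftrightarrow> continuous_on S f"
  by (simp add: continuous_on_def tendsto_emb_iff)

text \<open>Limits taken in the complex plane come back to the field because its image there is closed.\<close>

lemma convergent_emb_imp:
  fixes f :: "nat \<Rightarrow> 'k::real_or_complex"
  assumes "(\<lambda>n. emb (f n)) \<longlonglongrightarrow> w"
  obtains l where "f \<longlonglongrightarrow> l"
proof -
  have "w \<in> range (emb :: 'k \<Rightarrow> complex)"
    using closed_sequentially[OF closed_range_emb _ assms] by auto
  then show ?thesis using that assms tendsto_emb_iff by (metis rangeE)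
qed

lemma Cauchy_scalars_convergent:
  fixes f :: "nat \<Rightarrow> 'k::real_or_complex"
  assumes "Cauchy f"
  obtains l where "f \<longlonglongrightarrow> l"
proof -
  have "Cauchy (\<lambda>n. emb (f n))" using assms by (simp add: Cauchy_def dist_emb)
  then show ?thesis using Cauchy_convergent convergent_def convergent_emb_imp that by metis
qed

lemma compact_cball_scalars: "compact (cball (0::'k::real_or_complex) r)"
  unfolding compact_eq_seq_compact_metric seq_compact_def
proof (intro allI impI)
  fix f :: "nat \<Rightarrow> 'k" assume f: "\<forall>n. f n \<in> cball 0 r"
  then have "\<forall>n. emb (f n) \<in> cball 0 r" by simp
  then obtain w s where w: "strict_mono (s::nat \<Rightarrow> nat)" "((\<lambda>n. emb (f n)) \<circ> s) \<longlonglongrightarrow> w"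
    using compact_imp_seq_compact[OF compact_cball[of "0::complex" r]] unfolding seq_compact_def by metis
  then obtain l where l: "(\<lambda>n. f (s n)) \<longlonglongrightarrow> l" using convergent_emb_imp[of "\<lambda>n. f (s n)"] by (auto simp: o_def)
  then have "l \<in> cball 0 r" using f closed_sequentially[OF closed_cball, of "\<lambda>n. f (s n)"] by metis
  then show "\<exists>l\<in>cball 0 r. \<exists>s. strict_mono s \<and> (f \<circ> s) \<longlonglongrightarrow> l" using l w(1) by (auto simp: o_def)
qed

lemma countable_dense_scalars:
  "\<exists>C :: 'k::real_or_complex set. countable C \<and> (\<forall>z e. 0 < e \<longrightarrow> (\<exists>c\<in>C. norm (z - c) < e))"
proof -
  have "\<exists>C. countable C \<and> C \<subseteq> range (emb :: 'k \<Rightarrow> complex) \<and> range (emb :: 'k \<Rightarrow> complex) \<subseteq> closure C"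
    using separable by metis
  then obtain C where C: "countable C" "C \<subseteq> range (emb :: 'k \<Rightarrow> complex)" "range (emb :: 'k \<Rightarrow> complex) \<subseteq> closure C"
    by blast
  have "\<exists>c\<in>inv emb ` C. norm (z - c) < e" if "0 < e" for z :: 'k and e
  proof -
    have "emb z \<in> closure C" using C(3) by auto
    then have "\<exists>w\<in>C. dist w (emb z) < e" using that by (simp add: closure_approachable)
    then obtain w where w: "w \<in> C" "dist w (emb z) < e" ..
    then obtain c where c: "w = emb (c :: 'k)" using C(2) by blast
    then have "inv emb w = c" by (metis inj_emb inj_def inv_f_f)
    then show ?thesis using w c by (metis dist_commute dist_emb dist_norm imageI)
  qed
  then show ?thesis using C(1) by (intro exI[of _ "inv emb ` C"]) auto
qed

definition re :: "'k::real_or_complex \<Rightarrow> real" where "re z = Re (emb z)"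

text \<open>The formula makes sense over both fields without naming an imaginary unit; at 0 the division
  gives 0.\<close>

definition conjugate :: "'k::real_or_complex \<Rightarrow> 'k" where "conjugate z = of_real ((norm z)\<^sup>2) / z"

lemma emb_conjugate: "emb (conjugate z) = cnj (emb z)"
proof (cases "z = 0")
  case False
  have "conjugate z * z = of_real ((norm z)\<^sup>2)" using False by (simp add: conjugate_def)
  then have "emb (conjugate z) * emb z = of_real ((norm (emb z))\<^sup>2)"
    by (metis emb_mult emb_of_real norm_emb)
  also have "\<dots> = cnj (emb z) * emb z" using complex_norm_square[of "emb z"] by (simp add: mult.commute)
  finally show ?thesis using False inj_emb[of z 0] by simp
qed (simp add: conjugate_def)

lemma re_add: "re (a + b) = re a + re b" by (simp add: re_def emb_add)
lemma re_diff: "re (a - b) = re a - re b" by (simp add: re_def emb_diff)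
lemma re_sum: "re (\<Sum>i\<in>A. f i) = (\<Sum>i\<in>A. re (f i))" by (simp add: re_def emb_sum)
lemma re_of_real [simp]: "re (of_real r) = r" by (simp add: re_def)
lemma re_le_norm: "re a \<le> norm a" unfolding re_def by (metis complex_Re_le_cmod norm_emb)

lemma re_conjugate_self: "re (conjugate a * a) = (norm a)\<^sup>2"
proof -
  have "emb (conjugate a * a) = of_real ((norm a)\<^sup>2)"
    using complex_norm_square[of "emb a"] by (simp add: emb_mult emb_conjugate mult.commute)
  then show ?thesis by (simp add: re_def)
qed

lemma exists_unit_rotation:
  fixes z :: "'k::real_normed_field"
  obtains c where "norm c = 1" "c * z = of_real (norm z)"
proof (cases "z = 0")
  case True then show ?thesis using that[of 1] by simp
next
  case False then show ?thesis using that[of "of_real (norm z) / z"] by (simp add: norm_divide)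
qed

text \<open>Over the reals take \<open>k = v 1\<close>, over the complex numbers \<open>k = v 1 - v j * j\<close> with \<open>j\<close> the imaginary
  unit.\<close>

lemma real_linear_scalar_functional:
  fixes v :: "'k::real_or_complex \<Rightarrow> real"
  assumes add: "\<And>a b. v (a + b) = v a + v b" and scale: "\<And>r a. v (of_real r * a) = r * v a"
  shows "\<exists>k. \<forall>c. v c = re (c * k)"
  using range_emb[where 'k='k]
proof
  assume R: "range (emb :: 'k \<Rightarrow> complex) = \<real>"
  have "v c = re (c * of_real (v 1))" for c
  proof -
    obtain r where "emb c = of_real r" using R by (metis Reals_cases rangeI)
    then have c: "c = of_real r" by (metis emb_of_real inj_emb)
    then show ?thesis using scale[of r 1] by (simp flip: of_real_mult)
  qed
  then show ?thesis by blast
next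
  assume "range (emb :: 'k \<Rightarrow> complex) = UNIV"
  then obtain j :: 'k where j: "emb j = \<i>" by (metis surj_def)
  have "v c = re (c * (of_real (v 1) - of_real (v j) * j))" for c
  proof -
    have c: "c = of_real (Re (emb c)) * 1 + of_real (Im (emb c)) * j"
      by (subst inj_emb[symmetric]) (simp add: emb_add emb_mult j complex_eq_iff)
    have "v c = Re (emb c) * v 1 + Im (emb c) * v j"
      by (subst c) (simp only: add scale)
    then show ?thesis by (simp add: re_def emb_mult emb_diff j)
  qed
  then show ?thesis by blast
qed

lemma scalar_eqI_re:
  fixes a b :: "'k::real_or_complex"
  assumes "\<And>c. re (c * a) = re (c * b)"
  shows "a = b"
proof -
  have "(norm (a - b))\<^sup>2 = re (conjugate (a - b) * a) - re (conjugate (a - b) * b)"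
    using re_conjugate_self[of "a - b"] by (simp add: right_diff_distrib re_diff)
  also have "\<dots> = 0" using assms by simp
  finally show ?thesis by simp
qed

lemma sets_of_pairs_lepoll_real: "(UNIV :: (nat \<times> nat) set set) \<lesssim> (UNIV :: real set)"
proof -
  have "(UNIV :: (nat \<times> nat) set set) \<lesssim> (UNIV :: nat set set)"
    unfolding lepoll_def by (intro exI[of _ "image prod_encode"]) (auto simp: inj_on_def inj_prod_encode inj_image_eq_iff)
  also have "(UNIV :: nat set set) \<lesssim> (UNIV :: real set)" using nat_sets_eqpoll_reals eqpoll_imp_lepoll by blast
  finally show ?thesis .
qed

lemma real_lepoll_scalars: "(UNIV :: real set) \<lesssim> (UNIV :: 'k::real_or_complex set)"
  unfolding lepoll_def by (intro exI[of _ of_real]) (auto simp: inj_on_def)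

text \<open>A scalar is determined by the balls with centre in a countable dense set and radius \<open>1/(n+1)\<close>
  that contain it.\<close>

lemma scalars_lepoll_real: "(UNIV :: 'k::real_or_complex set) \<lesssim> (UNIV :: real set)"
proof -
  obtain C :: "'k set" where "countable C" and dense: "\<And>z e. 0 < e \<Longrightarrow> \<exists>c\<in>C. norm (z - c) < e"
    using countable_dense_scalars by blast
  define D where "D = (\<lambda>z::'k. {(i, n). norm (z - from_nat_into C i) < 1 / real (Suc n)})"
  have "(UNIV :: 'k set) \<lesssim> (UNIV :: (nat \<times> nat) set set)"
    unfolding lepoll_def
  proof (intro exI[of _ D] conjI)
    show "inj D"
    proof (rule injI, rule ccontr)
      fix a b assume ab: "D a = D b" "a \<noteq> b"
      obtain n where n: "1 / real (Suc n) < norm (a - b) / 2"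
        using nat_approx_posE[of "norm (a - b) / 2"] ab(2) by auto
      obtain c where c: "c \<in> C" "norm (a - c) < 1 / real (Suc n)" using dense[of "1 / real (Suc n)" a] by auto
      obtain i where i: "from_nat_into C i = c" using c(1) \<open>countable C\<close> by (metis from_nat_into_surj)
      have "(i, n) \<in> D a" using c i by (simp add: D_def)
      then have "(i, n) \<in> D b" using ab(1) by simp
      then have "norm (b - c) < 1 / real (Suc n)" using i by (simp add: D_def)
      then have "norm ((a - c) - (b - c)) < norm (a - b)" using c(2) n norm_triangle_ineq4[of "a - c" "b - c"] by linarith
      then show False by simp
    qed
  qed simp
  also note sets_of_pairs_lepoll_real
  finally show ?thesis .
qed

text \<open>
  This is why a space of sequences fits into every type that holds a copy of a nonzero space.\<close>

lemma sequences_lepoll_scalars: "(UNIV :: (nat \<Rightarrow> 'k::real_or_complex) set) \<lesssim> (UNIV :: 'k set)"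
proof -
  have "(UNIV :: 'k set) \<lesssim> (UNIV :: nat set set)"
    using scalars_lepoll_real nat_sets_eqpoll_reals eqpoll_imp_lepoll eqpoll_sym lepoll_trans by metis
  then obtain h :: "'k \<Rightarrow> nat set" where h: "inj h" unfolding lepoll_def by blast
  have "(UNIV :: (nat \<Rightarrow> 'k) set) \<lesssim> (UNIV :: (nat \<times> nat) set set)"
    unfolding lepoll_def
  proof (intro exI[of _ "\<lambda>a. {(n, i). i \<in> h (a n)}"] conjI)
    show "inj_on (\<lambda>a. {(n, i). i \<in> h (a n)}) (UNIV :: (nat \<Rightarrow> 'k) set)"
    proof (rule injI, rule ext)
      fix a b :: "nat \<Rightarrow> 'k" and n assume "{(n, i). i \<in> h (a n)} = {(n, i). i \<in> h (b n)}"
      then have "h (a n) = h (b n)" by (auto simp: set_eq_iff)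
      then show "a n = b n" using h by (simp add: inj_eq)
    qed
  qed simp
  also note sets_of_pairs_lepoll_real
  also have "(UNIV :: real set) \<lesssim> (UNIV :: 'k set)" by (rule real_lepoll_scalars)
  finally show ?thesis .
qed

section \<open>Normed spaces on a carrier and their duals\<close>

context normed_vspace
begin

lemma zero_scale [simp]: "x \<in> pts X \<Longrightarrow> vscale X 0 x = vzero X"
  using norm_eq_zero[of "vscale X 0 x"] norm_scale[of x 0] scale_closed by simp

lemma norm_vzero [simp]: "vnorm X (vzero X) = 0"
  using norm_eq_zero zero_closed by blast

lemma scale_vzero [simp]: "vscale X c (vzero X) = vzero X"
  using norm_eq_zero[of "vscale X c (vzero X)"] norm_scale[of "vzero X" c] scale_closed zero_closed by simp

lemma zero_add: "x \<in> pts X \<Longrightarrow> vadd X (vzero X) x = x"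
  using add_commute add_zero zero_closed by simp

lemma vminus_closed: "\<lbrakk>x \<in> pts X; y \<in> pts X\<rbrakk> \<Longrightarrow> vminus X x y \<in> pts X"
  unfolding vminus_def by (intro add_closed scale_closed)

lemma vminus_self [simp]: "x \<in> pts X \<Longrightarrow> vminus X x x = vzero X"
  using scale_add_left[of x 1 "- 1"] scale_one by (simp add: vminus_def)

lemma add_vminus_cancel:
  assumes "x \<in> pts X" "y \<in> pts X" shows "vadd X (vminus X x y) y = x"
proof -
  have "vadd X (vscale X (- 1) y) y = vzero X"
    using vminus_self[OF assms(2)] assms scale_closed add_commute unfolding vminus_def by metis
  then show ?thesis unfolding vminus_def using assms by (simp add: add_assoc scale_closed add_zero)
qed

lemma vminus_eq_zero: "\<lbrakk>x \<in> pts X; y \<in> pts X\<rbrakk> \<Longrightarrow> vminus X x y = vzero X \<longleftrightarrow> x = y"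
  using add_vminus_cancel[of x y] zero_add vminus_self by metis

lemma vminus_vzero [simp]: "x \<in> pts X \<Longrightarrow> vminus X x (vzero X) = x"
  by (simp add: vminus_def add_zero)

lemma vminus_add_vminus:
  assumes "x \<in> pts X" "y \<in> pts X" "z \<in> pts X"
  shows "vadd X (vminus X x y) (vminus X y z) = vminus X x z"
proof -
  have "vadd X (vminus X x y) (vminus X y z) = vadd X (vadd X (vminus X x y) y) (vscale X (- 1) z)"
    using assms by (simp add: vminus_def[of X y z] add_assoc vminus_closed scale_closed)
  then show ?thesis using assms by (simp add: add_vminus_cancel) (simp add: vminus_def)
qed

lemma vminus_swap:
  assumes "x \<in> pts X" "y \<in> pts X" shows "vminus X y x = vscale X (- 1) (vminus X x y)"
  using assms by (simp add: vminus_def scale_add_right scale_scale scale_closed scale_one add_commute)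

lemma norm_vminus_commute: "\<lbrakk>x \<in> pts X; y \<in> pts X\<rbrakk> \<Longrightarrow> vnorm X (vminus X x y) = vnorm X (vminus X y x)"
  using vminus_swap[of x y] norm_scale[of "vminus X x y" "- 1"] vminus_closed by simp

lemma norm_vminus_triangle:
  "\<lbrakk>x \<in> pts X; y \<in> pts X; z \<in> pts X\<rbrakk> \<Longrightarrow>
     vnorm X (vminus X x z) \<le> vnorm X (vminus X x y) + vnorm X (vminus X y z)"
  using norm_triangle[of "vminus X x y" "vminus X y z"] by (simp add: vminus_add_vminus vminus_closed)

lemma metric: "Metric_space (pts X) (vdist X)"
proof
  show "0 \<le> vdist X x y" for x y
    by (simp add: vdist_def norm_nonneg vminus_closed)
  show "vdist X x y = vdist X y x" for x y
    by (simp add: vdist_def norm_vminus_commute)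
  show "vdist X x y = 0 \<longleftrightarrow> x = y" if "x \<in> pts X" "y \<in> pts X" for x y
    using that by (simp add: vdist_def norm_eq_zero vminus_closed vminus_eq_zero)
  show "vdist X x z \<le> vdist X x y + vdist X y z" if "x \<in> pts X" "y \<in> pts X" "z \<in> pts X" for x y z
    using that by (simp add: vdist_def norm_vminus_triangle)
qed

lemma normalised_in_ball:
  assumes "x \<in> pts X" "0 < vnorm X x"
  shows "vscale X (of_real (1 / vnorm X x)) x \<in> unit_ball X"
  using assms by (simp add: unit_ball_def scale_closed norm_scale norm_divide)

end

lemma ball_subset_pts: "x \<in> unit_ball X \<Longrightarrow> x \<in> pts X"
  by (simp add: unit_ball_def)

text \<open>Continuity at 0 gives a ball that is mapped into the unit ball, and homogeneity rescales every
  vector into that ball.\<close>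

lemma operator_iff_bounded:
  assumes X: "normed_vspace X" and Y: "normed_vspace Y"
  shows "operator X Y T \<longleftrightarrow>
     T \<in> pts X \<rightarrow> pts Y \<and>
     (\<forall>x\<in>pts X. \<forall>y\<in>pts X. T (vadd X x y) = vadd Y (T x) (T y)) \<and>
     (\<forall>c. \<forall>x\<in>pts X. T (vscale X c x) = vscale Y c (T x)) \<and>
     (\<exists>C. \<forall>x\<in>pts X. vnorm Y (T x) \<le> C * vnorm X x)"
    (is "_ \<longleftrightarrow> ?A \<and> ?B \<and> ?C \<and> ?D")
proof -
  interpret X: normed_vspace X by fact
  interpret Y: normed_vspace Y by fact
  have cont: "continuous_map (norm_topology X) (norm_topology Y) T \<longleftrightarrow> T ` pts X \<subseteq> pts Y \<and>
     (\<forall>a \<in> pts X. \<forall>\<epsilon>>0. \<exists>\<delta>>0. \<forall>x. x \<in> pts X \<and> vdist X a x < \<delta> \<longrightarrow> vdist Y (T a) (T x) < \<epsilon>)"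
    unfolding norm_topology_def using Metric_space.metric_continuous_map[OF X.metric Y.metric] .
  have "continuous_map (norm_topology X) (norm_topology Y) T \<longleftrightarrow> ?D" if A: ?A and B: ?B and C: ?C
  proof -
    have minus: "T (vminus X x y) = vminus Y (T x) (T y)" if "x \<in> pts X" "y \<in> pts X" for x y
      using that B C by (simp add: vminus_def X.scale_closed)
    have T0: "T (vzero X) = vzero Y"
      using minus[OF X.zero_closed X.zero_closed] A X.zero_closed Y.vminus_self[of "T (vzero X)"] X.vminus_self
      by (simp add: Pi_iff)
    show ?thesis
    proof
      assume "continuous_map (norm_topology X) (norm_topology Y) T"
      then obtain \<delta> where \<delta>: "\<delta> > 0"
        "\<And>x. x \<in> pts X \<Longrightarrow> vdist X (vzero X) x < \<delta> \<Longrightarrow> vdist Y (T (vzero X)) (T x) < 1"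
        using cont X.zero_closed zero_less_one by (metis (no_types, lifting))
      have small: "vnorm Y (T x) < 1" if "x \<in> pts X" "vnorm X x < \<delta>" for x
      proof -
        have "vdist X (vzero X) x < \<delta>"
          using that by (simp add: vdist_def X.zero_closed X.norm_vminus_commute[of "vzero X"])
        then have "vdist Y (vzero Y) (T x) < 1" using \<delta>(2)[OF that(1)] T0 by simp
        then show ?thesis
          using A that by (simp add: vdist_def Y.zero_closed Y.norm_vminus_commute[of "vzero Y"] Pi_iff)
      qed
      have "vnorm Y (T x) \<le> 2 / \<delta> * vnorm X x" if x: "x \<in> pts X" for x
      proof (cases "vnorm X x = 0")
        case True
        then have "x = vzero X" using x X.norm_eq_zero by blast
        then show ?thesis by (simp add: T0)
      next
        case False
        then have pos: "vnorm X x > 0" using X.norm_nonneg[OF x] by simp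
        define c where "c = \<delta> / (2 * vnorm X x)"
        have c: "c > 0" using pos \<delta> by (simp add: c_def)
        have "vnorm X (vscale X (of_real c) x) < \<delta>"
          using x c pos \<delta> by (simp add: X.norm_scale) (simp add: c_def)
        then have "vnorm Y (T (vscale X (of_real c) x)) < 1" using small x X.scale_closed by blast
        then have "c * vnorm Y (T x) < 1" using C A x c by (simp add: Y.norm_scale Pi_iff)
        then have "vnorm Y (T x) < 1 / c" using c by (simp add: field_simps)
        also have "1 / c = 2 / \<delta> * vnorm X x" by (simp add: c_def)
        finally show ?thesis by simp
      qed
      then show ?D by blast
    next
      assume ?D
      then obtain K where K: "\<And>x. x \<in> pts X \<Longrightarrow> vnorm Y (T x) \<le> K * vnorm X x" by blast
      show "continuous_map (norm_topology X) (norm_topology Y) T"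
        unfolding cont
      proof (intro conjI ballI allI impI)
        show "T ` pts X \<subseteq> pts Y" using A by auto
        fix a and e :: real assume a: "a \<in> pts X" and e: "0 < e"
        have "vdist Y (T a) (T x) < e" if x: "x \<in> pts X" and d: "vdist X a x < e / (\<bar>K\<bar> + 1)" for x
        proof -
          have "vnorm Y (vminus Y (T a) (T x)) \<le> K * vnorm X (vminus X a x)"
            using K[OF X.vminus_closed[OF a x]] minus a x by simp
          also have "\<dots> \<le> (\<bar>K\<bar> + 1) * vnorm X (vminus X a x)"
            by (intro mult_right_mono X.norm_nonneg X.vminus_closed a x) auto
          also have "\<dots> < e" using d a x by (simp add: vdist_def field_simps)
          finally show ?thesis using e by (simp add: vdist_def)
        qed
        then show "\<exists>\<delta>>0. \<forall>x. x \<in> pts X \<and> vdist X a x < \<delta> \<longrightarrow> vdist Y (T a) (T x) < e"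
          using e by (intro exI[of _ "e / (\<bar>K\<bar> + 1)"]) auto
      qed
    qed
  qed
  then show ?thesis unfolding operator_def by blast
qed

text \<open>Duals, the spaces of \<open>p\<close>-summable sequences and the bounded sequences are spaces of functions with
  pointwise operations; the injection \<open>\<iota>\<close> allows the carrier to live in another type.  An upper bound
  for the norm of a multiple suffices, since for \<open>c \<noteq> 0\<close> it also applies to the inverse of \<open>c\<close>.\<close>

lemma normed_vspace_of_functions:
  fixes L :: "('k::real_or_complex, 'w) nspace" and \<iota> :: "('i \<Rightarrow> 'k) \<Rightarrow> 'w"
  assumes pts: "pts L = \<iota> ` A" and zero: "vzero L = \<iota> (\<lambda>i. 0)"
    and add: "\<And>a b. vadd L (\<iota> a) (\<iota> b) = \<iota> (\<lambda>i. a i + b i)"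
    and scale: "\<And>c a. vscale L c (\<iota> a) = \<iota> (\<lambda>i. c * a i)"
    and A_add: "\<And>a b. \<lbrakk>a \<in> A; b \<in> A\<rbrakk> \<Longrightarrow> (\<lambda>i. a i + b i) \<in> A"
    and A_scale: "\<And>c a. a \<in> A \<Longrightarrow> (\<lambda>i. c * a i) \<in> A" and ne: "A \<noteq> {}"
    and nonneg: "\<And>a. a \<in> A \<Longrightarrow> 0 \<le> vnorm L (\<iota> a)"
    and definite: "\<And>a i. \<lbrakk>a \<in> A; vnorm L (\<iota> a) = 0\<rbrakk> \<Longrightarrow> a i = 0"
    and norm_scale: "\<And>c a. a \<in> A \<Longrightarrow> vnorm L (\<iota> (\<lambda>i. c * a i)) \<le> norm c * vnorm L (\<iota> a)"
    and triangle: "\<And>a b. \<lbrakk>a \<in> A; b \<in> A\<rbrakk> \<Longrightarrow> vnorm L (\<iota> (\<lambda>i. a i + b i)) \<le> vnorm L (\<iota> a) + vnorm L (\<iota> b)"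
  shows "normed_vspace L"
proof
  obtain a0 where a0: "a0 \<in> A" using ne by blast
  then have zero_A: "(\<lambda>i. 0) \<in> A" using A_scale[of a0 0] by simp
  then show "vzero L \<in> pts L" by (simp add: pts zero)
  have norm_zero: "vnorm L (\<iota> (\<lambda>i. 0)) = 0" using norm_scale[OF a0, of 0] nonneg[OF zero_A] by simp
  fix x y z and r s :: 'k assume "x \<in> pts L"
  then obtain a where a: "a \<in> A" "x = \<iota> a" by (auto simp: pts)
  show "vscale L r x \<in> pts L" using a A_scale by (auto simp: pts scale)
  show "\<exists>y\<in>pts L. vadd L x y = vzero L"
    using A_scale[OF a(1), of "- 1"] by (intro bexI[of _ "\<iota> (\<lambda>i. - 1 * a i)"]) (auto simp: a pts add zero)
  show "vadd L x (vzero L) = x" "vscale L 1 x = x" "vscale L r (vscale L s x) = vscale L (r * s) x"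
    "vscale L (r + s) x = vadd L (vscale L r x) (vscale L s x)"
    by (simp_all add: a add scale zero algebra_simps)
  show "0 \<le> vnorm L x" using nonneg a by simp
  show "vnorm L x = 0 \<longleftrightarrow> x = vzero L"
  proof
    assume "vnorm L x = 0"
    then have "a = (\<lambda>i. 0)" using definite[OF a(1)] a(2) by auto
    then show "x = vzero L" by (simp add: a zero)
  qed (simp add: zero norm_zero)
  show "vnorm L (vscale L r x) = norm r * vnorm L x"
  proof (cases "r = 0")
    case True then show ?thesis by (simp add: a scale norm_zero)
  next
    case False
    then have "vnorm L (\<iota> a) \<le> norm (inverse r) * vnorm L (\<iota> (\<lambda>i. r * a i))"
      using norm_scale[OF A_scale[OF a(1), of r], of "inverse r"] by (simp flip: mult.assoc)
    then have "norm r * vnorm L (\<iota> a) \<le> vnorm L (\<iota> (\<lambda>i. r * a i))"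
      using False by (simp add: norm_inverse norm_divide field_simps)
    then show ?thesis using norm_scale[OF a(1), of r] by (simp add: a scale)
  qed
  assume "y \<in> pts L"
  then obtain b where b: "b \<in> A" "y = \<iota> b" by (auto simp: pts)
  show "vadd L x y \<in> pts L" using a b A_add by (auto simp: pts add)
  show "vadd L x y = vadd L y x" "vscale L r (vadd L x y) = vadd L (vscale L r x) (vscale L r y)"
    by (simp_all add: a b add scale algebra_simps)
  show "vnorm L (vadd L x y) \<le> vnorm L x + vnorm L y" using triangle a b by (simp add: add)
  assume "z \<in> pts L"
  then obtain c where c: "z = \<iota> c" by (auto simp: pts)
  show "vadd L (vadd L x y) z = vadd L x (vadd L y z)" by (simp add: a b c add add.assoc)
qed

lemma scalars_simps [simp]:
  "pts scalars = UNIV" "vadd scalars = (+)" "vzero scalars = 0" "vscale scalars = (*)" "vnorm scalars = norm"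
  by (simp_all add: scalars_def)

lemma normed_vspace_scalars: "normed_vspace (scalars :: ('k::real_or_complex, 'k) nspace)"
proof
  show "\<exists>y\<in>pts scalars. vadd scalars x y = vzero scalars" for x :: 'k
    by (intro bexI[of _ "- x"]) auto
qed (auto simp: algebra_simps norm_mult norm_triangle_ineq)

lemma dual_simps [simp]:
  "vadd (dual X) f g = (\<lambda>x. f x + g x)" "vzero (dual X) = (\<lambda>x. 0)" "vscale (dual X) c f = (\<lambda>x. c * f x)"
  by (simp_all add: dual_def)

lemma vminus_dual [simp]: "vminus (dual X) f g = (\<lambda>x. f x - g x)"
  by (simp add: vminus_def)

context normed_vspace
begin

lemma in_dual_iff:
  "f \<in> pts (dual X) \<longleftrightarrow>
     (\<forall>x\<in>pts X. \<forall>y\<in>pts X. f (vadd X x y) = f x + f y) \<and>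
     (\<forall>c. \<forall>x\<in>pts X. f (vscale X c x) = c * f x) \<and>
     (\<forall>x. x \<notin> pts X \<longrightarrow> f x = 0) \<and>
     (\<exists>C. \<forall>x\<in>pts X. norm (f x) \<le> C * vnorm X x)"
  using operator_iff_bounded[OF normed_vspace_axioms normed_vspace_scalars, of f]
  by (auto simp: dual_def)

lemma
  assumes "f \<in> pts (dual X)"
  shows dual_add: "\<lbrakk>x \<in> pts X; y \<in> pts X\<rbrakk> \<Longrightarrow> f (vadd X x y) = f x + f y"
    and dual_scale: "x \<in> pts X \<Longrightarrow> f (vscale X c x) = c * f x"
    and dual_outside: "x \<notin> pts X \<Longrightarrow> f x = 0"
    and dual_bounded: "\<exists>C. \<forall>x\<in>pts X. norm (f x) \<le> C * vnorm X x"
  using assms by (auto simp: in_dual_iff)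

lemma dual_vzero: "f \<in> pts (dual X) \<Longrightarrow> f (vzero X) = 0"
  using dual_scale[of f "vzero X" 0] zero_closed by simp

lemma dual_vminus: "\<lbrakk>f \<in> pts (dual X); x \<in> pts X; y \<in> pts X\<rbrakk> \<Longrightarrow> f (vminus X x y) = f x - f y"
  by (simp add: vminus_def dual_add dual_scale scale_closed)

lemma zero_in_ball: "vzero X \<in> unit_ball X"
  by (simp add: unit_ball_def zero_closed)

lemma dual_bdd_above: "f \<in> pts (dual X) \<Longrightarrow> bdd_above ((\<lambda>x. norm (f x)) ` unit_ball X)"
proof -
  assume "f \<in> pts (dual X)"
  then obtain C where C: "\<And>x. x \<in> pts X \<Longrightarrow> norm (f x) \<le> C * vnorm X x" using dual_bounded by blast
  have "norm (f x) \<le> \<bar>C\<bar>" if "x \<in> unit_ball X" for x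
  proof -
    have "norm (f x) \<le> C * vnorm X x" using C that by (simp add: unit_ball_def)
    also have "\<dots> \<le> \<bar>C\<bar> * 1"
      using that by (intro mult_mono) (auto simp: unit_ball_def norm_nonneg)
    finally show ?thesis by simp
  qed
  then show ?thesis by (auto intro!: bdd_aboveI2)
qed

lemma dual_norm_def: "vnorm (dual X) f = (SUP x\<in>unit_ball X. norm (f x))"
  by (simp add: dual_def)

lemma dual_norm_nonneg: "f \<in> pts (dual X) \<Longrightarrow> 0 \<le> vnorm (dual X) f"
  unfolding dual_norm_def using cSUP_upper[OF zero_in_ball dual_bdd_above] dual_vzero by fastforce

lemma dual_bound:
  assumes f: "f \<in> pts (dual X)" and x: "x \<in> pts X"
  shows "norm (f x) \<le> vnorm (dual X) f * vnorm X x"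
proof (cases "vnorm X x = 0")
  case True
  then have "x = vzero X" using x norm_eq_zero by blast
  then show ?thesis by (simp add: f dual_vzero)
next
  case False
  then have pos: "vnorm X x > 0" using norm_nonneg[OF x] by simp
  have "norm (f (vscale X (of_real (1 / vnorm X x)) x)) \<le> vnorm (dual X) f"
    unfolding dual_norm_def by (rule cSUP_upper[OF normalised_in_ball[OF x pos] dual_bdd_above[OF f]])
  then show ?thesis using pos by (simp add: dual_scale[OF f x] norm_mult norm_divide field_simps)
qed

lemma dual_norm_le:
  assumes "0 \<le> C" "\<And>x. x \<in> pts X \<Longrightarrow> norm (f x) \<le> C * vnorm X x"
  shows "vnorm (dual X) f \<le> C"
  unfolding dual_norm_def
proof (rule cSUP_least)
  show "unit_ball X \<noteq> {}" using zero_in_ball by blast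
  fix x assume "x \<in> unit_ball X"
  then show "norm (f x) \<le> C"
    using assms(2)[of x] mult_left_mono[of "vnorm X x" 1 C] assms(1) by (simp add: unit_ball_def)
qed

lemma dual_ball_iff:
  "f \<in> unit_ball (dual X) \<longleftrightarrow> f \<in> pts (dual X) \<and> (\<forall>x\<in>pts X. norm (f x) \<le> vnorm X x)"
proof
  assume f: "f \<in> unit_ball (dual X)"
  have "norm (f x) \<le> vnorm X x" if "x \<in> pts X" for x
  proof -
    have "norm (f x) \<le> vnorm (dual X) f * vnorm X x" using f that dual_bound by (simp add: unit_ball_def)
    also have "\<dots> \<le> 1 * vnorm X x"
      using f that by (intro mult_right_mono) (auto simp: unit_ball_def norm_nonneg)
    finally show ?thesis by simp
  qed
  then show "f \<in> pts (dual X) \<and> (\<forall>x\<in>pts X. norm (f x) \<le> vnorm X x)" using f by (simp add: unit_ball_def)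
qed (use dual_norm_le[of 1] in \<open>auto simp: unit_ball_def\<close>)

lemma dual_ball_bound: "\<lbrakk>f \<in> unit_ball (dual X); x \<in> pts X\<rbrakk> \<Longrightarrow> norm (f x) \<le> vnorm X x"
  using dual_ball_iff by blast

lemma dual_ballI:
  assumes "\<And>x y. \<lbrakk>x \<in> pts X; y \<in> pts X\<rbrakk> \<Longrightarrow> f (vadd X x y) = f x + f y"
    and "\<And>c x. x \<in> pts X \<Longrightarrow> f (vscale X c x) = c * f x"
    and "\<And>x. x \<notin> pts X \<Longrightarrow> f x = 0"
    and "\<And>x. x \<in> pts X \<Longrightarrow> norm (f x) \<le> vnorm X x"
  shows "f \<in> unit_ball (dual X)"
  unfolding dual_ball_iff in_dual_iff using assms by (metis mult_1)

lemma normed_vspace_dual: "normed_vspace (dual X)"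
proof (rule normed_vspace_of_functions[where \<iota>="\<lambda>f. f" and A="pts (dual X)"])
  fix f g :: "'v \<Rightarrow> 'k" and c :: 'k
  have "(\<lambda>x. 0) \<in> pts (dual X)" by (auto simp: in_dual_iff intro!: exI[of _ 0])
  then show "pts (dual X) \<noteq> {}" by blast
  assume f: "f \<in> pts (dual X)"
  show "(\<lambda>x. c * f x) \<in> pts (dual X)"
    unfolding in_dual_iff using f
    by (auto simp: dual_add dual_scale dual_outside norm_mult distrib_left mult.left_commute mult.assoc
        intro!: exI[of _ "norm c * vnorm (dual X) f"] mult_left_mono dual_bound)
  show "0 \<le> vnorm (dual X) f" using f by (rule dual_norm_nonneg)
  show "vnorm (dual X) (\<lambda>x. c * f x) \<le> norm c * vnorm (dual X) f"
    using f dual_norm_nonneg dual_bound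
    by (intro dual_norm_le) (auto simp: norm_mult mult.assoc intro!: mult_left_mono)
  show "f x = 0" if "vnorm (dual X) f = 0" for x
    using dual_bound[OF f, of x] dual_outside[OF f, of x] that by (cases "x \<in> pts X") auto
  assume g: "g \<in> pts (dual X)"
  have bd: "norm (f x + g x) \<le> (vnorm (dual X) f + vnorm (dual X) g) * vnorm X x" if "x \<in> pts X" for x
    using norm_triangle_ineq[of "f x" "g x"] dual_bound[OF f that] dual_bound[OF g that]
    by (simp add: algebra_simps)
  then show "(\<lambda>x. f x + g x) \<in> pts (dual X)"
    unfolding in_dual_iff using f g
    by (auto simp: dual_add dual_scale dual_outside distrib_left
        intro!: exI[of _ "vnorm (dual X) f + vnorm (dual X) g"])
  show "vnorm (dual X) (\<lambda>x. f x + g x) \<le> vnorm (dual X) f + vnorm (dual X) g"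
    using bd dual_norm_nonneg f g by (intro dual_norm_le) auto
qed simp_all

definition evaluation :: "'v \<Rightarrow> ('v \<Rightarrow> 'k) \<Rightarrow> 'k" where
  "evaluation x = (\<lambda>f. if f \<in> pts (dual X) then f x else 0)"

lemma evaluation_in_bidual: "x \<in> pts X \<Longrightarrow> evaluation x \<in> pts (dual (dual X))"
  and evaluation_in_ball: "x \<in> unit_ball X \<Longrightarrow> evaluation x \<in> unit_ball (dual (dual X))"
proof -
  interpret D: normed_vspace "dual X" by (rule normed_vspace_dual)
  show *: "evaluation x \<in> pts (dual (dual X))" if "x \<in> pts X" for x
    unfolding D.in_dual_iff
  proof (intro conjI ballI allI impI exI[of _ "vnorm X x"])
    fix f g c assume f: "f \<in> pts (dual X)" 
    show "evaluation x (vscale (dual X) c f) = c * evaluation x f"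
      using f D.scale_closed[OF f, of c] by (simp add: evaluation_def)
    show "norm (evaluation x f) \<le> vnorm X x * vnorm (dual X) f"
      using f dual_bound[OF f that] by (simp add: evaluation_def mult.commute)
    assume g: "g \<in> pts (dual X)"
    show "evaluation x (vadd (dual X) f g) = evaluation x f + evaluation x g"
      using f g D.add_closed[OF f g] by (simp add: evaluation_def)
  qed (simp add: evaluation_def)
  show "evaluation x \<in> unit_ball (dual (dual X))" if x: "x \<in> unit_ball X"
    unfolding D.dual_ball_iff
  proof (intro conjI ballI)
    show "evaluation x \<in> pts (dual (dual X))" by (rule *[OF ball_subset_pts[OF x]])
    fix f assume f: "f \<in> pts (dual X)"
    then have "norm (f x) \<le> vnorm (dual X) f * vnorm X x" by (rule dual_bound[OF _ ball_subset_pts[OF x]])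
    also have "\<dots> \<le> vnorm (dual X) f * 1"
      using x f by (intro mult_left_mono dual_norm_nonneg) (auto simp: unit_ball_def)
    finally show "norm (evaluation x f) \<le> vnorm (dual X) f" using f by (simp add: evaluation_def)
  qed
qed

lemma scaled_dual_in_ball:
  assumes "f \<in> pts (dual X)" "0 < M" "vnorm (dual X) f \<le> M"
  shows "(\<lambda>x. of_real (1 / M) * f x) \<in> unit_ball (dual X)"
proof -
  interpret D: normed_vspace "dual X" by (rule normed_vspace_dual)
  have "vnorm (dual X) (vscale (dual X) (of_real (1 / M)) f) \<le> 1"
    using assms by (subst D.norm_scale) (auto simp: norm_divide)
  then show ?thesis using D.scale_closed[OF assms(1), of "of_real (1 / M)"] by (simp add: unit_ball_def)
qed

end

section \<open>Weak topologies and topologies given by seminorms\<close>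

lemma limitin_topology_generated_by:
  "limitin (topology_generated_by S) f l F \<longleftrightarrow>
     l \<in> \<Union>S \<and> (\<forall>U\<in>S. l \<in> U \<longrightarrow> (\<forall>\<^sub>F i in F. f i \<in> U))"
proof safe
  assume lim: "limitin (topology_generated_by S) f l F"
  then show "l \<in> \<Union>S" by (simp add: limitin_def)
  fix U assume "U \<in> S" "l \<in> U"
  then show "\<forall>\<^sub>F i in F. f i \<in> U" 
    using lim topology_generated_by_Basis[of U S] unfolding limitin_def by blast
next
  fix V assume *: "\<forall>U\<in>S. l \<in> U \<longrightarrow> (\<forall>\<^sub>F i in F. f i \<in> U)" and V: "l \<in> V" "V \<in> S"
  have "generate_topology_on S U \<Longrightarrow> l \<in> U \<Longrightarrow> \<forall>\<^sub>F i in F. f i \<in> U" for U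
  proof (induction U rule: generate_topology_on.induct)
    case (Int a b) then show ?case by (simp add: eventually_conj)
  next
    case (UN K)
    then obtain k where "k \<in> K" "l \<in> k" by blast
    then have "\<forall>\<^sub>F i in F. f i \<in> k" using UN.IH by blast
    then show ?case by (rule eventually_mono) (use \<open>k \<in> K\<close> in blast)
  qed (use * in auto)
  then show "limitin (topology_generated_by S) f l F"
    unfolding limitin_def openin_topology_generated_by_iff using V by auto
qed

context normed_vspace
begin

lemma topspace_weak [simp]: "topspace (weak_topology X) = pts X"
proof -
  interpret D: normed_vspace "dual X" by (rule normed_vspace_dual)
  have "\<exists>f U. pts X = {x \<in> pts X. f x \<in> U} \<and> f \<in> pts (dual X) \<and> open U"
    by (intro exI[of _ "vzero (dual X)"] exI[of _ UNIV]) (simp add: D.zero_closed[simplified])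
  then show ?thesis unfolding weak_topology_def topology_generated_by_topspace by blast
qed

text \<open>The weak topology is the coarsest one that makes the functionals continuous; this is the form in
  which it is used below.\<close>

lemma continuous_map_into_weak:
  "continuous_map T (weak_topology X) h \<longleftrightarrow>
     h ` topspace T \<subseteq> pts X \<and> (\<forall>f\<in>pts (dual X). continuous_map T euclidean (\<lambda>t. f (h t)))"
proof (cases "h ` topspace T \<subseteq> pts X")
  case True
  have eq: "openin T (h -` {x \<in> pts X. f x \<in> U} \<inter> topspace T) \<longleftrightarrow> openin T {t \<in> topspace T. f (h t) \<in> U}"
    for f :: "'v \<Rightarrow> 'k" and U
    using True by (intro arg_cong[where f="openin T"]) auto
  have "\<Union>{{x \<in> pts X. f x \<in> U} |f U. f \<in> pts (dual X) \<and> open U} = pts X"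
    using topspace_weak unfolding weak_topology_def topology_generated_by_topspace .
  then show ?thesis
    unfolding weak_topology_def continuous_on_generated_topo_iff
  proof (intro iffI conjI True ballI allI impI; (elim conjE)?)
    fix f assume *: "\<forall>U. U \<in> {{x \<in> pts X. f x \<in> U} |f U. f \<in> pts (dual X) \<and> open U} \<longrightarrow> openin T (h -` U \<inter> topspace T)"
      and f: "f \<in> pts (dual X)"
    have "openin T {t \<in> topspace T. f (h t) \<in> U}" if "open U" for U
      unfolding eq[symmetric] using * f that by blast
    then show "continuous_map T euclidean (\<lambda>t. f (h t))" by (simp add: continuous_map_def)
  next
    fix V assume *: "\<forall>f\<in>pts (dual X). continuous_map T euclidean (\<lambda>t. f (h t))"
      and "V \<in> {{x \<in> pts X. f x \<in> U} |f U. f \<in> pts (dual X) \<and> open U}"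
    then obtain f U where V: "V = {x \<in> pts X. f x \<in> U}" "f \<in> pts (dual X)" "open U" by blast
    then have "openin T {t \<in> topspace T. f (h t) \<in> U}" using * by (simp add: continuous_map_def)
    then show "openin T (h -` V \<inter> topspace T)" unfolding V(1) eq .
  qed (use True in auto)
next
  case False
  then show ?thesis using topspace_weak by (auto simp: continuous_map_def Pi_iff)
qed

lemma continuous_map_weak_dual: "f \<in> pts (dual X) \<Longrightarrow> continuous_map (weak_topology X) euclidean f"
  using continuous_map_into_weak[of "weak_topology X" id] by auto

lemma limitin_weak_iff:
  assumes "range x \<subseteq> pts X"
  shows "limitin (weak_topology X) x l sequentially \<longleftrightarrow>
     l \<in> pts X \<and> (\<forall>f\<in>pts (dual X). (\<lambda>n. f (x n)) \<longlonglongrightarrow> f l)"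
proof (intro iffI conjI ballI; (elim conjE)?)
  assume lim: "limitin (weak_topology X) x l sequentially"
  then show "l \<in> pts X" using limitin_topspace topspace_weak by metis
  fix f assume "f \<in> pts (dual X)"
  then have "continuous_map (weak_topology X) euclidean f" by (rule continuous_map_weak_dual)
  then have "limitin euclidean (f \<circ> x) (f l) sequentially" using lim by (rule continuous_map_limit)
  then show "(\<lambda>n. f (x n)) \<longlonglongrightarrow> f l" by (simp add: o_def)
next
  assume l: "l \<in> pts X" and lim: "\<forall>f\<in>pts (dual X). (\<lambda>n. f (x n)) \<longlonglongrightarrow> f l"
  have x: "x n \<in> pts X" for n using assms by auto
  show "limitin (weak_topology X) x l sequentially"
    unfolding weak_topology_def limitin_topology_generated_by
  proof (intro conjI ballI impI)
    show "l \<in> \<Union>{{x \<in> pts X. f x \<in> U} |f U. f \<in> pts (dual X) \<and> open U}"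
      using l topspace_weak unfolding weak_topology_def topology_generated_by_topspace by simp
    fix V assume "V \<in> {{x \<in> pts X. f x \<in> U} |f U. f \<in> pts (dual X) \<and> open U}" "l \<in> V"
    then obtain f U where V: "V = {x \<in> pts X. f x \<in> U}" "f \<in> pts (dual X)" "open U" "f l \<in> U" by auto
    have "(\<lambda>n. f (x n)) \<longlonglongrightarrow> f l" using lim V(2) by simp
    then show "\<forall>\<^sub>F n in sequentially. x n \<in> V" using topological_tendstoD[OF _ V(3,4)] V(1) x by simp
  qed
qed

text \<open>The topology is generated by seminorm balls about arbitrary centres; the triangle inequality puts a
  ball about \<open>l\<close> into each of them that contains \<open>l\<close>.\<close>

lemma limitin_seminorm_topology:
  assumes ne: "Q \<noteq> {}"
    and zero: "\<And>q. q \<in> Q \<Longrightarrow> q (vzero X) = 0"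
    and triangle: "\<And>q x y. \<lbrakk>q \<in> Q; x \<in> pts X; y \<in> pts X\<rbrakk> \<Longrightarrow> q (vadd X x y) \<le> q x + q y"
    and x: "range x \<subseteq> pts X" and l: "l \<in> pts X"
  shows "limitin (seminorm_topology X Q) x l sequentially \<longleftrightarrow>
     (\<forall>q\<in>Q. \<forall>e>0. \<forall>\<^sub>F n in sequentially. q (vminus X (x n) l) < e)"
proof -
  have x': "x n \<in> pts X" for n using x by auto
  define S where "S = {{y \<in> pts X. q (vminus X y x) < \<epsilon>} |q x \<epsilon>. q \<in> Q \<and> x \<in> pts X \<and> 0 < \<epsilon>}"
  have S_I: "{y \<in> pts X. q (vminus X y l) < e} \<in> S" if "q \<in> Q" "e > 0" for q e
    unfolding S_def using that l by blast
  have mem: "l \<in> {y \<in> pts X. q (vminus X y l) < e}" if "q \<in> Q" "e > 0" for q e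
    using that l zero[OF that(1)] by simp
  have lim: "limitin (seminorm_topology X Q) x l sequentially \<longleftrightarrow>
      l \<in> \<Union>S \<and> (\<forall>U\<in>S. l \<in> U \<longrightarrow> (\<forall>\<^sub>F n in sequentially. x n \<in> U))"
    unfolding seminorm_topology_def S_def[symmetric] by (rule limitin_topology_generated_by)
  show ?thesis
    unfolding lim
  proof (intro iffI conjI ballI allI impI; (elim conjE)?)
    fix q and e :: real
    assume "\<forall>U\<in>S. l \<in> U \<longrightarrow> (\<forall>\<^sub>F n in sequentially. x n \<in> U)" and q: "q \<in> Q" "e > 0"
    from bspec[OF this(1) S_I[OF q]] mem[OF q]
    show "\<forall>\<^sub>F n in sequentially. q (vminus X (x n) l) < e" using x' l zero[OF q(1)] q(2) by simp
  next
    obtain q where "q \<in> Q" using ne by blast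
    then show "l \<in> \<Union>S" using S_I[of q 1] mem[of q 1] by (meson UnionI zero_less_one)
  next
    fix U assume H: "\<forall>q\<in>Q. \<forall>e>0. \<forall>\<^sub>F n in sequentially. q (vminus X (x n) l) < e"
      and "U \<in> S" and lU: "l \<in> U"
    then obtain q z e where U: "U = {y \<in> pts X. q (vminus X y z) < e}" and q: "q \<in> Q" and z: "z \<in> pts X"
      unfolding S_def by auto
    have "\<forall>\<^sub>F n in sequentially. q (vminus X (x n) l) < e - q (vminus X l z)"
      using H q lU U by simp
    then show "\<forall>\<^sub>F n in sequentially. x n \<in> U"
    proof (rule eventually_mono)
      fix n assume "q (vminus X (x n) l) < e - q (vminus X l z)"
      then show "x n \<in> U"
        using triangle[OF q vminus_closed[OF x' l] vminus_closed[OF l z], of n] vminus_add_vminus[OF x' l z, of n] x'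
        by (simp add: U)
    qed
  qed
qed

end

section \<open>The Hahn-Banach theorem\<close>

context normed_vspace
begin

definition sublinear :: "('v \<Rightarrow> real) \<Rightarrow> bool" where
  "sublinear q \<longleftrightarrow>
     (\<forall>x\<in>pts X. \<forall>y\<in>pts X. q (vadd X x y) \<le> q x + q y) \<and>
     (\<forall>x\<in>pts X. \<forall>t>0. q (vscale X (of_real t) x) = t * q x) \<and> (\<forall>x. x \<notin> pts X \<longrightarrow> q x = 0)"

lemma sublinearI:
  assumes "\<And>x y. \<lbrakk>x \<in> pts X; y \<in> pts X\<rbrakk> \<Longrightarrow> q (vadd X x y) \<le> q x + q y"
    and le: "\<And>x t. \<lbrakk>x \<in> pts X; 0 < t\<rbrakk> \<Longrightarrow> q (vscale X (of_real t) x) \<le> t * q x"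
    and "\<And>x. x \<notin> pts X \<Longrightarrow> q x = 0"
  shows "sublinear q"
proof -
  have "q (vscale X (of_real t) x) = t * q x" if x: "x \<in> pts X" and t: "0 < t" for x t
  proof (rule antisym)
    have "q (vscale X (of_real (1 / t)) (vscale X (of_real t) x)) \<le> 1 / t * q (vscale X (of_real t) x)"
      using le[of "vscale X (of_real t) x" "1 / t"] x t scale_closed by simp
    also have "vscale X (of_real (1 / t)) (vscale X (of_real t) x) = x"
      using x t by (simp add: scale_scale scale_one flip: of_real_mult)
    finally show "t * q x \<le> q (vscale X (of_real t) x)" using t by (simp add: field_simps)
  qed (use le x t in blast)
  then show ?thesis using assms unfolding sublinear_def by blast
qed

lemma sublinear_add: "\<lbrakk>sublinear q; x \<in> pts X; y \<in> pts X\<rbrakk> \<Longrightarrow> q (vadd X x y) \<le> q x + q y"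
  by (simp add: sublinear_def)

lemma sublinear_scale: "\<lbrakk>sublinear q; x \<in> pts X; 0 < t\<rbrakk> \<Longrightarrow> q (vscale X (of_real t) x) = t * q x"
  by (simp add: sublinear_def)

lemma sublinear_outside: "\<lbrakk>sublinear q; x \<notin> pts X\<rbrakk> \<Longrightarrow> q x = 0"
  by (simp add: sublinear_def)

lemma sublinear_vzero: "sublinear q \<Longrightarrow> q (vzero X) = 0"
  using sublinear_scale[of q "vzero X" 2] zero_closed scale_vzero by simp

lemma sublinear_scale_nonneg:
  "\<lbrakk>sublinear q; x \<in> pts X; 0 \<le> t\<rbrakk> \<Longrightarrow> q (vscale X (of_real t) x) = t * q x"
  using sublinear_scale[of q x t] sublinear_vzero[of q] by (cases "t = 0") auto

lemma sublinear_lower: "\<lbrakk>sublinear q; x \<in> pts X\<rbrakk> \<Longrightarrow> - q (vscale X (- 1) x) \<le> q x"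
  using sublinear_add[of q x "vscale X (- 1) x"] sublinear_vzero[of q] vminus_self[of x] scale_closed
  by (simp add: vminus_def)

text \<open>
  Taking the infimum along the ray through \<open>x\<close> gives a smaller sublinear functional whose value at
  \<open>-x\<close> is at most \<open>- q x\<close>.  A minimal sublinear functional is not changed by this, hence it is odd, and
  odd sublinear functionals are linear.\<close>

definition ray_inf :: "('v \<Rightarrow> real) \<Rightarrow> 'v \<Rightarrow> 'v \<Rightarrow> real" where
  "ray_inf q x y = (if y \<in> pts X then INF t\<in>{0..}. q (vadd X y (vscale X (of_real t) x)) - t * q x else 0)"

context
  fixes q x assumes q: "sublinear q" and x: "x \<in> pts X"
begin

lemma ray_inf_bdd: "y \<in> pts X \<Longrightarrow> bdd_below ((\<lambda>t. q (vadd X y (vscale X (of_real t) x)) - t * q x) ` {0..})"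
proof (rule bdd_belowI2)
  fix t :: real assume y: "y \<in> pts X" and "t \<in> {0..}"
  then have t: "0 \<le> t" by simp
  define z where "z = vscale X (of_real t) x"
  have z: "z \<in> pts X" using x by (simp add: z_def scale_closed)
  have "vadd X (vadd X y z) (vscale X (- 1) y) = z"
    using y z by (metis add_vminus_cancel add_assoc add_commute add_closed scale_closed vminus_def)
  then have "q z \<le> q (vadd X y z) + q (vscale X (- 1) y)"
    using sublinear_add[OF q, of "vadd X y z" "vscale X (- 1) y"] y z by (simp add: add_closed scale_closed)
  moreover have "q z = t * q x" using sublinear_scale_nonneg[OF q x t] by (simp add: z_def)
  ultimately show "- q (vscale X (- 1) y) \<le> q (vadd X y (vscale X (of_real t) x)) - t * q x"
    by (simp add: z_def)
qed

lemma ray_inf_le: "\<lbrakk>y \<in> pts X; 0 \<le> t\<rbrakk> \<Longrightarrow> ray_inf q x y \<le> q (vadd X y (vscale X (of_real t) x)) - t * q x"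
  unfolding ray_inf_def using ray_inf_bdd by (auto intro: cINF_lower)

lemma ray_inf_le_self: "y \<in> pts X \<Longrightarrow> ray_inf q x y \<le> q y"
  using ray_inf_le[of y 0] x by (simp add: add_zero)

lemma ray_inf_neg: "ray_inf q x (vscale X (- 1) x) \<le> - q x"
  using ray_inf_le[of "vscale X (- 1) x" 1] x vminus_self[OF x] sublinear_vzero[OF q]
  by (simp add: scale_closed scale_one vminus_def add_commute)

lemma ray_inf_greatest:
  assumes "y \<in> pts X" "\<And>t. 0 \<le> t \<Longrightarrow> c \<le> q (vadd X y (vscale X (of_real t) x)) - t * q x"
  shows "c \<le> ray_inf q x y"
  unfolding ray_inf_def using assms by (auto intro!: cINF_greatest)

lemma sublinear_ray_inf: "sublinear (ray_inf q x)"
proof (rule sublinearI)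
  fix y z assume y: "y \<in> pts X" and z: "z \<in> pts X"
  have "ray_inf q x (vadd X y z) - (q (vadd X y (vscale X (of_real s) x)) - s * q x) \<le> ray_inf q x z"
    if s: "0 \<le> s" for s
  proof (rule ray_inf_greatest[OF z])
    fix t :: real assume t: "0 \<le> t"
    define xs xt where "xs = vscale X (of_real s) x" and "xt = vscale X (of_real t) x"
    have c: "xs \<in> pts X" "xt \<in> pts X" using x by (auto simp: xs_def xt_def scale_closed)
    have "vadd X (vadd X y z) (vscale X (of_real (s + t)) x) = vadd X (vadd X y z) (vadd X xs xt)"
      using x by (simp add: xs_def xt_def scale_add_left)
    also have "\<dots> = vadd X (vadd X y xs) (vadd X z xt)"
      using y z c by (metis add_assoc add_commute add_closed)
    finally have "q (vadd X (vadd X y z) (vscale X (of_real (s + t)) x)) \<le> q (vadd X y xs) + q (vadd X z xt)"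
      using sublinear_add[OF q, of "vadd X y xs" "vadd X z xt"] y z c by (simp add: add_closed)
    then show "ray_inf q x (vadd X y z) - (q (vadd X y (vscale X (of_real s) x)) - s * q x)
        \<le> q (vadd X z (vscale X (of_real t) x)) - t * q x"
      using ray_inf_le[of "vadd X y z" "s + t"] y z s t
      by (simp add: add_closed xs_def xt_def algebra_simps)
  qed
  then have "ray_inf q x (vadd X y z) - ray_inf q x z \<le> ray_inf q x y"
    by (intro ray_inf_greatest[OF y]) (simp add: algebra_simps)
  then show "ray_inf q x (vadd X y z) \<le> ray_inf q x y + ray_inf q x z" by simp
next
  fix y and r :: real assume y: "y \<in> pts X" and r: "0 < r"
  have "ray_inf q x (vscale X (of_real r) y) / r \<le> ray_inf q x y"
  proof (rule ray_inf_greatest[OF y])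
    fix t :: real assume t: "0 \<le> t"
    have "vscale X (of_real r) (vadd X y (vscale X (of_real t) x))
        = vadd X (vscale X (of_real r) y) (vscale X (of_real (r * t)) x)"
      using x y by (simp add: scale_add_right scale_closed scale_scale)
    then have "q (vadd X (vscale X (of_real r) y) (vscale X (of_real (r * t)) x))
        = r * q (vadd X y (vscale X (of_real t) x))"
      using sublinear_scale[OF q _ r, of "vadd X y (vscale X (of_real t) x)"] x y
      by (simp add: add_closed scale_closed)
    then have "ray_inf q x (vscale X (of_real r) y) \<le> r * q (vadd X y (vscale X (of_real t) x)) - r * t * q x"
      using ray_inf_le[of "vscale X (of_real r) y" "r * t"] y r t by (simp add: scale_closed)
    then show "ray_inf q x (vscale X (of_real r) y) / r \<le> q (vadd X y (vscale X (of_real t) x)) - t * q x"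
      using r by (simp add: field_simps)
  qed
  then show "ray_inf q x (vscale X (of_real r) y) \<le> r * ray_inf q x y"
    using r by (simp add: field_simps)
qed (simp add: ray_inf_def)

end

text \<open>Zorn's lemma: the pointwise infimum of a chain is finite because every sublinear \<open>q \<le> p\<close> satisfies
  \<open>- p (- x) \<le> - q (- x) \<le> q x\<close>, and it is subadditive because any two members of a chain have a common
  lower bound in it.\<close>

lemma minimal_sublinear_exists:
  assumes p: "sublinear p"
  obtains m where "sublinear m" "m \<le> p" "\<And>q. \<lbrakk>sublinear q; q \<le> m\<rbrakk> \<Longrightarrow> q = m"
proof -
  define A where "A = {q. sublinear q \<and> q \<le> p}"
  have "\<exists>m\<in>A. \<forall>a\<in>A. a \<le> m \<longrightarrow> a = m"
  proof (rule predicate_Zorn[where P="\<lambda>a b. b \<le> a"])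
    show "partial_order_on A (relation_of (\<lambda>a b. b \<le> a) A)"
      by (rule partial_order_on_relation_ofI) auto
    fix C assume C: "C \<in> Chains (relation_of (\<lambda>a b. b \<le> a) A)"
    have CA: "C \<subseteq> A" and chain: "\<And>a b. \<lbrakk>a \<in> C; b \<in> C\<rbrakk> \<Longrightarrow> a \<le> b \<or> b \<le> a"
      using C by (auto simp: Chains_def relation_of_def)
    show "\<exists>u\<in>A. \<forall>a\<in>C. u \<le> a"
    proof (cases "C = {}")
      case True then show ?thesis using p by (intro bexI[of _ p]) (auto simp: A_def)
    next
      case False
      define u where "u = (\<lambda>x. INF a\<in>C. a x)"
      have bdd: "bdd_below ((\<lambda>a. a x) ` C)" for x
      proof (rule bdd_belowI2)
        fix a assume "a \<in> C"
        then have a: "sublinear a" "a \<le> p" using CA by (auto simp: A_def)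
        show "(if x \<in> pts X then - p (vscale X (- 1) x) else 0) \<le> a x"
          using sublinear_lower[OF a(1), of x] le_funD[OF a(2), of "vscale X (- 1) x"] sublinear_outside[OF a(1), of x]
          by auto
      qed
      have u_le: "u x \<le> a x" if "a \<in> C" for a x
        unfolding u_def by (rule cINF_lower[OF bdd that])
      have u_greatest: "c \<le> u x" if "\<And>a. a \<in> C \<Longrightarrow> c \<le> a x" for c x
        unfolding u_def by (rule cINF_greatest[OF False that])
      have "sublinear u"
      proof (rule sublinearI)
        fix x y assume x: "x \<in> pts X" and y: "y \<in> pts X"
        have "u (vadd X x y) - a x \<le> b y" if ab: "a \<in> C" "b \<in> C" for a b
        proof -
          obtain c where c: "c \<in> C" "c \<le> a" "c \<le> b" using chain[OF ab] ab by blast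
          have "u (vadd X x y) \<le> c x + c y"
            using u_le[OF c(1), of "vadd X x y"] sublinear_add[of c x y] c(1) CA x y by (auto simp: A_def)
          then show ?thesis using le_funD[OF c(2), of x] le_funD[OF c(3), of y] by linarith
        qed
        then have "u (vadd X x y) - a x \<le> u y" if "a \<in> C" for a using that by (intro u_greatest) auto
        then have "u (vadd X x y) - u y \<le> u x" by (intro u_greatest) (simp add: algebra_simps)
        then show "u (vadd X x y) \<le> u x + u y" by simp
      next
        fix x and t :: real assume x: "x \<in> pts X" and t: "0 < t"
        have "u (vscale X (of_real t) x) / t \<le> u x"
        proof (rule u_greatest)
          fix a assume a: "a \<in> C"
          then have "u (vscale X (of_real t) x) \<le> t * a x"
            using u_le[OF a, of "vscale X (of_real t) x"] sublinear_scale[of a x t] CA x t by (auto simp: A_def)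
          then show "u (vscale X (of_real t) x) / t \<le> a x" using t by (simp add: field_simps)
        qed
        then show "u (vscale X (of_real t) x) \<le> t * u x" using t by (simp add: field_simps)
      next
        fix x assume "x \<notin> pts X"
        then have "a x = 0" if "a \<in> C" for a using that CA sublinear_outside by (auto simp: A_def)
        then have "(\<lambda>a. a x) ` C = {0}" using False by (auto simp: image_def)
        then show "u x = 0" by (simp add: u_def)
      qed
      moreover have "u \<le> p"
      proof (rule le_funI)
        fix x obtain a where "a \<in> C" using False by blast
        then show "u x \<le> p x" using u_le[of a x] CA le_funD[of a p x] by (force simp: A_def)
      qed
      ultimately show ?thesis using u_le by (intro bexI[of _ u]) (auto simp: A_def le_fun_def)
    qed
  qed
  then obtain m where "m \<in> A" "\<And>a. \<lbrakk>a \<in> A; a \<le> m\<rbrakk> \<Longrightarrow> a = m" by blast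
  then show ?thesis using that[of m] by (auto simp: A_def intro: order_trans)
qed

lemma minimal_sublinear_linear:
  assumes m: "sublinear m" and min: "\<And>q. \<lbrakk>sublinear q; q \<le> m\<rbrakk> \<Longrightarrow> q = m"
  shows "\<lbrakk>x \<in> pts X; y \<in> pts X\<rbrakk> \<Longrightarrow> m (vadd X x y) = m x + m y"
    and "x \<in> pts X \<Longrightarrow> m (vscale X (of_real r) x) = r * m x"
proof -
  have neg: "m (vscale X (- 1) x) = - m x" if x: "x \<in> pts X" for x
  proof -
    have "ray_inf m x y \<le> m y" for y
      using ray_inf_le_self[OF m x, of y] sublinear_outside[OF m, of y] by (cases "y \<in> pts X") (auto simp: ray_inf_def)
    then have "ray_inf m x = m" using min[OF sublinear_ray_inf[OF m x]] by (simp add: le_fun_def)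
    then have "m (vscale X (- 1) x) \<le> - m x" using ray_inf_neg[OF m x] by simp
    then show ?thesis using sublinear_lower[OF m x] by linarith
  qed
  show "m (vadd X x y) = m x + m y" if x: "x \<in> pts X" and y: "y \<in> pts X"
  proof -
    have "vscale X (- 1) (vadd X x y) = vadd X (vscale X (- 1) x) (vscale X (- 1) y)"
      using x y by (rule scale_add_right)
    then have "- m (vadd X x y) \<le> - m x - m y"
      using neg[OF add_closed[OF x y]] neg[OF x] neg[OF y] sublinear_add[OF m, of "vscale X (- 1) x" "vscale X (- 1) y"]
        scale_closed x y by simp
    then show ?thesis using sublinear_add[OF m x y] by linarith
  qed
  show "m (vscale X (of_real r) x) = r * m x" if x: "x \<in> pts X"
  proof (cases "0 \<le> r")
    case True then show ?thesis using sublinear_scale_nonneg[OF m x] by blast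
  next
    case False
    have "vscale X (of_real r) x = vscale X (- 1) (vscale X (of_real (- r)) x)"
      using x by (simp add: scale_scale)
    then show ?thesis
      using neg[of "vscale X (of_real (- r)) x"] sublinear_scale_nonneg[OF m x, of "- r"] False x
      by (simp add: scale_closed)
  qed
qed

text \<open>
  Below the functional \<open>ray_inf p x0\<close> there is a real-linear \<open>m\<close>, and \<open>m (- x0) \<le> - p x0\<close> forces
  \<open>m x0 = p x0\<close>.  A functional over the field is recovered from its real part \<open>m\<close>: its value at \<open>x\<close>
  represents the real-linear map \<open>c \<mapsto> m (c x)\<close> of the field.\<close>

theorem Hahn_Banach_seminorm:
  assumes add: "\<And>x y. \<lbrakk>x \<in> pts X; y \<in> pts X\<rbrakk> \<Longrightarrow> p (vadd X x y) \<le> p x + p y"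
    and scale: "\<And>c x. x \<in> pts X \<Longrightarrow> p (vscale X c x) = norm c * p x"
    and le: "\<And>x. x \<in> pts X \<Longrightarrow> p x \<le> vnorm X x"
    and x0: "x0 \<in> pts X"
  obtains f where "f \<in> unit_ball (dual X)" "f x0 = of_real (p x0)" "\<And>x. x \<in> pts X \<Longrightarrow> norm (f x) \<le> p x"
proof -
  define p0 where "p0 = (\<lambda>x. if x \<in> pts X then p x else 0)"
  have p0: "sublinear p0"
    by (rule sublinearI) (auto simp: p0_def add_closed scale_closed add scale)
  obtain m where m: "sublinear m" "m \<le> ray_inf p0 x0" "\<And>q. \<lbrakk>sublinear q; q \<le> m\<rbrakk> \<Longrightarrow> q = m"
    using minimal_sublinear_exists[OF sublinear_ray_inf[OF p0 x0]] by blast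
  have lin: "\<lbrakk>x \<in> pts X; y \<in> pts X\<rbrakk> \<Longrightarrow> m (vadd X x y) = m x + m y"
    "x \<in> pts X \<Longrightarrow> m (vscale X (of_real r) x) = r * m x" for x y r
    using minimal_sublinear_linear(1)[of m x y] minimal_sublinear_linear(2)[of m x r] m by simp_all
  have m_le: "m x \<le> p x" if "x \<in> pts X" for x
    using le_funD[OF m(2), of x] ray_inf_le_self[OF p0 x0 that] that by (simp add: p0_def)
  have m_x0: "m x0 = p x0"
  proof (rule antisym[OF m_le[OF x0]])
    have "m (vscale X (- 1) x0) \<le> - p x0"
      using le_funD[OF m(2), of "vscale X (- 1) x0"] ray_inf_neg[OF p0 x0] x0 by (simp add: p0_def)
    then show "p x0 \<le> m x0" using sublinear_lower[OF m(1) x0] by linarith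
  qed
  have "\<exists>k. \<forall>c. m (vscale X c x) = re (c * k)" if x: "x \<in> pts X" for x
  proof (rule real_linear_scalar_functional)
    show "m (vscale X (a + b) x) = m (vscale X a x) + m (vscale X b x)" for a b
      using lin(1)[of "vscale X a x" "vscale X b x"] x by (simp add: scale_add_left scale_closed)
    show "m (vscale X (of_real r * a) x) = r * m (vscale X a x)" for r a
      using lin(2)[of "vscale X a x" r] x by (simp add: scale_scale scale_closed)
  qed
  then obtain g where g: "\<And>x c. x \<in> pts X \<Longrightarrow> m (vscale X c x) = re (c * g x)" by metis
  define f where "f = (\<lambda>x. if x \<in> pts X then g x else 0)"
  have f: "re (c * f x) = m (vscale X c x)" if "x \<in> pts X" for x c
    using g that by (simp add: f_def)
  have bound: "norm (f x) \<le> p x" if x: "x \<in> pts X" for x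
  proof -
    obtain c where c: "norm c = 1" "c * f x = of_real (norm (f x))" using exists_unit_rotation by blast
    then have "norm (f x) = m (vscale X c x)" using f[OF x, of c] by simp
    also have "\<dots> \<le> p x" using m_le[of "vscale X c x"] scale[OF x, of c] c x by (simp add: scale_closed)
    finally show ?thesis .
  qed
  show ?thesis
  proof
    show "f \<in> unit_ball (dual X)"
    proof (rule dual_ballI)
      show "f (vadd X x y) = f x + f y" if "x \<in> pts X" "y \<in> pts X" for x y
      proof (rule scalar_eqI_re)
        fix c
        show "re (c * f (vadd X x y)) = re (c * (f x + f y))"
          using that lin(1)[OF scale_closed[OF that(1), of c] scale_closed[OF that(2), of c]]
          by (simp only: f add_closed scale_add_right distrib_left re_add)
      qed
      show "f (vscale X c x) = c * f x" if "x \<in> pts X" for c x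
      proof (rule scalar_eqI_re)
        fix b
        show "re (b * f (vscale X c x)) = re (b * (c * f x))"
          using that by (simp only: f scale_closed scale_scale mult.assoc[symmetric])
      qed
      show "f x = 0" if "x \<notin> pts X" for x using that by (simp add: f_def)
      show "norm (f x) \<le> vnorm X x" if "x \<in> pts X" for x using bound[OF that] le[OF that] by linarith
    qed
    show "norm (f x) \<le> p x" if "x \<in> pts X" for x by (rule bound[OF that])
    have re: "re (f x0) = p x0" using f[OF x0, of 1] m_x0 x0 by (simp add: scale_one)
    have "cmod (emb (f x0)) \<le> Re (emb (f x0))" using bound[OF x0] re by (simp add: re_def)
    then have "(cmod (emb (f x0)))\<^sup>2 \<le> (Re (emb (f x0)))\<^sup>2" by (intro power_mono) auto
    then have "Im (emb (f x0)) = 0" using cmod_power2[of "emb (f x0)"] by simp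
    then have "emb (f x0) = of_real (Re (emb (f x0)))" by (simp add: complex_eq_iff)
    then show "f x0 = of_real (p x0)" using re by (metis emb_of_real inj_emb re_def)
  qed
qed

corollary norming_functional:
  assumes "x \<in> pts X"
  obtains f where "f \<in> unit_ball (dual X)" "f x = of_real (vnorm X x)"
  by (rule Hahn_Banach_seminorm[of "vnorm X" x]) (use norm_triangle norm_scale assms that in auto)

corollary functionals_separate:
  assumes "x \<in> pts X" "y \<in> pts X" "\<And>f. f \<in> unit_ball (dual X) \<Longrightarrow> f x = f y"
  shows "x = y"
proof -
  obtain f where f: "f \<in> unit_ball (dual X)" "f (vminus X x y) = of_real (vnorm X (vminus X x y))"
    using norming_functional[OF vminus_closed[OF assms(1,2)]] by blast
  then have "of_real (vnorm X (vminus X x y)) = (0 :: 'k)"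
    using assms(3)[OF f(1)] dual_vminus[OF ball_subset_pts[OF f(1)] assms(1,2)] by simp
  then show ?thesis using assms norm_eq_zero[OF vminus_closed] vminus_eq_zero by simp
qed

corollary norm_le_by_functionals:
  assumes "x \<in> pts X" "\<And>f. f \<in> unit_ball (dual X) \<Longrightarrow> norm (f x) \<le> C"
  shows "vnorm X x \<le> C"
proof -
  obtain f where f: "f \<in> unit_ball (dual X)" "f x = of_real (vnorm X x)"
    using norming_functional[OF assms(1)] by blast
  then show ?thesis using assms(2)[OF f(1)] norm_nonneg[OF assms(1)] by simp
qed

text \<open>The seminorm to dominate is the distance to \<open>Z\<close>: the functional that it bounds vanishes on \<open>Z\<close>, and
  at \<open>x\<close> it equals the distance of \<open>x\<close>.\<close>

corollary separation_from_subspace: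
  assumes Z: "Z \<subseteq> pts X" "Z \<noteq> {}" "\<And>x y. \<lbrakk>x \<in> Z; y \<in> Z\<rbrakk> \<Longrightarrow> vadd X x y \<in> Z"
      "\<And>c x. x \<in> Z \<Longrightarrow> vscale X c x \<in> Z"
    and x: "x \<in> pts X" and zero: "\<And>f. \<lbrakk>f \<in> unit_ball (dual X); \<forall>z\<in>Z. f z = 0\<rbrakk> \<Longrightarrow> f x = 0"
    and e: "0 < e"
  shows "\<exists>z\<in>Z. vnorm X (vminus X x z) < e"
proof -
  have Zpts: "z \<in> pts X" if "z \<in> Z" for z using that Z(1) by blast
  have Z0: "vzero X \<in> Z" using Z(2) Z(4)[of _ 0] Zpts zero_scale by (metis ex_in_conv)
  define p where "p = (\<lambda>y. INF z\<in>Z. vnorm X (vminus X y z))"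
  have bdd: "bdd_below ((\<lambda>z. vnorm X (vminus X y z)) ` Z)" if "y \<in> pts X" for y
    using that Zpts by (auto intro!: bdd_belowI2[of _ 0] norm_nonneg vminus_closed)
  have p_le: "p y \<le> vnorm X (vminus X y z)" if "y \<in> pts X" "z \<in> Z" for y z
    unfolding p_def by (rule cINF_lower[OF bdd[OF that(1)] that(2)])
  have p_greatest: "c \<le> p y" if "\<And>z. z \<in> Z \<Longrightarrow> c \<le> vnorm X (vminus X y z)" for c y
    unfolding p_def by (rule cINF_greatest[OF Z(2) that])
  have p0: "0 \<le> p y" if "y \<in> pts X" for y
    by (rule p_greatest) (use that Zpts in \<open>simp add: norm_nonneg vminus_closed\<close>)
  have sc: "p (vscale X c y) \<le> norm c * p y" if y: "y \<in> pts X" for c y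
  proof (cases "c = 0")
    case True
    then show ?thesis using p_le[OF zero_closed Z0] y by (simp add: zero_closed)
  next
    case False
    have "p (vscale X c y) / norm c \<le> p y"
    proof (rule p_greatest)
      fix z assume z: "z \<in> Z"
      have "vminus X (vscale X c y) (vscale X c z) = vscale X c (vminus X y z)"
        using y Zpts[OF z] by (simp add: vminus_def scale_add_right scale_scale scale_closed)
      then have "p (vscale X c y) \<le> norm c * vnorm X (vminus X y z)"
        using p_le[OF scale_closed[OF y] Z(4)[OF z], of c c] y Zpts[OF z] by (simp add: norm_scale vminus_closed)
      then show "p (vscale X c y) / norm c \<le> vnorm X (vminus X y z)" using False by (simp add: field_simps)
    qed
    then show ?thesis using False by (simp add: field_simps)
  qed
  obtain f where f: "f \<in> unit_ball (dual X)" "f x = of_real (p x)" "\<And>y. y \<in> pts X \<Longrightarrow> norm (f y) \<le> p y"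
  proof (rule Hahn_Banach_seminorm[of p x])
    fix y z assume y: "y \<in> pts X" and z: "z \<in> pts X"
    have "p (vadd X y z) - vnorm X (vminus X y a) \<le> vnorm X (vminus X z b)" if ab: "a \<in> Z" "b \<in> Z" for a b
    proof -
      have "vminus X (vadd X y z) (vadd X a b) = vadd X (vadd X y z) (vadd X (vscale X (- 1) a) (vscale X (- 1) b))"
        using Zpts ab by (simp add: vminus_def scale_add_right)
      also have "\<dots> = vadd X (vminus X y a) (vminus X z b)"
        unfolding vminus_def using y z Zpts[OF ab(1)] Zpts[OF ab(2)]
        by (metis (no_types, lifting) add_assoc add_commute add_closed scale_closed)
      finally show ?thesis
        using p_le[OF add_closed[OF y z] Z(3)[OF ab]]
          norm_triangle[of "vminus X y a" "vminus X z b"] y z Zpts ab by (simp add: vminus_closed)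
    qed
    then have "p (vadd X y z) - vnorm X (vminus X y a) \<le> p z" if "a \<in> Z" for a using that by (intro p_greatest)
    then have "p (vadd X y z) - p z \<le> p y" by (intro p_greatest) (simp add: algebra_simps)
    then show "p (vadd X y z) \<le> p y + p z" by simp
  next
    fix c y assume y: "y \<in> pts X"
    show "p (vscale X c y) = norm c * p y"
    proof (cases "c = 0")
      case True
      then show ?thesis using sc[OF y, of c] p0[OF scale_closed[OF y], of c] by simp
    next
      case False
      have "vscale X (inverse c) (vscale X c y) = y" using False y by (simp add: scale_scale scale_one)
      then have "p y \<le> norm (inverse c) * p (vscale X c y)" using sc[OF scale_closed[OF y], of "inverse c" c] by simp
      then have "norm c * p y \<le> p (vscale X c y)" using False by (simp add: norm_inverse norm_divide field_simps)
      then show ?thesis using sc[OF y, of c] by simp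
    qed
  next
    show "p y \<le> vnorm X y" if "y \<in> pts X" for y using p_le[OF that Z0] that by simp
  qed (use x in auto)
  have "f z = 0" if z: "z \<in> Z" for z
    using order_trans[OF f(3)[OF Zpts[OF z]] p_le[OF Zpts[OF z] z]] Zpts[OF z] by simp
  then have "p x = 0" using zero[OF f(1)] f(2) by simp
  show ?thesis
  proof (rule ccontr)
    assume "\<not> ?thesis"
    then have "e \<le> p x" by (intro p_greatest) (force simp: not_less)
    then show False using \<open>p x = 0\<close> e by simp
  qed
qed

end

section \<open>Sequences of exponent \<open>p\<close>\<close>

lemma conjugate_exponent:
  assumes "1 < p"
  shows "1 < conjugate_exponent p" "1 / p + 1 / conjugate_exponent p = 1"
    "conjugate_exponent (conjugate_exponent p) = p"
proof -
  show *: "1 < conjugate_exponent p" using assms by (simp add: conjugate_exponent_def field_simps)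
  show "1 / p + 1 / conjugate_exponent p = 1" using assms by (simp add: conjugate_exponent_def field_simps)
  show "conjugate_exponent (conjugate_exponent p) = p"
    using assms by (simp add: conjugate_exponent_def divide_simps)
qed

lemma finite_Holder:
  fixes a b :: "'i \<Rightarrow> real"
  assumes p: "1 < p" and a: "\<And>i. i \<in> I \<Longrightarrow> 0 \<le> a i" and b: "\<And>i. i \<in> I \<Longrightarrow> 0 \<le> b i"
    and A: "(\<Sum>i\<in>I. a i powr conjugate_exponent p) \<le> A powr conjugate_exponent p" "0 \<le> A"
    and B: "(\<Sum>i\<in>I. b i powr p) \<le> B powr p" "0 \<le> B"
  shows "(\<Sum>i\<in>I. a i * b i) \<le> A * B"
proof (cases "finite I")
  case fin: True
  define q where "q = conjugate_exponent p"
  have q: "1 < q" "1 / q + 1 / p = 1" using conjugate_exponent[OF p] by (auto simp: q_def)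
  show ?thesis
  proof (cases "A = 0 \<or> B = 0")
    case True
    have "a i * b i = 0" if i: "i \<in> I" for i
    proof -
      have "a i powr q \<le> A powr q"
        using A(1) member_le_sum[OF i _ fin, of "\<lambda>i. a i powr q"] by (simp add: q_def)
      moreover have "b i powr p \<le> B powr p"
        using B(1) member_le_sum[OF i _ fin, of "\<lambda>i. b i powr p"] by simp
      ultimately show ?thesis using True by auto
    qed
    then have "(\<Sum>i\<in>I. a i * b i) = 0" by (intro sum.neutral) blast
    then show ?thesis using True by auto
  next
    case False
    then have pos: "0 < A" "0 < B" using A B by auto
    have "a i * b i \<le> A * B * ((a i powr q / A powr q) / q + (b i powr p / B powr p) / p)" if i: "i \<in> I" for i
    proof -
      have "(a i / A) * (b i / B) \<le> (a i / A) powr q / q + (b i / B) powr p / p"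
        using Youngs_inequality[OF q(1) p q(2), of "a i / A" "b i / B"] a[OF i] b[OF i] pos by simp
      then have "A * B * ((a i / A) * (b i / B)) \<le> A * B * ((a i / A) powr q / q + (b i / B) powr p / p)"
        using pos by (intro mult_left_mono) auto
      then show ?thesis using pos a[OF i] b[OF i] by (simp add: powr_divide)
    qed
    then have "(\<Sum>i\<in>I. a i * b i) \<le> (\<Sum>i\<in>I. A * B * ((a i powr q / A powr q) / q + (b i powr p / B powr p) / p))"
      by (rule sum_mono)
    also have "\<dots> = A * B * ((\<Sum>i\<in>I. a i powr q) / A powr q / q + (\<Sum>i\<in>I. b i powr p) / B powr p / p)"
      by (simp only: sum_distrib_left[symmetric] sum.distrib sum_divide_distrib[symmetric])
    also have "\<dots> \<le> A * B * (1 / q + 1 / p)"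
      using A(1) B(1) pos q(1) p
      by (intro mult_left_mono add_mono divide_right_mono) (auto simp: q_def)
    also have "\<dots> = A * B" using q(2) by simp
    finally show ?thesis .
  qed
qed (use A B in simp)

text \<open>
  Equality in Hoelder's inequality is attained at \<open>a i = |b i|\<^sup>p / (s\<^sup>1\<^sup>/\<^sup>q b i)\<close>, where \<open>s\<close> is the sum of
  the \<open>|b i|\<^sup>p\<close>.\<close>

lemma Holder_extremal:
  fixes b :: "'i \<Rightarrow> 'k::real_or_complex"
  assumes p: "1 < p" and fin: "finite I"
  obtains a where "(\<Sum>i\<in>I. norm (a i) powr conjugate_exponent p) \<le> 1"
    "(\<Sum>i\<in>I. a i * b i) = of_real ((\<Sum>i\<in>I. norm (b i) powr p) powr (1 / p))"
proof -
  define q where "q = conjugate_exponent p"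
  have q: "1 < q" "1 / p + 1 / q = 1" using conjugate_exponent[OF p] by (auto simp: q_def)
  define s where "s = (\<Sum>i\<in>I. norm (b i) powr p)"
  have s0: "0 \<le> s" unfolding s_def by (rule sum_nonneg) simp
  show ?thesis
  proof (cases "s = 0")
    case True
    then show ?thesis by (intro that[of "\<lambda>_. 0"]) (simp_all add: s_def[symmetric])
  next
    case False
    then have s: "0 < s" using s0 by simp
    define a where "a = (\<lambda>i. of_real (norm (b i) powr p / s powr (1 / q)) / b i)"
    have ab: "a i * b i = of_real (norm (b i) powr p / s powr (1 / q))" for i
      using p by (cases "b i = 0") (simp_all add: a_def)
    have na: "norm (a i) powr q = norm (b i) powr p / s" for i
    proof (cases "b i = 0")
      case True then show ?thesis using p q(1) by (simp add: a_def)
    next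
      case False
      have "norm (a i) = norm (b i) powr (p - 1) / s powr (1 / q)"
        using False by (simp add: a_def norm_divide norm_mult powr_diff)
      then have "norm (a i) powr q = norm (b i) powr ((p - 1) * q) / s powr (1 / q * q)"
        using s by (simp add: powr_divide powr_powr)
      moreover have "(p - 1) * q = p" "1 / q * q = 1"
        using p q(1) by (auto simp: q_def conjugate_exponent_def)
      ultimately show ?thesis using s by simp
    qed
    show ?thesis
    proof (rule that[of a])
      have "(\<Sum>i\<in>I. norm (a i) powr q) = 1"
        using s unfolding na sum_divide_distrib[symmetric] s_def[symmetric] by simp
      then show "(\<Sum>i\<in>I. norm (a i) powr conjugate_exponent p) \<le> 1" by (simp add: q_def)
      have "(\<Sum>i\<in>I. a i * b i) = of_real (s / s powr (1 / q))"
        unfolding ab of_real_sum[symmetric] sum_divide_distrib[symmetric] s_def[symmetric] ..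
      also have "s / s powr (1 / q) = s powr (1 - 1 / q)" using s by (simp add: powr_diff)
      also have "1 - 1 / q = 1 / p" using q(2) by linarith
      finally show "(\<Sum>i\<in>I. a i * b i) = of_real ((\<Sum>i\<in>I. norm (b i) powr p) powr (1 / p))"
        by (simp add: s_def)
    qed
  qed
qed

lemma powr_convex_nonneg:
  fixes u v :: real
  assumes p: "1 \<le> p" and uv: "0 \<le> u" "0 \<le> v" and t: "0 \<le> t" "t \<le> 1"
  shows "(t * u + (1 - t) * v) powr p \<le> t * u powr p + (1 - t) * v powr p"
proof -
  have le: "s powr p \<le> s" if "0 \<le> s" "s \<le> 1" for s :: real
    using that p powr_mono'[of 1 p s] by (cases "s = 0") auto
  consider "u = 0" | "v = 0" | "0 < u" "0 < v" using uv by linarith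
  then show ?thesis
  proof cases
    case 1
    have "((1 - t) * v) powr p \<le> (1 - t) * v powr p"
      using le[of "1 - t"] t uv by (simp add: powr_mult mult_right_mono)
    then show ?thesis using 1 t uv by simp
  next
    case 2
    have "(t * u) powr p \<le> t * u powr p"
      using le[of t] t uv by (simp add: powr_mult mult_right_mono)
    then show ?thesis using 2 t uv by simp
  next
    case 3
    then show ?thesis using convex_onD[OF powr_convex[OF p], of "1 - t" u v] t by (simp add: algebra_simps)
  qed
qed

text \<open>Convexity of the power function, applied to \<open>a i / A\<close> and \<open>b i / B\<close> with the weights \<open>A / (A + B)\<close>
  and \<open>B / (A + B)\<close>.\<close>

lemma finite_Minkowski:
  fixes a b :: "'i \<Rightarrow> real"
  assumes p: "1 \<le> p" and a: "\<And>i. i \<in> I \<Longrightarrow> 0 \<le> a i" and b: "\<And>i. i \<in> I \<Longrightarrow> 0 \<le> b i"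
    and A: "(\<Sum>i\<in>I. a i powr p) \<le> A powr p" "0 < A"
    and B: "(\<Sum>i\<in>I. b i powr p) \<le> B powr p" "0 < B"
  shows "(\<Sum>i\<in>I. (a i + b i) powr p) \<le> (A + B) powr p"
proof -
  define t where "t = A / (A + B)"
  have t: "0 \<le> t" "t \<le> 1" "1 - t = B / (A + B)" using A B by (auto simp: t_def field_simps)
  have "(a i + b i) powr p \<le> (A + B) powr p * (t * (a i powr p / A powr p) + (1 - t) * (b i powr p / B powr p))"
    if i: "i \<in> I" for i
  proof -
    have "a i + b i = (A + B) * (t * (a i / A) + (1 - t) * (b i / B))"
      unfolding t(3) unfolding t_def using A(2) B(2) by (simp add: distrib_left)
    then have "(a i + b i) powr p = (A + B) powr p * (t * (a i / A) + (1 - t) * (b i / B)) powr p"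
      using A B a[OF i] b[OF i] t by (simp add: powr_mult)
    also have "\<dots> \<le> (A + B) powr p * (t * (a i / A) powr p + (1 - t) * (b i / B) powr p)"
      using A B a[OF i] b[OF i] t p by (intro mult_left_mono powr_convex_nonneg) auto
    finally show ?thesis using A B a[OF i] b[OF i] by (simp add: powr_divide)
  qed
  then have "(\<Sum>i\<in>I. (a i + b i) powr p)
      \<le> (\<Sum>i\<in>I. (A + B) powr p * (t * (a i powr p / A powr p) + (1 - t) * (b i powr p / B powr p)))"
    by (rule sum_mono)
  also have "\<dots> = (A + B) powr p * (t * ((\<Sum>i\<in>I. a i powr p) / A powr p) + (1 - t) * ((\<Sum>i\<in>I. b i powr p) / B powr p))"
    by (simp only: sum_distrib_left[symmetric] sum.distrib sum_divide_distrib[symmetric])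
  also have "\<dots> \<le> (A + B) powr p * (t * 1 + (1 - t) * 1)"
    using A B t by (intro mult_left_mono add_mono) auto
  finally show ?thesis by simp
qed

lemma powr_le_powr_iff: "\<lbrakk>0 \<le> a; 0 \<le> b; 0 < p\<rbrakk> \<Longrightarrow> a powr p \<le> b powr p \<longleftrightarrow> a \<le> (b::real)"
  using powr_mono2[of p a b] powr_less_mono2[of p b a] by fastforce

text \<open>All summability conditions below are used through bounds for finite sums, which avoids extended
  real values and convergence questions.\<close>

lemma lp_norm_le_iff:
  fixes a :: "nat \<Rightarrow> 'k::real_or_complex"
  assumes p: "0 < p" and C: "0 \<le> C"
  shows "lp_norm p a \<le> ennreal C \<longleftrightarrow> (\<forall>N. (\<Sum>n<N. norm (a n) powr p) \<le> C powr p)"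
proof
  assume le: "lp_norm p a \<le> ennreal C"
  then have s: "summable (\<lambda>n. norm (a n) powr p)"
    unfolding lp_norm_def by (auto simp: top_unique split: if_splits)
  then have "(\<Sum>n. norm (a n) powr p) powr (1 / p) \<le> C" using le C by (simp add: lp_norm_def)
  then have "((\<Sum>n. norm (a n) powr p) powr (1 / p)) powr p \<le> C powr p"
    using p by (intro powr_mono2) auto
  then have "(\<Sum>n. norm (a n) powr p) \<le> C powr p" using p by (simp add: powr_powr suminf_nonneg[OF s])
  moreover have "(\<Sum>n<N. norm (a n) powr p) \<le> (\<Sum>n. norm (a n) powr p)" for N
    by (rule sum_le_suminf[OF s]) auto
  ultimately show "\<forall>N. (\<Sum>n<N. norm (a n) powr p) \<le> C powr p" by (meson order_trans)
next
  assume le: "\<forall>N. (\<Sum>n<N. norm (a n) powr p) \<le> C powr p"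
  then have s: "summable (\<lambda>n. norm (a n) powr p)" by (intro summableI_nonneg_bounded[of _ "C powr p"]) auto
  then have "(\<Sum>n. norm (a n) powr p) \<le> C powr p" using le by (intro suminf_le_const) auto
  then have "(\<Sum>n. norm (a n) powr p) powr (1 / p) \<le> (C powr p) powr (1 / p)"
    using p s by (intro powr_mono2 suminf_nonneg) auto
  also have "\<dots> = C" using p C by (simp add: powr_powr)
  finally show "lp_norm p a \<le> ennreal C" using s by (simp add: lp_norm_def ennreal_leI)
qed

section \<open>The space of \<open>p\<close>-summable scalar sequences\<close>

lemma lp_space_simps [simp]:
  "vadd (lp_space p) a b = (\<lambda>n. a n + b n)" "vzero (lp_space p) = (\<lambda>n. 0)"
  "vscale (lp_space p) c a = (\<lambda>n. c * a n)"
  by (simp_all add: lp_space_def)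

lemma vminus_lp_space [simp]: "vminus (lp_space p) a b = (\<lambda>n. a n - b n)"
  by (simp add: vminus_def)

lemma lp_space_norm_le_iff:
  assumes "0 < p" "0 \<le> C"
  shows "a \<in> pts (lp_space p) \<and> vnorm (lp_space p) a \<le> C \<longleftrightarrow> (\<forall>N. (\<Sum>n<N. norm (a n) powr p) \<le> C powr p)"
proof -
  have "a \<in> pts (lp_space p) \<and> vnorm (lp_space p) a \<le> C \<longleftrightarrow> lp_norm p a \<le> ennreal C"
    using assms(2) by (auto simp: lp_space_def enn2real_leI top.not_eq_extremum le_less_trans enn2real_le)
  then show ?thesis using lp_norm_le_iff[OF assms] by blast
qed

lemma lp_space_sum_le:
  assumes "0 < p" "a \<in> pts (lp_space p)"
  shows "(\<Sum>n<N. norm (a n) powr p) \<le> vnorm (lp_space p) a powr p"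
  using lp_space_norm_le_iff[of p "vnorm (lp_space p) a" a] assms by (simp add: lp_space_def)

lemma lp_spaceI:
  assumes "0 < p" "0 \<le> C" "\<And>N. (\<Sum>n<N. norm (a n) powr p) \<le> C powr p"
  shows "a \<in> pts (lp_space p)" "vnorm (lp_space p) a \<le> C"
  using lp_space_norm_le_iff[of p C a] assms by auto

lemma lp_space_norm_nonneg: "0 \<le> vnorm (lp_space p) a"
  by (simp add: lp_space_def)

lemma normed_vspace_lp:
  assumes p: "1 \<le> p"
  shows "normed_vspace (lp_space p :: ('k::real_or_complex, nat \<Rightarrow> 'k) nspace)" (is "normed_vspace ?L")
proof (rule normed_vspace_of_functions[where \<iota>="\<lambda>a. a" and A="pts ?L"])
  have p0: "0 < p" using p by simp
  fix a b :: "nat \<Rightarrow> 'k" and r :: 'k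
  have "(\<lambda>n. 0) \<in> pts ?L" using lp_spaceI(1)[OF p0, of 0 "\<lambda>n. 0"] p0 by simp
  then show "pts ?L \<noteq> {}" by blast
  show "0 \<le> vnorm ?L a" by (rule lp_space_norm_nonneg)
  assume a: "a \<in> pts ?L"
  have "(\<lambda>n. r * a n) \<in> pts ?L \<and> vnorm ?L (\<lambda>n. r * a n) \<le> norm r * vnorm ?L a"
  proof (subst lp_space_norm_le_iff[OF p0])
    show "0 \<le> norm r * vnorm ?L a" by (simp add: lp_space_norm_nonneg)
    show "\<forall>N. (\<Sum>n<N. norm (r * a n) powr p) \<le> (norm r * vnorm ?L a) powr p"
      using lp_space_sum_le[OF p0 a]
      by (auto simp: norm_mult powr_mult lp_space_norm_nonneg simp flip: sum_distrib_left intro!: mult_left_mono)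
  qed
  then show "(\<lambda>n. r * a n) \<in> pts ?L" "vnorm ?L (\<lambda>n. r * a n) \<le> norm r * vnorm ?L a" by auto
  show "a n = 0" if "vnorm ?L a = 0" for n
  proof -
    have "norm (a n) powr p \<le> (\<Sum>n<Suc n. norm (a n) powr p)" by (rule member_le_sum) auto
    also have "\<dots> \<le> 0" using lp_space_sum_le[OF p0 a, of "Suc n"] p0 that by simp
    finally show ?thesis by (metis norm_eq_zero powr_gt_zero not_le)
  qed
  assume b: "b \<in> pts ?L"
  have add: "(\<lambda>n. a n + b n) \<in> pts ?L \<and> vnorm ?L (\<lambda>n. a n + b n) \<le> vnorm ?L a + vnorm ?L b + 2 * e"
    if e: "0 < e" for e
  proof -
    let ?A = "vnorm ?L a + e" and ?B = "vnorm ?L b + e"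
    have AB: "0 < ?A" "0 < ?B" using e lp_space_norm_nonneg[of p] by (smt (verit))+
    have "(\<Sum>n<N. norm (a n + b n) powr p) \<le> (?A + ?B) powr p" for N
    proof -
      have "(\<Sum>n<N. norm (a n) powr p) \<le> ?A powr p"
        using lp_space_sum_le[OF p0 a, of N] powr_mono2[of p "vnorm ?L a" ?A] p0 e lp_space_norm_nonneg[of p a] by simp
      moreover have "(\<Sum>n<N. norm (b n) powr p) \<le> ?B powr p"
        using lp_space_sum_le[OF p0 b, of N] powr_mono2[of p "vnorm ?L b" ?B] p0 e lp_space_norm_nonneg[of p b] by simp
      ultimately have "(\<Sum>n<N. (norm (a n) + norm (b n)) powr p) \<le> (?A + ?B) powr p"
        using finite_Minkowski[OF p, of "{..<N}" "\<lambda>n. norm (a n)" "\<lambda>n. norm (b n)" ?A ?B] AB by simp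
      moreover have "(\<Sum>n<N. norm (a n + b n) powr p) \<le> (\<Sum>n<N. (norm (a n) + norm (b n)) powr p)"
        using p0 by (intro sum_mono powr_mono2 norm_triangle_ineq) auto
      ultimately show ?thesis by linarith
    qed
    then show ?thesis
      using lp_spaceI[OF p0, of "?A + ?B" "\<lambda>n. a n + b n"] AB by (simp add: algebra_simps)
  qed
  show "(\<lambda>n. a n + b n) \<in> pts ?L" using add[of 1] by simp
  show "vnorm ?L (\<lambda>n. a n + b n) \<le> vnorm ?L a + vnorm ?L b"
  proof (rule field_le_epsilon)
    fix e :: real assume "0 < e"
    then show "vnorm ?L (\<lambda>n. a n + b n) \<le> vnorm ?L a + vnorm ?L b + e" using add[of "e / 2"] by simp
  qed
qed simp_all

lemma lp_unit_vector:
  assumes p: "0 < p"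
  shows "(\<lambda>n. if n = k then 1 else 0) \<in> unit_ball (lp_space p :: ('k::real_or_complex, nat \<Rightarrow> 'k) nspace)"
proof -
  have "(\<Sum>n<N. norm (if n = k then 1 else (0::'k)) powr p) = (if k < N then 1 else 0)" for N
    using p by (simp add: if_distrib[of norm] if_distrib[of "\<lambda>x. x powr p"] cong: if_cong)
  then have "(\<Sum>n<N. norm (if n = k then 1 else (0::'k)) powr p) \<le> 1 powr p" for N by simp
  from lp_spaceI[OF p zero_le_one this] show ?thesis by (simp add: unit_ball_def)
qed

lemma lp_tail_small:
  fixes a :: "nat \<Rightarrow> 'k::real_or_complex"
  assumes p: "0 < p" and a: "a \<in> pts (lp_space p)" and e: "0 < e"
  shows "\<exists>N. (\<lambda>n. if n < N then 0 else a n) \<in> pts (lp_space p) \<and>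
     vnorm (lp_space p) (\<lambda>n. if n < N then 0 else a n) \<le> e"
proof -
  have s: "summable (\<lambda>n. norm (a n) powr p)"
    by (rule summableI_nonneg_bounded[of _ "vnorm (lp_space p) a powr p"]) (use lp_space_sum_le[OF p a] in auto)
  have "0 < e powr p" using e by simp
  from suminf_exist_split[OF this s] obtain N where "\<forall>n\<ge>N. norm (\<Sum>i. norm (a (i + n)) powr p) < e powr p" by blast
  then have tail: "(\<Sum>i. norm (a (i + N)) powr p) < e powr p" by fastforce
  have sN: "summable (\<lambda>i. norm (a (i + N)) powr p)" using s by (rule summable_ignore_initial_segment)
  have "(\<Sum>n<M. norm (if n < N then 0 else a n) powr p) \<le> e powr p" for M
  proof -
    have "(\<Sum>n<M. norm (if n < N then 0 else a n) powr p) \<le> (\<Sum>n<M + N. norm (if n < N then 0 else a n) powr p)"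
      by (rule sum_mono2) auto
    also have "\<dots> = (\<Sum>n<N. norm (if n < N then 0 else a n) powr p) + (\<Sum>i<M. norm (a (i + N)) powr p)"
      using sum.atLeastLessThan_concat[of 0 N "M + N" "\<lambda>n. norm (if n < N then 0 else a n) powr p"]
        sum.shift_bounds_nat_ivl[of "\<lambda>n. norm (if n < N then 0 else a n) powr p" 0 N M]
      by (simp add: lessThan_atLeast0)
    also have "(\<Sum>n<N. norm (if n < N then 0 else a n) powr p) = 0" using p by simp
    also have "0 + (\<Sum>i<M. norm (a (i + N)) powr p) \<le> (\<Sum>i. norm (a (i + N)) powr p)"
      using sum_le_suminf[OF sN, of "{..<M}"] by simp
    finally show ?thesis using tail by linarith
  qed
  from lp_spaceI[OF p less_imp_le[OF e] this] show ?thesis by blast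
qed

section \<open>Summable sequences in Banach spaces\<close>

lemma SUP_lp_norm_le_iff:
  assumes "0 < p" "0 \<le> C"
  shows "(SUP f\<in>B. lp_norm p (\<lambda>n. f (x n))) \<le> ennreal C \<longleftrightarrow>
     (\<forall>f\<in>B. \<forall>N. (\<Sum>n<N. norm (f (x n)) powr p) \<le> C powr p)"
  by (simp add: SUP_le_iff lp_norm_le_iff[OF assms])

lemma weakly_p_summable_iff:
  assumes p: "0 < p"
  shows "weakly_p_summable p X x \<longleftrightarrow> range x \<subseteq> pts X \<and>
     (\<exists>C\<ge>0. \<forall>f\<in>unit_ball (dual X). \<forall>N. (\<Sum>n<N. norm (f (x n)) powr p) \<le> C powr p)"
proof -
  have *: "(s < \<infinity>) \<longleftrightarrow> (\<exists>C\<ge>0. s \<le> ennreal C)" for s :: ennreal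
    by (metis ennreal_cases ennreal_less_top infinity_ennreal_def le_less_trans order_refl top.not_eq_extremum)
  show ?thesis unfolding weakly_p_summable_def * using SUP_lp_norm_le_iff[OF p] by blast
qed

lemma unconditionally_p_summable_iff:
  assumes p: "0 < p"
  shows "unconditionally_p_summable p X x \<longleftrightarrow> weakly_p_summable p X x \<and>
     (\<forall>e>0. \<exists>m0. \<forall>m\<ge>m0. \<forall>f\<in>unit_ball (dual X). \<forall>N. (\<Sum>n<N. norm (f (x (m + n))) powr p) \<le> e powr p)"
proof -
  define S where "S = (\<lambda>m. SUP f\<in>unit_ball (dual X). lp_norm p (\<lambda>n. f (x (m + n))))"
  have S: "S m \<le> ennreal e \<longleftrightarrow> (\<forall>f\<in>unit_ball (dual X). \<forall>N. (\<Sum>n<N. norm (f (x (m + n))) powr p) \<le> e powr p)"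
    if "0 < e" for m e
    unfolding S_def using SUP_lp_norm_le_iff[OF p less_imp_le[OF that], where x="\<lambda>n. x (m + n)"] .
  have "S \<longlonglongrightarrow> 0 \<longleftrightarrow> (\<forall>e>0. \<exists>m0. \<forall>m\<ge>m0. S m \<le> ennreal e)"
  proof
    assume *: "S \<longlonglongrightarrow> 0"
    show "\<forall>e>0. \<exists>m0. \<forall>m\<ge>m0. S m \<le> ennreal e"
    proof (intro allI impI)
      fix e :: real assume "0 < e"
      then have "\<forall>\<^sub>F m in sequentially. S m < ennreal e" using * by (intro order_tendstoD(2)) auto
      then show "\<exists>m0. \<forall>m\<ge>m0. S m \<le> ennreal e" unfolding eventually_sequentially by (meson less_imp_le)
    qed
  next
    assume *: "\<forall>e>0. \<exists>m0. \<forall>m\<ge>m0. S m \<le> ennreal e"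
    show "S \<longlonglongrightarrow> 0"
    proof (rule order_tendstoI)
      fix a :: ennreal assume "0 < a"
      then obtain b where b: "0 < b" "b < a" using dense by blast
      then obtain r where r: "b = ennreal r" "0 < r" by (cases b) auto
      then obtain m0 where "\<forall>m\<ge>m0. S m \<le> b" using * by blast
      then show "\<forall>\<^sub>F m in sequentially. S m < a"
        unfolding eventually_sequentially using b(2) by (meson le_less_trans)
    qed simp
  qed
  then show ?thesis unfolding unconditionally_p_summable_def S_def[symmetric] using S by simp
qed

section \<open>Finite combinations and the operator of a weakly summable sequence\<close>

primrec combination :: "('k::real_or_complex, 'v) nspace \<Rightarrow> (nat \<Rightarrow> 'k) \<Rightarrow> (nat \<Rightarrow> 'v) \<Rightarrow> nat \<Rightarrow> 'v" where
  "combination X a x 0 = vzero X"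
| "combination X a x (Suc n) = vadd X (combination X a x n) (vscale X (a n) (x n))"

context normed_vspace
begin

lemma combination_closed: "range x \<subseteq> pts X \<Longrightarrow> combination X a x n \<in> pts X"
  by (induction n) (auto simp: zero_closed add_closed scale_closed image_subset_iff)

lemma dual_combination:
  assumes "f \<in> pts (dual X)" "range x \<subseteq> pts X"
  shows "f (combination X a x n) = (\<Sum>i<n. a i * f (x i))"
  using assms by (induction n) (auto simp: dual_vzero dual_add dual_scale combination_closed scale_closed image_subset_iff)

end

lemma (in normed_vspace) dual_limit:
  assumes f: "f \<in> pts (dual X)" and s: "range s \<subseteq> pts X" and x: "x \<in> pts X"
    and lim: "\<And>e. 0 < e \<Longrightarrow> \<exists>N. \<forall>n\<ge>N. vdist X (s n) x < e"
  shows "(\<lambda>n. f (s n)) \<longlonglongrightarrow> f x"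
proof (rule LIMSEQ_I)
  have sp: "s n \<in> pts X" for n using s by auto
  fix e :: real assume e: "0 < e"
  define K where "K = vnorm (dual X) f + 1"
  have K: "0 < K" "vnorm (dual X) f \<le> K" using dual_norm_nonneg[OF f] by (auto simp: K_def)
  obtain N where N: "\<forall>n\<ge>N. vdist X (s n) x < e / K" using lim[of "e / K"] e K by auto
  have "norm (f (s n) - f x) < e" if "n \<ge> N" for n
  proof -
    have "norm (f (s n) - f x) \<le> vnorm (dual X) f * vnorm X (vminus X (s n) x)"
      using dual_bound[OF f vminus_closed[OF sp x]] dual_vminus[OF f sp x] by simp
    also have "\<dots> \<le> K * vnorm X (vminus X (s n) x)"
      by (intro mult_right_mono K norm_nonneg vminus_closed sp x)
    also have "\<dots> < K * (e / K)" using N that K x by (intro mult_strict_left_mono) (auto simp: vdist_def sp)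
    finally show ?thesis using K by simp
  qed
  then show "\<exists>N. \<forall>n\<ge>N. norm (f (s n) - f x) < e" by blast
qed

lemma (in banach_space) Cauchy_limit:
  assumes s: "range s \<subseteq> pts X"
    and C: "\<And>e. 0 < e \<Longrightarrow> \<exists>N. \<forall>m\<ge>N. \<forall>n\<ge>m. vnorm X (vminus X (s n) (s m)) < e"
  obtains x where "x \<in> pts X" "\<And>f. f \<in> pts (dual X) \<Longrightarrow> (\<lambda>n. f (s n)) \<longlonglongrightarrow> f x"
proof -
  interpret M: Metric_space "pts X" "vdist X" by (rule metric)
  have sp: "s n \<in> pts X" for n using s by auto
  have "M.MCauchy s"
    unfolding M.MCauchy_def
  proof (intro conjI s allI impI)
    fix e :: real assume "0 < e"
    then obtain N where N: "\<forall>m\<ge>N. \<forall>n\<ge>m. vnorm X (vminus X (s n) (s m)) < e" using C by blast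
    have "vdist X (s n) (s m) < e" if "N \<le> n" "N \<le> m" for n m
    proof -
      have "vnorm X (vminus X (s n) (s m)) < e"
      proof (cases "m \<le> n")
        case True then show ?thesis using N that by blast
      next
        case False
        then have "vnorm X (vminus X (s m) (s n)) < e" using N that by simp
        then show ?thesis using norm_vminus_commute[OF sp sp, of n m] by simp
      qed
      then show ?thesis by (simp add: vdist_def sp)
    qed
    then show "\<exists>N. \<forall>n n'. N \<le> n \<longrightarrow> N \<le> n' \<longrightarrow> vdist X (s n) (s n') < e" by blast
  qed
  then obtain x where "limitin M.mtopology s x sequentially" using complete unfolding M.mcomplete_def by blast
  then have x: "x \<in> pts X" and lim: "\<And>e. 0 < e \<Longrightarrow> \<exists>N. \<forall>n\<ge>N. vdist X (s n) x < e"
    unfolding M.limit_metric_sequentially by blast+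
  then show ?thesis using that dual_limit[OF _ s] by blast
qed

text \<open>Hoelder's inequality makes the partial sums of \<open>\<Sum>\<^sub>n a\<^sub>n x\<^sub>n\<close> Cauchy, uniformly over the functionals in the
  dual ball, and hence in norm.  Linearity of \<open>S\<close> and its bound are then checked on functionals, which
  separate points and determine the norm.\<close>

lemma (in banach_space) summing_operator_exists:
  assumes p: "1 < p" and wps: "weakly_p_summable p X x"
  obtains S where "operator (lp_space (conjugate_exponent p)) X S"
    "\<And>a f. \<lbrakk>a \<in> pts (lp_space (conjugate_exponent p)); f \<in> pts (dual X)\<rbrakk> \<Longrightarrow> (\<lambda>n. a n * f (x n)) sums f (S a)"
proof -
  define q where "q = conjugate_exponent p"
  have p0: "0 < p" and q: "1 < q" "0 < q" using p conjugate_exponent(1)[OF p] by (auto simp: q_def)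
  let ?L = "lp_space q :: ('a, nat \<Rightarrow> 'a) nspace"
  interpret L: normed_vspace ?L by (rule normed_vspace_lp[OF less_imp_le[OF q(1)]])
  obtain C where x: "range x \<subseteq> pts X" and C: "0 \<le> C"
    "\<And>f N. f \<in> unit_ball (dual X) \<Longrightarrow> (\<Sum>n<N. norm (f (x n)) powr p) \<le> C powr p"
    using wps unfolding weakly_p_summable_iff[OF p0] by blast
  have Holder: "norm (\<Sum>n\<in>I. a n * f (x n)) \<le> A * C"
    if f: "f \<in> unit_ball (dual X)" and I: "finite I" and A: "0 \<le> A" "(\<Sum>n\<in>I. norm (a n) powr q) \<le> A powr q"
    for a f I A
  proof -
    obtain N where "I \<subseteq> {..<N}" using I finite_nat_iff_bounded by blast
    then have "(\<Sum>n\<in>I. norm (f (x n)) powr p) \<le> (\<Sum>n<N. norm (f (x n)) powr p)" by (intro sum_mono2) auto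
    then have "(\<Sum>n\<in>I. norm (f (x n)) powr p) \<le> C powr p" using C(2)[OF f, of N] by linarith
    then have "(\<Sum>n\<in>I. norm (a n) * norm (f (x n))) \<le> A * C"
      using A C(1) by (intro finite_Holder[OF p]) (auto simp: q_def)
    then show ?thesis using norm_sum[of "\<lambda>n. a n * f (x n)" I] by (simp add: norm_mult)
  qed
  have "\<exists>y\<in>pts X. \<forall>f\<in>pts (dual X). (\<lambda>n. a n * f (x n)) sums f y" if a: "a \<in> pts ?L" for a
  proof -
    have "\<exists>N. \<forall>m\<ge>N. \<forall>n\<ge>m. vnorm X (vminus X (combination X a x n) (combination X a x m)) < e" if e: "0 < e" for e
    proof -
      define d where "d = e / (2 * (C + 1))"
      have d: "0 < d" "d * C < e" using e C(1) by (auto simp: d_def field_simps add_strict_increasing2 mult_pos_pos)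
      obtain N where N: "(\<lambda>n. if n < N then 0 else a n) \<in> pts ?L" "vnorm ?L (\<lambda>n. if n < N then 0 else a n) \<le> d"
        using lp_tail_small[OF q(2) a d(1)] by blast
      have tail: "(\<Sum>i<n. norm (if i < N then 0 else a i) powr q) \<le> d powr q" for n
        using lp_space_norm_le_iff[OF q(2), of d] N d(1) by (metis less_imp_le)
      have "vnorm X (vminus X (combination X a x n) (combination X a x m)) \<le> d * C" if "N \<le> m" "m \<le> n" for m n
      proof (rule norm_le_by_functionals)
        show "vminus X (combination X a x n) (combination X a x m) \<in> pts X"
          by (intro vminus_closed combination_closed x)
        fix f assume f: "f \<in> unit_ball (dual X)"
        have "{..<n} - {..<m} = {m..<n}" using that by auto
        then have "f (vminus X (combination X a x n) (combination X a x m)) = (\<Sum>i\<in>{m..<n}. a i * f (x i))"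
          using that dual_vminus[OF ball_subset_pts[OF f] combination_closed[OF x] combination_closed[OF x]]
            dual_combination[OF ball_subset_pts[OF f] x] sum_diff[of "{..<n}" "{..<m}" "\<lambda>i. a i * f (x i)"]
          by simp
        moreover have "(\<Sum>i\<in>{m..<n}. norm (a i) powr q) \<le> d powr q"
        proof -
          have "(\<Sum>i\<in>{m..<n}. norm (a i) powr q) = (\<Sum>i\<in>{m..<n}. norm (if i < N then 0 else a i) powr q)"
            using that by (intro sum.cong) auto
          also have "\<dots> \<le> (\<Sum>i<n. norm (if i < N then 0 else a i) powr q)" by (intro sum_mono2) auto
          finally show ?thesis using tail[of n] by linarith
        qed
        ultimately show "norm (f (vminus X (combination X a x n) (combination X a x m))) \<le> d * C"
          using Holder[OF f, of "{m..<n}" d a] d by simp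
      qed
      then show ?thesis using d(2) by (meson le_less_trans)
    qed
    then obtain y where "y \<in> pts X" "\<And>f. f \<in> pts (dual X) \<Longrightarrow> (\<lambda>n. f (combination X a x n)) \<longlonglongrightarrow> f y"
      using Cauchy_limit[of "combination X a x"] combination_closed[OF x] by blast
    then show ?thesis unfolding sums_def using dual_combination[OF _ x] by (intro bexI[of _ y]) auto
  qed
  then obtain S where S: "\<And>a. a \<in> pts ?L \<Longrightarrow> S a \<in> pts X"
    "\<And>a f. \<lbrakk>a \<in> pts ?L; f \<in> pts (dual X)\<rbrakk> \<Longrightarrow> (\<lambda>n. a n * f (x n)) sums f (S a)"
    by metis
  have "operator ?L X S"
    unfolding operator_iff_bounded[OF L.normed_vspace_axioms normed_vspace_axioms]
  proof (intro conjI ballI allI)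
    show "S \<in> pts ?L \<rightarrow> pts X" using S(1) by blast
    fix a c assume a: "a \<in> pts ?L"
    show "S (vscale ?L c a) = vscale X c (S a)"
    proof (rule functionals_separate)
      show "S (vscale ?L c a) \<in> pts X" "vscale X c (S a) \<in> pts X" using S(1) L.scale_closed[OF a] scale_closed a by blast+
      fix f assume "f \<in> unit_ball (dual X)"
      then have f: "f \<in> pts (dual X)" by (rule ball_subset_pts)
      have "(\<lambda>n. c * (a n * f (x n))) sums (c * f (S a))" by (rule sums_mult[OF S(2)[OF a f]])
      moreover have "(\<lambda>n. c * (a n * f (x n))) sums f (S (vscale ?L c a))"
        using S(2)[OF L.scale_closed[OF a, of c] f] by (simp add: mult.assoc)
      ultimately show "f (S (vscale ?L c a)) = f (vscale X c (S a))"
        using sums_unique2 dual_scale[OF f S(1)[OF a]] by metis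
    qed
  next
    fix a b assume a: "a \<in> pts ?L" and b: "b \<in> pts ?L"
    show "S (vadd ?L a b) = vadd X (S a) (S b)"
    proof (rule functionals_separate)
      show "S (vadd ?L a b) \<in> pts X" "vadd X (S a) (S b) \<in> pts X" using S(1) L.add_closed[OF a b] add_closed a b by blast+
      fix f assume "f \<in> unit_ball (dual X)"
      then have f: "f \<in> pts (dual X)" by (rule ball_subset_pts)
      have "(\<lambda>n. a n * f (x n) + b n * f (x n)) sums (f (S a) + f (S b))" by (rule sums_add[OF S(2)[OF a f] S(2)[OF b f]])
      moreover have "(\<lambda>n. a n * f (x n) + b n * f (x n)) sums f (S (vadd ?L a b))"
        using S(2)[OF L.add_closed[OF a b] f] by (simp add: distrib_right)
      ultimately show "f (S (vadd ?L a b)) = f (vadd X (S a) (S b))"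
        using sums_unique2 dual_add[OF f S(1)[OF a] S(1)[OF b]] by metis
    qed
  next
    have "vnorm X (S a) \<le> C * vnorm ?L a" if a: "a \<in> pts ?L" for a
    proof (rule norm_le_by_functionals[OF S(1)[OF a]])
      fix f assume f: "f \<in> unit_ball (dual X)"
      have "(\<lambda>N. norm (\<Sum>n<N. a n * f (x n))) \<longlonglongrightarrow> norm (f (S a))"
        using S(2)[OF a ball_subset_pts[OF f]] unfolding sums_def by (rule tendsto_norm)
      moreover have "norm (\<Sum>n<N. a n * f (x n)) \<le> C * vnorm ?L a" for N
        using Holder[OF f, of "{..<N}" "vnorm ?L a" a] lp_space_sum_le[OF q(2) a] lp_space_norm_nonneg[of q a]
        by (simp add: mult.commute)
      ultimately show "norm (f (S a)) \<le> C * vnorm ?L a" by (meson LIMSEQ_le_const2)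
    qed
    then show "\<exists>C. \<forall>a\<in>pts ?L. vnorm X (S a) \<le> C * vnorm ?L a" by blast
  qed
  then show ?thesis using that S(2) unfolding q_def by blast
qed

lemma (in banach_space) range_relatively_weakly_p_compact:
  assumes p: "1 < p" and wps: "weakly_p_summable p X x"
  shows "relatively_weakly_p_compact p X (range x)"
proof -
  define q where "q = conjugate_exponent p"
  have q: "0 < q" using conjugate_exponent(1)[OF p] by (auto simp: q_def)
  have x: "x k \<in> pts X" for k using wps by (auto simp: weakly_p_summable_def)
  obtain S where S: "operator (lp_space q) X S"
    "\<And>a f. \<lbrakk>a \<in> pts (lp_space q); f \<in> pts (dual X)\<rbrakk> \<Longrightarrow> (\<lambda>n. a n * f (x n)) sums f (S a)"
    using summing_operator_exists[OF p wps] unfolding q_def by blast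
  have "x k \<in> S ` unit_ball (lp_space q)" for k
  proof
    let ?e = "\<lambda>n. if n = k then 1 else (0::'a)"
    show e: "?e \<in> unit_ball (lp_space q)" by (rule lp_unit_vector[OF q])
    show "x k = S ?e"
    proof (rule functionals_separate[OF x])
      show "S ?e \<in> pts X" using S(1) ball_subset_pts[OF e] by (auto simp: operator_def)
      fix f assume "f \<in> unit_ball (dual X)"
      then have "(\<lambda>n. ?e n * f (x n)) sums f (S ?e)" by (intro S(2) ball_subset_pts e)
      moreover have "(\<lambda>n. ?e n * f (x n)) = (\<lambda>n. if n = k then f (x k) else 0)" by auto
      ultimately show "f (x k) = f (S ?e)" using sums_single[of k "\<lambda>_. f (x k)"] sums_unique2 by metis
    qed
  qed
  then show ?thesis unfolding relatively_weakly_p_compact_def q_def[symmetric] using S(1) by blast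
qed

section \<open>Weak compactness: Alaoglu, Goldstine and Gantmacher\<close>

text \<open>In the product topology of the function type the dual ball is a closed subset, cut out by the
  linearity equations, of a product of compact discs.  The disc over a point outside the carrier has
  radius 0, which encodes that functionals vanish there.\<close>

theorem (in normed_vspace) Alaoglu: "compact (unit_ball (dual X))"
proof -
  define r where "r = (\<lambda>x. if x \<in> pts X then vnorm X x else 0)"
  have "compactin (product_topology (\<lambda>_. euclidean) UNIV) (PiE UNIV (\<lambda>x. cball (0::'k) (r x)))"
    by (simp add: compactin_PiE compact_cball_scalars)
  then have "compact (PiE UNIV (\<lambda>x. cball (0::'k) (r x)))"
    unfolding euclidean_product_topology by simp
  moreover have "closed (\<Inter>x\<in>pts X. \<Inter>y\<in>pts X. {f :: 'v \<Rightarrow> 'k. f (vadd X x y) = f x + f y})"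
    "closed (\<Inter>c. \<Inter>x\<in>pts X. {f :: 'v \<Rightarrow> 'k. f (vscale X c x) = c * f x})"
    by (intro closed_INT ballI closed_Collect_eq continuous_intros continuous_on_product_coordinates)+
  ultimately have "compact (PiE UNIV (\<lambda>x. cball (0::'k) (r x)) \<inter>
      ((\<Inter>x\<in>pts X. \<Inter>y\<in>pts X. {f. f (vadd X x y) = f x + f y}) \<inter> (\<Inter>c. \<Inter>x\<in>pts X. {f. f (vscale X c x) = c * f x})))"
    by (intro compact_Int_closed closed_Int)
  also have "\<dots> = unit_ball (dual X)"
  proof (intro set_eqI iffI)
    fix f assume "f \<in> unit_ball (dual X)"
    then show "f \<in> PiE UNIV (\<lambda>x. cball (0::'k) (r x)) \<inter>
      ((\<Inter>x\<in>pts X. \<Inter>y\<in>pts X. {f. f (vadd X x y) = f x + f y}) \<inter> (\<Inter>c. \<Inter>x\<in>pts X. {f. f (vscale X c x) = c * f x}))"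
      by (auto simp: r_def dual_ball_iff dual_add dual_scale dual_outside)
  next
    fix f assume f: "f \<in> PiE UNIV (\<lambda>x. cball (0::'k) (r x)) \<inter>
      ((\<Inter>x\<in>pts X. \<Inter>y\<in>pts X. {f. f (vadd X x y) = f x + f y}) \<inter> (\<Inter>c. \<Inter>x\<in>pts X. {f. f (vscale X c x) = c * f x}))"
    then have "norm (f x) \<le> r x" for x by (auto simp: PiE_iff)
    then have "norm (f x) \<le> (if x \<in> pts X then vnorm X x else 0)" for x unfolding r_def .
    then have "x \<in> pts X \<Longrightarrow> norm (f x) \<le> vnorm X x" "x \<notin> pts X \<Longrightarrow> f x = 0" for x
      by (metis, metis norm_le_zero_iff)
    then show "f \<in> unit_ball (dual X)" using f by (intro dual_ballI) auto
  qed
  finally show ?thesis .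
qed

context normed_vspace
begin

lemma bidual_sum:
  assumes \<phi>: "\<phi> \<in> pts (dual (dual X))" and G: "finite G" "G \<subseteq> pts (dual X)"
  shows "(\<lambda>x. \<Sum>g\<in>G. c g * g x) \<in> pts (dual X)" "\<phi> (\<lambda>x. \<Sum>g\<in>G. c g * g x) = (\<Sum>g\<in>G. c g * \<phi> g)"
proof -
  interpret D: normed_vspace "dual X" by (rule normed_vspace_dual)
  have "(\<lambda>x. \<Sum>g\<in>G. c g * g x) \<in> pts (dual X) \<and> \<phi> (\<lambda>x. \<Sum>g\<in>G. c g * g x) = (\<Sum>g\<in>G. c g * \<phi> g)"
    using G
  proof (induction G rule: finite_induct)
    case empty
    then show ?case using D.zero_closed D.dual_vzero[OF \<phi>] by simp
  next
    case (insert g G)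
    then have g: "(\<lambda>x. c g * g x) \<in> pts (dual X)" "\<phi> (\<lambda>x. c g * g x) = c g * \<phi> g"
      using D.scale_closed[of g "c g"] D.dual_scale[OF \<phi>, of g "c g"] by auto
    show ?case
      using insert D.add_closed[OF g(1), of "\<lambda>x. \<Sum>g\<in>G. c g * g x"]
        D.dual_add[OF \<phi> g(1), of "\<lambda>x. \<Sum>g\<in>G. c g * g x"] g(2) by simp
  qed
  then show "(\<lambda>x. \<Sum>g\<in>G. c g * g x) \<in> pts (dual X)" "\<phi> (\<lambda>x. \<Sum>g\<in>G. c g * g x) = (\<Sum>g\<in>G. c g * \<phi> g)" by auto
qed

lemma ball_convex:
  assumes x: "x \<in> unit_ball X" and y: "y \<in> unit_ball X" and t: "0 \<le> t" "t \<le> 1"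
  shows "vadd X (vscale X (of_real (1 - t)) x) (vscale X (of_real t) y) \<in> unit_ball X"
proof -
  have xy: "x \<in> pts X" "y \<in> pts X" "vnorm X x \<le> 1" "vnorm X y \<le> 1" using x y by (auto simp: unit_ball_def)
  have "vnorm X (vadd X (vscale X (of_real (1 - t)) x) (vscale X (of_real t) y))
      \<le> vnorm X (vscale X (of_real (1 - t)) x) + vnorm X (vscale X (of_real t) y)"
    using xy by (intro norm_triangle scale_closed)
  also have "\<dots> = (1 - t) * vnorm X x + t * vnorm X y"
    using xy t by (simp add: norm_scale del: of_real_diff)
  also have "\<dots> \<le> (1 - t) * 1 + t * 1" using xy t by (intro add_mono mult_left_mono) auto
  finally show ?thesis using xy by (simp add: unit_ball_def add_closed scale_closed)
qed

lemma norm_diff_square: "(norm (w - of_real t * u))\<^sup>2 = (norm w)\<^sup>2 - 2 * t * re (conjugate w * u) + t\<^sup>2 * (norm u)\<^sup>2"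
  for w u :: "'a::real_or_complex"
proof -
  have "(norm (w - of_real t * u))\<^sup>2 = (cmod (emb w - of_real t * emb u))\<^sup>2"
    using norm_emb[of "w - of_real t * u"] by (simp only: emb_diff emb_mult emb_of_real)
  also have "\<dots> = (cmod (emb w))\<^sup>2 - 2 * t * Re (cnj (emb w) * emb u) + t\<^sup>2 * (cmod (emb u))\<^sup>2"
    unfolding cmod_power2 by (simp add: power2_eq_square algebra_simps)
  finally show ?thesis by (simp add: re_def emb_mult emb_conjugate)
qed

text \<open>Among the \<open>x\<close> in the ball let one almost minimise the Euclidean distance of \<open>(g x)\<^sub>g\<close> from \<open>(\<phi> g)\<^sub>g\<close>.
  With \<open>w\<close> the difference vector and \<open>h\<close> the combination of the \<open>g\<close> with the conjugate coefficients
  of \<open>w\<close>, minimality says that \<open>re (h y)\<close> exceeds \<open>re (h x)\<close> only slightly for \<open>y\<close> in the ball.  So the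
  norm of \<open>h\<close>, and with it \<open>re (\<phi> h)\<close>, is at most slightly larger than \<open>re (h x)\<close>, while
  \<open>re (\<phi> h) - re (h x)\<close> is the squared distance.\<close>

theorem Goldstine:
  assumes \<phi>: "\<phi> \<in> unit_ball (dual (dual X))" and G: "finite G" "G \<subseteq> pts (dual X)" and e: "0 < e"
  shows "\<exists>x\<in>unit_ball X. \<forall>g\<in>G. norm (g x - \<phi> g) \<le> e"
proof (rule ccontr)
  assume no: "\<not> ?thesis"
  interpret D: normed_vspace "dual X" by (rule normed_vspace_dual)
  have \<phi>p: "\<phi> \<in> pts (dual (dual X))" using \<phi> by (rule ball_subset_pts)
  have Gp: "g \<in> pts (dual X)" if "g \<in> G" for g using that G(2) by blast
  define E where "E = (\<lambda>x. \<Sum>g\<in>G. (norm (\<phi> g - g x))\<^sup>2)"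
  have E_low: "e\<^sup>2 \<le> E x" if x: "x \<in> unit_ball X" for x
  proof -
    obtain g where g: "g \<in> G" "e < norm (g x - \<phi> g)" using no x by (auto simp: not_le)
    then have "e\<^sup>2 \<le> (norm (\<phi> g - g x))\<^sup>2" using e by (intro power_mono) (auto simp: norm_minus_commute)
    also have "\<dots> \<le> E x" unfolding E_def by (rule member_le_sum[OF g(1) _ G(1)]) auto
    finally show ?thesis .
  qed
  define K where "K = (\<Sum>g\<in>G. (2 * vnorm (dual X) g)\<^sup>2)"
  have K0: "0 \<le> K" unfolding K_def by (intro sum_nonneg) auto
  \<comment> \<open>The step length towards a competitor \<open>y\<close>; the minimum is attained up to \<open>t\<^sup>2\<close>, so that the
    error relative to \<open>t\<close> in the first-order condition is at most \<open>t (1 + K) \<le> e\<^sup>2\<close>.\<close>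
  define t where "t = min 1 (e\<^sup>2 / (1 + K))"
  have t: "0 < t" "t \<le> 1" using e K0 by (auto simp: t_def)
  have "t \<le> e\<^sup>2 / (1 + K)" by (simp add: t_def)
  then have tK: "t * (1 + K) \<le> e\<^sup>2" using K0 by (subst (asm) pos_le_divide_eq) auto
  have bdd: "bdd_below (E ` unit_ball X)" by (auto intro!: bdd_belowI2[of _ 0] sum_nonneg simp: E_def)
  have "(INF x\<in>unit_ball X. E x) < (INF x\<in>unit_ball X. E x) + t\<^sup>2" using t by simp
  then obtain x where x: "x \<in> unit_ball X" and Ex: "E x < (INF x\<in>unit_ball X. E x) + t\<^sup>2"
    using cINF_less_iff[OF _ bdd] zero_in_ball by (metis empty_iff)
  have near: "E x \<le> E y + t\<^sup>2" if "y \<in> unit_ball X" for y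
    using Ex cINF_lower[OF bdd that] by linarith
  have xp: "x \<in> pts X" using x by (rule ball_subset_pts)
  define w where "w = (\<lambda>g. \<phi> g - g x)"
  define h where "h = (\<lambda>y. \<Sum>g\<in>G. conjugate (w g) * g y)"
  have h: "h \<in> pts (dual X)" "\<phi> h = (\<Sum>g\<in>G. conjugate (w g) * \<phi> g)"
    using bidual_sum[OF \<phi>p G] unfolding h_def by auto
  define R where "R = re (h x) + t * (1 + K) / 2"
  \<comment> \<open>First-order condition at the near-minimiser \<open>x\<close>: the real part of \<open>h\<close> almost attains its
    supremum over the ball at \<open>x\<close>.\<close>
  have re_le: "re (h y) \<le> R" if y: "y \<in> unit_ball X" for y
  proof -
    have yp: "y \<in> pts X" using y by (rule ball_subset_pts)
    define z where "z = vadd X (vscale X (of_real (1 - t)) x) (vscale X (of_real t) y)"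
    have z: "z \<in> unit_ball X" unfolding z_def using ball_convex x y t by simp
    have gz: "\<phi> g - g z = w g - of_real t * (g y - g x)" if "g \<in> G" for g
      using Gp[OF that] xp yp by (simp add: z_def w_def dual_add dual_scale scale_closed algebra_simps)
    have "E z = (\<Sum>g\<in>G. (norm (w g))\<^sup>2 - 2 * t * re (conjugate (w g) * (g y - g x)) + t\<^sup>2 * (norm (g y - g x))\<^sup>2)"
      unfolding E_def by (rule sum.cong) (simp_all add: gz norm_diff_square)
    also have "\<dots> = E x - 2 * t * (re (h y) - re (h x)) + t\<^sup>2 * (\<Sum>g\<in>G. (norm (g y - g x))\<^sup>2)"
      unfolding E_def h_def w_def
      by (simp add: sum.distrib sum_subtractf sum_distrib_left re_sum re_diff right_diff_distrib)
    also have "(\<Sum>g\<in>G. (norm (g y - g x))\<^sup>2) \<le> K"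
      unfolding K_def
    proof (rule sum_mono, rule power_mono)
      fix g assume g: "g \<in> G"
      have "norm (g v) \<le> vnorm (dual X) g" if "v \<in> unit_ball X" for v
        using dual_bound[OF Gp[OF g], of v] mult_left_mono[of "vnorm X v" 1 "vnorm (dual X) g"]
          dual_norm_nonneg[OF Gp[OF g]] that by (simp add: unit_ball_def)
      then show "norm (g y - g x) \<le> 2 * vnorm (dual X) g"
        using x y norm_triangle_ineq4[of "g y" "g x"] by (smt (verit))
    qed simp
    finally have "E z \<le> E x - 2 * t * (re (h y) - re (h x)) + t\<^sup>2 * K" using t by simp
    then have "2 * t * (re (h y) - re (h x)) \<le> t\<^sup>2 * (1 + K)" using near[OF z] by (simp add: algebra_simps)
    then have "t * (2 * (re (h y) - re (h x))) \<le> t * (t * (1 + K))" by (simp add: power2_eq_square algebra_simps)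
    then have "2 * (re (h y) - re (h x)) \<le> t * (1 + K)" using t(1) by simp
    then show ?thesis by (simp add: R_def)
  qed
  have "norm (h y) \<le> R" if y: "y \<in> unit_ball X" for y
  proof -
    obtain c where c: "norm c = 1" "c * h y = of_real (norm (h y))" using exists_unit_rotation by blast
    have "vscale X c y \<in> unit_ball X" using y c by (simp add: unit_ball_def scale_closed norm_scale)
    then show ?thesis using re_le[of "vscale X c y"] dual_scale[OF h(1), of y c] c y by (simp add: ball_subset_pts)
  qed
  then have "vnorm (dual X) h \<le> R"
    unfolding dual_norm_def using zero_in_ball by (intro cSUP_least) auto
  then have "norm (\<phi> h) \<le> R" using D.dual_ball_bound[OF \<phi> h(1)] by linarith
  then have "re (\<phi> h) - re (h x) \<le> t * (1 + K) / 2" using re_le_norm[of "\<phi> h"] by (simp add: R_def)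
  moreover have "re (\<phi> h) - re (h x) = E x"
    unfolding h(2) unfolding h_def E_def re_sum sum_subtractf[symmetric] re_diff[symmetric]
      right_diff_distrib[symmetric] by (simp add: w_def re_conjugate_self)
  ultimately have "E x \<le> e\<^sup>2 / 2" using tK by simp
  moreover have "0 < e\<^sup>2" using e by simp
  ultimately show False using E_low[OF x] by linarith
qed

end

lemma compactin_fip_image:
  assumes K: "compactin T K" and cl: "\<And>i. i \<in> I \<Longrightarrow> closedin T (A i)"
    and fin: "\<And>J. \<lbrakk>finite J; J \<subseteq> I\<rbrakk> \<Longrightarrow> K \<inter> \<Inter>(A ` J) \<noteq> {}"
  shows "K \<inter> \<Inter>(A ` I) \<noteq> {}"
proof (cases "I = {}")
  case False
  have "\<forall>C\<in>A ` I. closedin T C" using cl by blast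
  moreover have "K \<inter> \<Inter>\<F> \<noteq> {}" if "finite \<F>" "\<F> \<subseteq> A ` I" for \<F>
    using fin finite_subset_image[OF that] by metis
  ultimately show ?thesis using K unfolding compactin_fip by blast
qed (use fin[of "{}"] in simp)

definition dual_operator :: "('k::real_or_complex, 'v) nspace \<Rightarrow> ('v \<Rightarrow> 'w) \<Rightarrow> ('w \<Rightarrow> 'k) \<Rightarrow> 'v \<Rightarrow> 'k" where
  "dual_operator X T f = (\<lambda>x. if x \<in> pts X then f (T x) else 0)"

lemma dual_operator_apply [simp]: "x \<in> pts X \<Longrightarrow> dual_operator X T f x = f (T x)"
  by (simp add: dual_operator_def)

lemma dual_operator_in_dual:
  assumes X: "normed_vspace X" and Y: "normed_vspace Y" and op: "operator X Y T" and f: "f \<in> pts (dual Y)"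
  shows "dual_operator X T f \<in> pts (dual X)"
proof -
  interpret X: normed_vspace X by fact
  interpret Y: normed_vspace Y by fact
  have Tpts: "T x \<in> pts Y" if "x \<in> pts X" for x using op that by (auto simp: operator_def)
  obtain C where C: "\<And>x. x \<in> pts X \<Longrightarrow> vnorm Y (T x) \<le> C * vnorm X x"
    using op unfolding operator_iff_bounded[OF X Y] by blast
  show ?thesis
    unfolding X.in_dual_iff
  proof (intro conjI ballI allI impI exI)
    fix x assume x: "x \<in> pts X"
    have "norm (f (T x)) \<le> vnorm (dual Y) f * vnorm Y (T x)" by (rule Y.dual_bound[OF f Tpts[OF x]])
    also have "\<dots> \<le> vnorm (dual Y) f * (C * vnorm X x)"
      by (intro mult_left_mono C x Y.dual_norm_nonneg f)
    finally show "norm (dual_operator X T f x) \<le> vnorm (dual Y) f * C * vnorm X x" using x by (simp add: mult.assoc)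
  qed (use op f Tpts in \<open>auto simp: dual_operator_def operator_def X.add_closed X.scale_closed Y.dual_add Y.dual_scale\<close>)
qed

text \<open>
  For a weakly compact \<open>T\<close> the bidual operator takes its values in \<open>Y\<close>: by Goldstine's theorem the
  conditions \<open>|f y - \<phi> (f \<circ> T)| \<le> e\<close> can be met finitely many at a time by some \<open>y\<close> in the image of the
  ball, and the weakly compact closure of that image provides a common solution.\<close>

lemma weakly_compact_bidual_value:
  fixes X :: "('k::real_or_complex, 'v) nspace" and Y :: "('k, 'w) nspace"
  assumes X: "normed_vspace X" and Y: "normed_vspace Y" and T: "weakly_compact_operator X Y T"
    and \<phi>: "\<phi> \<in> unit_ball (dual (dual X))"
  obtains y where "y \<in> pts Y"
    "\<And>f. f \<in> pts (dual Y) \<Longrightarrow> \<phi> (dual_operator X T f) = f y"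
proof -
  interpret X: normed_vspace X by fact
  interpret Y: normed_vspace Y by fact
  interpret DX: normed_vspace "dual X" by (rule X.normed_vspace_dual)
  have op: "operator X Y T" and comp: "compactin (weak_topology Y) (weak_topology Y closure_of (T ` unit_ball X))"
    using T by (auto simp: weakly_compact_operator_def)
  have Tpts: "T x \<in> pts Y" if "x \<in> pts X" for x using op that by (auto simp: operator_def)
  define adj where "adj = dual_operator X T"
  have adj: "adj f \<in> pts (dual X)" if "f \<in> pts (dual Y)" for f
    unfolding adj_def by (rule dual_operator_in_dual[OF X Y op that])
  define K where "K = weak_topology Y closure_of (T ` unit_ball X)"
  define A where "A = (\<lambda>(f, e). {y \<in> pts Y. norm (f y - \<phi> (adj f)) \<le> e})"
  have TK: "T x \<in> K" if "x \<in> unit_ball X" for x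
  proof -
    have "T ` unit_ball X \<subseteq> topspace (weak_topology Y)"
      unfolding Y.topspace_weak using Tpts[OF ball_subset_pts] by blast
    then show ?thesis unfolding K_def using closure_of_subset that by blast
  qed
  have closed: "closedin (weak_topology Y) (A (f, e))" if f: "f \<in> pts (dual Y)" for f and e :: real
  proof -
    have "closed {z. norm (z - \<phi> (adj f)) \<le> e}" by (intro closed_Collect_le continuous_intros)
    then have "closedin (weak_topology Y) {y \<in> topspace (weak_topology Y). f y \<in> {z. norm (z - \<phi> (adj f)) \<le> e}}"
      by (intro closedin_continuous_map_preimage[OF Y.continuous_map_weak_dual[OF f]]) simp
    then show ?thesis by (simp add: A_def)
  qed
  have "K \<inter> \<Inter>(A ` (pts (dual Y) \<times> {0::real<..})) \<noteq> {}"
  proof (rule compactin_fip_image[OF comp[folded K_def]])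
    show "closedin (weak_topology Y) (A i)" if "i \<in> pts (dual Y) \<times> {0::real<..}" for i using that closed by auto
    fix J assume J: "finite J" "J \<subseteq> pts (dual Y) \<times> {0::real<..}"
    define e where "e = Min (insert 1 (snd ` J))"
    have e: "0 < e" "\<And>f d. (f, d) \<in> J \<Longrightarrow> e \<le> d" using J by (auto simp: e_def Min_le_iff intro!: bexI image_eqI[of _ snd])
    obtain x where x: "x \<in> unit_ball X" "\<forall>g\<in>(adj \<circ> fst) ` J. norm (g x - \<phi> g) \<le> e"
      using X.Goldstine[OF \<phi>, of "(adj \<circ> fst) ` J" e] J e(1) adj by force
    have "norm (f (T x) - \<phi> (adj f)) \<le> d" if "(f, d) \<in> J" for f d
    proof -
      have "norm (adj f x - \<phi> (adj f)) \<le> e" using x(2) that by force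
      then show ?thesis using e(2)[OF that] ball_subset_pts[OF x(1)] by (simp add: adj_def)
    qed
    then have "T x \<in> K \<inter> \<Inter>(A ` J)" using TK[OF x(1)] Tpts[OF ball_subset_pts[OF x(1)]] by (auto simp: A_def)
    then show "K \<inter> \<Inter>(A ` J) \<noteq> {}" by blast
  qed
  then obtain y where y: "y \<in> K" "\<And>f e. \<lbrakk>f \<in> pts (dual Y); 0 < e\<rbrakk> \<Longrightarrow> y \<in> A (f, e)" by blast
  show ?thesis
  proof
    show "y \<in> pts Y" using y(1) closure_of_subset_topspace[of "weak_topology Y"] unfolding K_def by auto
    fix f assume f: "f \<in> pts (dual Y)"
    have "norm (f y - \<phi> (adj f)) \<le> e" if "0 < e" for e using y(2)[OF f that] by (simp add: A_def)
    then have "norm (f y - \<phi> (adj f)) = 0" by (meson dense_ge norm_ge_zero antisym)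
    then show "\<phi> (dual_operator X T f) = f y" by (simp add: adj_def)
  qed
qed

text \<open>Since bidual values lie in \<open>Y\<close>, the map \<open>f \<mapsto> f \<circ> T\<close> is continuous from the weak-star topology of the
  dual ball of \<open>Y\<close> to the weak topology of the dual of \<open>X\<close>, and the dual ball is weak-star compact.  The
  factor \<open>c\<close> serves to move the image into the unit ball.\<close>

theorem Gantmacher:
  fixes X :: "('k::real_or_complex, 'v) nspace" and Y :: "('k, 'w) nspace"
  assumes X: "normed_vspace X" and Y: "normed_vspace Y" and T: "weakly_compact_operator X Y T"
  shows "compactin (weak_topology (dual X)) ((\<lambda>f x. c * dual_operator X T f x) ` unit_ball (dual Y))"
proof -
  interpret X: normed_vspace X by fact
  interpret Y: normed_vspace Y by fact
  interpret DX: normed_vspace "dual X" by (rule X.normed_vspace_dual)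
  interpret DDX: normed_vspace "dual (dual X)" by (rule DX.normed_vspace_dual)
  have adj: "dual_operator X T f \<in> pts (dual X)" if "f \<in> unit_ball (dual Y)" for f
    using dual_operator_in_dual[OF X Y _ ball_subset_pts[OF that]] T by (simp add: weakly_compact_operator_def)
  have adjc: "(\<lambda>x. c * dual_operator X T f x) \<in> pts (dual X)" if "f \<in> unit_ball (dual Y)" for f
    using DX.scale_closed[OF adj[OF that], of c] by simp
  have "continuous_map (top_of_set (unit_ball (dual Y))) (weak_topology (dual X)) (\<lambda>f x. c * dual_operator X T f x)"
    unfolding DX.continuous_map_into_weak
  proof (intro conjI ballI)
    show "(\<lambda>f x. c * dual_operator X T f x) ` topspace (top_of_set (unit_ball (dual Y))) \<subseteq> pts (dual X)" using adjc by auto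
    fix \<phi> assume \<phi>: "\<phi> \<in> pts (dual (dual X))"
    define s where "s = vnorm (dual (dual X)) \<phi> + 1"
    have s: "0 < s" "vnorm (dual (dual X)) \<phi> \<le> s" using DX.dual_norm_nonneg[OF \<phi>] by (auto simp: s_def)
    define \<psi> where "\<psi> = (\<lambda>f. of_real (1 / s) * \<phi> f)"
    have "\<psi> \<in> unit_ball (dual (dual X))" unfolding \<psi>_def by (rule DX.scaled_dual_in_ball[OF \<phi> s])
    then obtain y where y: "y \<in> pts Y" "\<And>f. f \<in> pts (dual Y) \<Longrightarrow> \<psi> (dual_operator X T f) = f y"
      using weakly_compact_bidual_value[OF X Y T] by blast
    have eq: "\<phi> (\<lambda>x. c * dual_operator X T f x) = c * (of_real s * f y)" if f: "f \<in> unit_ball (dual Y)" for f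
    proof -
      have "\<phi> (\<lambda>x. c * dual_operator X T f x) = c * \<phi> (dual_operator X T f)"
        using DX.dual_scale[OF \<phi> adj[OF f], of c] by simp
      also have "\<phi> (dual_operator X T f) = of_real s * \<psi> (dual_operator X T f)" using s by (simp add: \<psi>_def flip: mult.assoc of_real_mult)
      finally show ?thesis using y(2)[OF ball_subset_pts[OF f]] by simp
    qed
    have "continuous_on (unit_ball (dual Y)) (\<lambda>f. c * (of_real s * f y))"
      by (intro continuous_intros continuous_on_subset[OF continuous_on_product_coordinates]) simp
    then have "continuous_on (unit_ball (dual Y)) (\<lambda>f. \<phi> (\<lambda>x. c * dual_operator X T f x))"
      by (rule continuous_on_eq) (simp add: eq)
    then show "continuous_map (top_of_set (unit_ball (dual Y))) euclidean (\<lambda>f. \<phi> (\<lambda>x. c * dual_operator X T f x))" by simp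
  qed
  moreover have "compactin (top_of_set (unit_ball (dual Y))) (unit_ball (dual Y))"
    using Y.Alaoglu by (simp add: compactin_subtopology)
  ultimately show ?thesis by (rule image_compactin[rotated])
qed

section \<open>Weakly compact sets are weakly sequentially compact\<close>

lemma compactin_sequence_cluster:
  fixes s :: "nat \<Rightarrow> 'a"
  assumes F: "compactin T F" and s: "range s \<subseteq> F"
  obtains l where "l \<in> F" "\<And>U. \<lbrakk>openin T U; l \<in> U\<rbrakk> \<Longrightarrow> infinite {n. s n \<in> U}"
proof (rule ccontr)
  assume no: "\<not> thesis"
  note found = that
  have "\<exists>U. openin T U \<and> l \<in> U \<and> finite {n. s n \<in> U}" if l: "l \<in> F" for l
  proof (rule ccontr)
    assume *: "\<not> ?thesis"
    have thesis
    proof (rule found[OF l])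
      fix U assume "openin T U" "l \<in> U"
      then show "infinite {n. s n \<in> U}" using * by auto
    qed
    then show False using no by simp
  qed
  then have "\<forall>l\<in>F. \<exists>U. openin T U \<and> l \<in> U \<and> finite {n. s n \<in> U}" ..
  then obtain U where U: "\<forall>l\<in>F. openin T (U l) \<and> l \<in> U l \<and> finite {n. s n \<in> U l}" unfolding bchoice_iff ..
  then have "(\<forall>V\<in>U ` F. openin T V) \<and> F \<subseteq> \<Union>(U ` F)" by blast
  then obtain \<F> where \<F>: "finite \<F>" "\<F> \<subseteq> U ` F" "F \<subseteq> \<Union>\<F>" using F unfolding compactin_def by meson
  have "n \<in> (\<Union>V\<in>\<F>. {n. s n \<in> V})" for n
  proof -
    have "s n \<in> \<Union>\<F>" using s \<F>(3) by (meson rangeI subsetD)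
    then show ?thesis by simp
  qed
  then have "UNIV \<subseteq> (\<Union>V\<in>\<F>. {n. s n \<in> V})" by (rule subsetI)
  moreover have "finite (\<Union>V\<in>\<F>. {n. s n \<in> V})"
  proof (rule finite_UN_I[OF \<F>(1)])
    fix V assume "V \<in> \<F>"
    then obtain l where "l \<in> F" "V = U l" using \<F>(2) by (meson imageE subsetD)
    then show "finite {n. s n \<in> V}" using U by simp
  qed
  ultimately show False using finite_subset infinite_UNIV_nat by blast
qed

lemma cluster_value_eq_limit:
  fixes f :: "'a \<Rightarrow> 'b::metric_space"
  assumes cont: "continuous_map T euclidean f" and l: "l \<in> topspace T"
    and cluster: "\<And>U. \<lbrakk>openin T U; l \<in> U\<rbrakk> \<Longrightarrow> infinite {n::nat. s n \<in> U}"
    and lim: "(\<lambda>n. f (s n)) \<longlonglongrightarrow> c"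
  shows "f l = c"
proof (rule ccontr)
  assume "f l \<noteq> c"
  then have e: "0 < dist (f l) c / 2" by simp
  have "openin T {x \<in> topspace T. f x \<in> ball (f l) (dist (f l) c / 2)}"
    by (rule openin_continuous_map_preimage[OF cont]) simp
  then have inf: "infinite {n. s n \<in> {x \<in> topspace T. f x \<in> ball (f l) (dist (f l) c / 2)}}"
    using l e by (intro cluster) auto
  obtain N where N: "\<forall>n\<ge>N. dist (f (s n)) c < dist (f l) c / 2"
    using lim e unfolding lim_sequentially by blast
  obtain n where "n \<ge> N" "s n \<in> {x \<in> topspace T. f x \<in> ball (f l) (dist (f l) c / 2)}"
    using inf unfolding infinite_nat_iff_unbounded_le by blast
  then have "dist (f l) (f (s n)) < dist (f l) c / 2" "dist (f (s n)) c < dist (f l) c / 2" using N by auto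
  then show False using dist_triangle[of "f l" c "f (s n)"] by linarith
qed

context normed_vspace
begin

text \<open>
  The combinations with coefficients from a countable dense set of scalars are dense in the closed span
  of \<open>x\<close>; a norming functional for each of them gives a countable separating family.  Membership of
  \<open>z\<close> in the closed span is expressed by the functionals that annihilate \<open>x\<close>, since that condition passes
  to weak limits.\<close>

lemma span_countably_separated:
  fixes x :: "nat \<Rightarrow> 'v"
  assumes x: "range x \<subseteq> pts X"
  shows "\<exists>d :: nat \<Rightarrow> 'v \<Rightarrow> 'k. (\<forall>i. d i \<in> unit_ball (dual X)) \<and>
    (\<forall>z\<in>pts X. (\<forall>f\<in>pts (dual X). (\<forall>n. f (x n) = 0) \<longrightarrow> f z = 0) \<longrightarrow> (\<forall>i. d i z = 0) \<longrightarrow> z = vzero X)"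
proof -
  have xp: "x n \<in> pts X" for n using x by auto
  note comb = combination_closed[OF x] and fcomb = dual_combination[OF ball_subset_pts x]
  define Z where "Z = {combination X a x n | a n. True}"
  have Z: "Z \<subseteq> pts X" using comb by (auto simp: Z_def)
  have pad: "(\<Sum>i<N. (if i < n then a i else 0) * f (x i)) = (\<Sum>i<n. a i * f (x i))" if "n \<le> N"
    for a :: "nat \<Rightarrow> 'k" and f :: "'v \<Rightarrow> 'k" and n N
  proof -
    have "(\<Sum>i<N. (if i < n then a i else 0) * f (x i)) = (\<Sum>i\<in>{..<N} \<inter> {i. i < n}. a i * f (x i))"
      by (subst sum.inter_restrict) (auto intro: sum.cong)
    also have "{..<N} \<inter> {i. i < n} = {..<n}" using that by auto
    finally show ?thesis .
  qed
  have Z_add: "vadd X u v \<in> Z" if uv: "u \<in> Z" "v \<in> Z" for u v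
  proof -
    obtain a n b m where u: "u = combination X a x n" and v: "v = combination X b x m"
      using uv unfolding Z_def by blast
    have "vadd X u v = combination X (\<lambda>i. (if i < n then a i else 0) + (if i < m then b i else 0)) x (max n m)"
    proof (rule functionals_separate)
      fix f assume f: "f \<in> unit_ball (dual X)"
      show "f (vadd X u v) = f (combination X (\<lambda>i. (if i < n then a i else 0) + (if i < m then b i else 0)) x (max n m))"
        unfolding u v dual_add[OF ball_subset_pts[OF f] comb comb] fcomb[OF f] distrib_right sum.distrib
        by (simp add: pad)
    qed (simp_all add: u v add_closed comb)
    then show ?thesis unfolding Z_def by blast
  qed
  have Z_scale: "vscale X c u \<in> Z" if "u \<in> Z" for c u
  proof -
    obtain a n where u: "u = combination X a x n" using \<open>u \<in> Z\<close> unfolding Z_def by blast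
    have "vscale X c u = combination X (\<lambda>i. c * a i) x n"
    proof (rule functionals_separate)
      fix f assume f: "f \<in> unit_ball (dual X)"
      show "f (vscale X c u) = f (combination X (\<lambda>i. c * a i) x n)"
        unfolding u dual_scale[OF ball_subset_pts[OF f] comb] fcomb[OF f] by (simp add: sum_distrib_left mult.assoc)
    qed (simp_all add: u scale_closed comb)
    then show ?thesis unfolding Z_def by blast
  qed
  obtain C :: "'k set" where C: "countable C" and dense: "\<And>z e. 0 < e \<Longrightarrow> \<exists>c\<in>C. norm (z - c) < e"
    using countable_dense_scalars by blast
  define Q where "Q = (\<lambda>cs. combination X (\<lambda>i. cs ! i) x (length cs)) ` lists C"
  have Q: "countable Q" "Q \<noteq> {}" "Q \<subseteq> pts X" using C comb by (auto simp: Q_def)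
  have Q_dense: "\<exists>q\<in>Q. vnorm X (vminus X u q) \<le> e" if u: "u \<in> Z" and e: "0 < e" for u e
  proof -
    obtain a n where u: "u = combination X a x n" using u unfolding Z_def by blast
    have "\<exists>c\<in>C. norm (a i - c) < e / (real (n + 1) * (vnorm X (x i) + 1))" for i
      using e norm_nonneg[OF xp[of i]] by (intro dense divide_pos_pos mult_pos_pos) auto
    then obtain c where c: "\<And>i. c i \<in> C" "\<And>i. norm (a i - c i) < e / (real (n + 1) * (vnorm X (x i) + 1))" by metis
    define q where "q = combination X c x n"
    have "combination X (\<lambda>i. map c [0..<n] ! i) x m = combination X c x m" if "m \<le> n" for m
      using that by (induction m) auto
    then have "q = combination X (\<lambda>i. map c [0..<n] ! i) x (length (map c [0..<n]))" by (simp add: q_def)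
    then have qQ: "q \<in> Q" unfolding Q_def using c(1) by (intro image_eqI[of _ _ "map c [0..<n]"]) auto
    have "vnorm X (vminus X u q) \<le> e"
    proof (rule norm_le_by_functionals)
      show "vminus X u q \<in> pts X" by (simp add: u q_def vminus_closed comb)
      fix f assume f: "f \<in> unit_ball (dual X)"
      have "f (vminus X u q) = (\<Sum>i<n. (a i - c i) * f (x i))"
        by (simp add: u q_def dual_vminus[OF ball_subset_pts[OF f] comb comb] fcomb[OF f] left_diff_distrib sum_subtractf)
      also have "norm \<dots> \<le> (\<Sum>i<n. e / real (n + 1))"
      proof (rule sum_norm_le)
        fix i
        have "norm ((a i - c i) * f (x i)) \<le> e / (real (n + 1) * (vnorm X (x i) + 1)) * (vnorm X (x i) + 1)"
          unfolding norm_mult using c(2)[of i] dual_ball_bound[OF f xp[of i]] norm_nonneg[OF xp[of i]] e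
          by (intro mult_mono) auto
        also have "\<dots> = e / real (n + 1)" using norm_nonneg[OF xp[of i]] by simp
        finally show "norm ((a i - c i) * f (x i)) \<le> e / real (n + 1)" .
      qed
      also have "\<dots> \<le> e" using e by (simp add: field_simps)
      finally show "norm (f (vminus X u q)) \<le> e" .
    qed
    then show ?thesis using qQ by blast
  qed
  have "\<exists>f. f \<in> unit_ball (dual X) \<and> f q = of_real (vnorm X q)" if "q \<in> Q" for q
    using norming_functional[of q] that Q(3) by blast
  then obtain g where g: "\<And>q. q \<in> Q \<Longrightarrow> g q \<in> unit_ball (dual X) \<and> g q q = of_real (vnorm X q)" by metis
  define d where "d = (\<lambda>i. g (from_nat_into Q i))"
  show ?thesis
  proof (intro exI[of _ d] conjI allI ballI impI)
    show "d i \<in> unit_ball (dual X)" for i using g from_nat_into[OF Q(2)] by (simp add: d_def)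
    fix z assume z: "z \<in> pts X" and ann: "\<forall>f\<in>pts (dual X). (\<forall>n. f (x n) = 0) \<longrightarrow> f z = 0"
      and dz: "\<forall>i. d i z = 0"
    have "vnorm X z \<le> 0 + e" if e: "0 < e" for e
    proof -
      have "\<exists>u\<in>Z. vnorm X (vminus X z u) < e / 4"
      proof (rule separation_from_subspace[OF Z _ Z_add Z_scale z])
        show "Z \<noteq> {}" by (auto simp: Z_def)
        fix f assume f: "f \<in> unit_ball (dual X)" "\<forall>z\<in>Z. f z = 0"
        have "x n = combination X (\<lambda>i. if i = n then 1 else 0) x (Suc n)" for n
        proof (rule functionals_separate)
          fix f assume "f \<in> unit_ball (dual X)"
          then show "f (x n) = f (combination X (\<lambda>i. if i = n then 1 else 0) x (Suc n))"
            unfolding fcomb[OF \<open>f \<in> unit_ball (dual X)\<close>] by simp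
        qed (rule xp, rule comb)
        then have "x n \<in> Z" for n unfolding Z_def by blast
        then show "f z = 0" using f ann ball_subset_pts[OF f(1)] by simp
      qed (use e in auto)
      then obtain u where u: "u \<in> Z" "vnorm X (vminus X z u) < e / 4" by blast
      obtain q where q: "q \<in> Q" "vnorm X (vminus X u q) \<le> e / 4" using Q_dense[OF u(1), of "e / 4"] e by auto
      have pts: "u \<in> pts X" "q \<in> pts X" using u Z q Q by auto
      have zq: "vnorm X (vminus X z q) < e / 2" using norm_vminus_triangle[OF z pts] u q by simp
      obtain i where "from_nat_into Q i = q" using q(1) Q(1) by (metis from_nat_into_surj)
      then have gz: "g q z = 0" using dz by (auto simp: d_def)
      have "vnorm X q = norm (g q (vminus X z q))"
        using g[OF q(1)] gz dual_vminus[OF ball_subset_pts z pts(2), of "g q"] norm_nonneg[OF pts(2)] by simp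
      also have "\<dots> \<le> vnorm X (vminus X z q)" using g[OF q(1)] by (intro dual_ball_bound vminus_closed z pts) auto
      finally have "vnorm X q < e / 2" using zq by simp
      then show ?thesis using zq norm_vminus_triangle[OF z pts(2) zero_closed] z pts by simp
    qed
    then have "vnorm X z \<le> 0" by (rule field_le_epsilon)
    then show "z = vzero X" using norm_eq_zero[OF z] norm_nonneg[OF z] by simp
  qed
qed

text \<open>This is one half of the theorem of Eberlein and Smulian.  A diagonal argument, in the form of
  compactness of a countable product of discs, makes countably many functionals that separate the closed
  span converge along a subsequence; then the subsequence has only one weak cluster point.\<close>

theorem weakly_compact_imp_sequentially:
  assumes F: "compactin (weak_topology X) F" and x: "range x \<subseteq> F"
  obtains r l where "strict_mono (r :: nat \<Rightarrow> nat)" "l \<in> F" "\<And>f. f \<in> pts (dual X) \<Longrightarrow> (\<lambda>n. f (x (r n))) \<longlonglongrightarrow> f l"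
proof -
  have Fp: "F \<subseteq> pts X" using compactin_subset_topspace[OF F] by simp
  then have xp: "range x \<subseteq> pts X" using x by blast
  obtain d :: "nat \<Rightarrow> 'v \<Rightarrow> 'k" where d: "\<forall>i. d i \<in> unit_ball (dual X)"
    "\<forall>z\<in>pts X. (\<forall>f\<in>pts (dual X). (\<forall>n. f (x n) = 0) \<longrightarrow> f z = 0) \<longrightarrow> (\<forall>i. d i z = 0) \<longrightarrow> z = vzero X"
    using span_countably_separated[OF xp] by blast
  have dp: "d i \<in> pts (dual X)" for i by (rule ball_subset_pts[OF spec[OF d(1)]])
  have "\<exists>R. \<forall>n. norm (d i (x n)) \<le> R" for i
  proof -
    have "compactin euclidean (d i ` F)" by (rule image_compactin[OF F continuous_map_weak_dual[OF dp]])
    then have "bounded (d i ` F)" by (simp add: compact_imp_bounded)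
    then obtain R where R: "\<forall>v\<in>d i ` F. norm v \<le> R" unfolding bounded_iff ..
    have "x n \<in> F" for n using x by auto
    then show ?thesis using R by (intro exI[of _ R]) simp
  qed
  then obtain R where R: "\<And>i n. norm (d i (x n)) \<le> R i" by metis
  define y where "y = (\<lambda>n i. emb (d i (x n)))"
  have "compactin (product_topology (\<lambda>_. euclidean) UNIV) (PiE UNIV (\<lambda>i. cball (0::complex) (R i)))"
    by (simp add: compactin_PiE)
  then have "compact (PiE UNIV (\<lambda>i::nat. cball (0::complex) (R i)))"
    unfolding euclidean_product_topology by simp
  moreover have "y n \<in> PiE UNIV (\<lambda>i::nat. cball (0::complex) (R i))" for n using R by (simp add: y_def PiE_iff)
  ultimately obtain L r where r: "strict_mono (r :: nat \<Rightarrow> nat)" and L: "(y \<circ> r) \<longlonglongrightarrow> L"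
    using compact_imp_seq_compact unfolding seq_compact_def by metis
  have "(\<lambda>n. (y \<circ> r) n i) \<longlonglongrightarrow> L i" for i
    by (rule continuous_on_tendsto_compose[OF continuous_on_product_coordinates L]) auto
  then have Li: "(\<lambda>n. emb (d i (x (r n)))) \<longlonglongrightarrow> L i" for i by (simp add: y_def)
  \<comment> \<open>All cluster points of subsequences of \<open>x \<circ> r\<close> coincide: the functionals \<open>d i\<close> take the same
    values on them, and their differences lie in the closed span of \<open>x\<close>.\<close>
  have unique: "l = l'"
    if l: "l \<in> F" "\<And>U. \<lbrakk>openin (weak_topology X) U; l \<in> U\<rbrakk> \<Longrightarrow> infinite {n. x (r (s n)) \<in> U}" "strict_mono s"
      and l': "l' \<in> F" "\<And>U. \<lbrakk>openin (weak_topology X) U; l' \<in> U\<rbrakk> \<Longrightarrow> infinite {n. x (r (s' n)) \<in> U}" "strict_mono s'"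
    for l l' and s s' :: "nat \<Rightarrow> nat"
  proof -
    have lp: "l \<in> pts X" "l' \<in> pts X" using l(1) l'(1) Fp by auto
    have "vminus X l l' = vzero X"
    proof (rule d(2)[rule_format, OF vminus_closed[OF lp]])
      fix f assume f: "f \<in> pts (dual X)" and "\<And>n. f (x n) = 0"
      then have lim: "(\<lambda>n. f (x (r (s n)))) \<longlonglongrightarrow> 0" "(\<lambda>n. f (x (r (s' n)))) \<longlonglongrightarrow> 0" by simp_all
      have "f l = 0" "f l' = 0"
        using cluster_value_eq_limit[OF continuous_map_weak_dual[OF f] _ l(2) lim(1)]
          cluster_value_eq_limit[OF continuous_map_weak_dual[OF f] _ l'(2) lim(2)] lp by auto
      then show "f (vminus X l l') = 0" by (simp add: dual_vminus[OF f lp])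
    next
      have cont: "continuous_map (weak_topology X) euclidean (\<lambda>z. emb (d i z))" for i
        using continuous_map_compose[OF continuous_map_weak_dual[OF dp[of i]], of euclidean emb]
          continuous_on_emb_iff[of UNIV "\<lambda>z. z"] by (simp add: o_def)
      have "(\<lambda>n. emb (d i (x (r (s n))))) \<longlonglongrightarrow> L i" "(\<lambda>n. emb (d i (x (r (s' n))))) \<longlonglongrightarrow> L i" for i
        using LIMSEQ_subseq_LIMSEQ[OF Li l(3)] LIMSEQ_subseq_LIMSEQ[OF Li l'(3)] by (simp_all add: o_def)
      then have "emb (d i l) = L i" "emb (d i l') = L i" for i
        using cluster_value_eq_limit[OF cont[of i] _ l(2)] cluster_value_eq_limit[OF cont[of i] _ l'(2)] lp
        by auto
      then show "d i (vminus X l l') = 0" for i by (metis dual_vminus[OF dp lp] inj_emb right_minus_eq)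
    qed
    then show ?thesis using vminus_eq_zero[OF lp] by simp
  qed
  have "range (\<lambda>n. x (r n)) \<subseteq> F" using x by blast
  then obtain l where l: "l \<in> F" "\<And>U. \<lbrakk>openin (weak_topology X) U; l \<in> U\<rbrakk> \<Longrightarrow> infinite {n. x (r n) \<in> U}"
    using compactin_sequence_cluster[OF F] by metis
  have lp: "l \<in> pts X" using l(1) Fp by blast
  have lim: "(\<lambda>n. f (x (r n))) \<longlonglongrightarrow> f l" if f: "f \<in> pts (dual X)" for f
  proof (rule ccontr)
    assume "\<not> (\<lambda>n. f (x (r n))) \<longlonglongrightarrow> f l"
    then obtain e where e: "0 < e" and "\<forall>N. \<exists>n\<ge>N. e \<le> dist (f (x (r n))) (f l)"
      unfolding lim_sequentially by (meson not_le)
    then have "infinite {n. e \<le> dist (f (x (r n))) (f l)}" unfolding infinite_nat_iff_unbounded_le by simp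
    from infinite_enumerate[OF this] obtain s :: "nat \<Rightarrow> nat"
      where s: "strict_mono s" "\<And>n. e \<le> dist (f (x (r (s n)))) (f l)"
      by auto
    have "range (\<lambda>n. x (r (s n))) \<subseteq> F" using x by blast
    then obtain l' where l': "l' \<in> F" "\<And>U. \<lbrakk>openin (weak_topology X) U; l' \<in> U\<rbrakk> \<Longrightarrow> infinite {n. x (r (s n)) \<in> U}"
      using compactin_sequence_cluster[OF F] by metis
    have "l' = l" using unique[OF l' s(1) l(1), of id] l(2) by (simp add: strict_mono_def)
    have "openin (weak_topology X) {z \<in> topspace (weak_topology X). f z \<in> ball (f l) e}"
      by (rule openin_continuous_map_preimage[OF continuous_map_weak_dual[OF f]]) simp
    then have "infinite {n. x (r (s n)) \<in> {z \<in> topspace (weak_topology X). f z \<in> ball (f l) e}}"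
      using e lp \<open>l' = l\<close> by (intro l'(2)) auto
    then obtain n where "x (r (s n)) \<in> {z \<in> topspace (weak_topology X). f z \<in> ball (f l) e}"
      using infinite_imp_nonempty by blast
    then show False using s(2)[of n] by (simp add: dist_commute)
  qed
  show ?thesis by (rule that[OF r l(1) lim])
qed

end

section \<open>Weakly null sequences of functionals as weakly compact operators\<close>

text \<open>By Baire's theorem one of the closed sets on which all \<open>g n\<close> are bounded by a given integer contains
  a ball.\<close>

theorem (in banach_space) uniform_boundedness:
  fixes g :: "nat \<Rightarrow> 'b \<Rightarrow> 'a"
  assumes g: "\<And>n. g n \<in> pts (dual X)" and bounded: "\<And>x. x \<in> pts X \<Longrightarrow> \<exists>R. \<forall>n. norm (g n x) \<le> R"
  obtains M where "0 < M" "\<And>n x. x \<in> pts X \<Longrightarrow> norm (g n x) \<le> M * vnorm X x"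
proof -
  interpret M: Metric_space "pts X" "vdist X" by (rule metric)
  define E where "E = (\<lambda>m::nat. {x \<in> pts X. \<forall>n. norm (g n x) \<le> real m})"
  have closed: "closedin M.mtopology (E m)" for m
    unfolding M.metric_closedin_iff_sequentially_closed
  proof (intro conjI allI impI; (elim conjE)?)
    show "E m \<subseteq> pts X" by (auto simp: E_def)
    fix \<sigma> l assume \<sigma>: "range \<sigma> \<subseteq> E m" and lim: "limitin M.mtopology \<sigma> l sequentially"
    have \<sigma>p: "range \<sigma> \<subseteq> pts X" using \<sigma> by (auto simp: E_def)
    have l: "l \<in> pts X" and l_lim: "\<And>e. 0 < e \<Longrightarrow> \<exists>N. \<forall>n\<ge>N. vdist X (\<sigma> n) l < e"
      using lim unfolding M.limit_metric_sequentially by blast+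
    have "norm (g n l) \<le> real m" for n
    proof (rule LIMSEQ_le_const2)
      show "(\<lambda>k. norm (g n (\<sigma> k))) \<longlonglongrightarrow> norm (g n l)"
        by (rule tendsto_norm[OF dual_limit[OF g \<sigma>p l l_lim]])
      show "\<exists>N. \<forall>k\<ge>N. norm (g n (\<sigma> k)) \<le> real m" using \<sigma> by (auto simp: E_def)
    qed
    then show "l \<in> E m" using l by (simp add: E_def)
  qed
  have "pts X \<subseteq> \<Union>(range E)"
  proof
    fix x assume x: "x \<in> pts X"
    then obtain R where R: "\<forall>n. norm (g n x) \<le> R" using bounded by blast
    obtain m :: nat where "R \<le> real m" using real_arch_simple by blast
    then have "x \<in> E m" using R x by (auto simp: E_def intro: order_trans)
    then show "x \<in> \<Union>(range E)" by blast
  qed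
  then have "\<Union>(range E) = pts X" by (auto simp: E_def)
  then have "M.mtopology interior_of \<Union>(range E) \<noteq> {}"
    using zero_closed interior_of_topspace[of M.mtopology] M.topspace_mtopology by auto
  have "\<exists>m. M.mtopology interior_of (E m) \<noteq> {}"
  proof (rule ccontr)
    assume *: "\<not> ?thesis"
    have "M.mtopology interior_of \<Union>(range E) = {}"
      by (rule M.metric_Baire_category_alt[OF complete]) (use * closed in auto)
    then show False using \<open>M.mtopology interior_of \<Union>(range E) \<noteq> {}\<close> by simp
  qed
  then obtain m x0 where x0: "x0 \<in> M.mtopology interior_of (E m)" by blast
  have "openin M.mtopology (M.mtopology interior_of (E m))" by (rule openin_interior_of)
  then obtain r where r: "0 < r" "M.mball x0 r \<subseteq> M.mtopology interior_of (E m)"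
    using x0 unfolding M.openin_mtopology by blast
  have ball: "M.mball x0 r \<subseteq> E m" by (rule order_trans[OF r(2) interior_of_subset])
  have x0E: "x0 \<in> E m" by (rule subsetD[OF interior_of_subset x0])
  then have x0p: "x0 \<in> pts X" by (simp add: E_def)
  have small: "norm (g n y) \<le> 2 * real m" if y: "y \<in> pts X" "vnorm X y < r" for n y
  proof -
    have p: "vadd X y x0 \<in> pts X" using y x0p by (simp add: add_closed)
    have "vminus X (vadd X y x0) x0 = y"
      using y x0p vminus_self[OF x0p]
      by (simp add: vminus_def add_assoc scale_closed add_zero)
    then have "vdist X x0 (vadd X y x0) < r"
      using y p x0p norm_vminus_commute[OF x0p p] by (simp add: vdist_def)
    then have "vadd X y x0 \<in> E m" using ball p x0p by (auto simp: M.mball_def)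
    then have "norm (g n (vadd X y x0)) \<le> real m" "norm (g n x0) \<le> real m" using x0E by (auto simp: E_def)
    moreover have "g n y = g n (vadd X y x0) - g n x0" using dual_add[OF g y(1) x0p] by simp
    ultimately show ?thesis using norm_triangle_ineq4[of "g n (vadd X y x0)" "g n x0"] by simp
  qed
  show ?thesis
  proof (rule that)
    show "0 < 2 * (2 * real m + 1) / r" using r by (intro divide_pos_pos mult_pos_pos) auto
    fix n x assume x: "x \<in> pts X"
    show "norm (g n x) \<le> 2 * (2 * real m + 1) / r * vnorm X x"
    proof (cases "vnorm X x = 0")
      case True
      then have "x = vzero X" using x norm_eq_zero by blast
      then show ?thesis by (simp add: dual_vzero[OF g])
    next
      case False
      then have pos: "0 < vnorm X x" using norm_nonneg[OF x] by simp
      define c where "c = r / (2 * vnorm X x)"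
      have c: "0 < c" using pos r by (simp add: c_def)
      have "vnorm X (vscale X (of_real c) x) < r" using x c pos r by (simp add: norm_scale) (simp add: c_def)
      then have "norm (g n (vscale X (of_real c) x)) \<le> 2 * real m" using x by (intro small scale_closed)
      then have "c * norm (g n x) \<le> 2 * real m + 1" using c by (simp add: dual_scale[OF g x] norm_mult)
      then have "norm (g n x) \<le> (2 * real m + 1) / c" using c by (simp add: field_simps)
      also have "\<dots> = 2 * (2 * real m + 1) / r * vnorm X x" by (simp add: c_def)
      finally show ?thesis .
    qed
  qed
qed

lemma (in normed_vspace) Hausdorff_weak: "Hausdorff_space (weak_topology X)"
  unfolding Hausdorff_space_def
proof (intro allI impI; elim conjE)
  fix x y assume "x \<in> topspace (weak_topology X)" "y \<in> topspace (weak_topology X)" and "x \<noteq> y"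
  then have xy: "x \<in> pts X" "y \<in> pts X" by simp_all
  then obtain f where f: "f \<in> unit_ball (dual X)" "f x \<noteq> f y" using functionals_separate \<open>x \<noteq> y\<close> by blast
  obtain U V where UV: "open U" "open V" "f x \<in> U" "f y \<in> V" "U \<inter> V = {}" using hausdorff[OF f(2)] by blast
  have op: "openin (weak_topology X) {z \<in> topspace (weak_topology X). f z \<in> W}" if "open W" for W
    by (rule openin_continuous_map_preimage[OF continuous_map_weak_dual[OF ball_subset_pts[OF f(1)]]]) (use that in simp)
  show "\<exists>U V. openin (weak_topology X) U \<and> openin (weak_topology X) V \<and> x \<in> U \<and> y \<in> V \<and> disjnt U V"
    by (intro exI conjI, rule op[OF UV(1)], rule op[OF UV(2)]) (use UV xy in \<open>auto simp: disjnt_def\<close>)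
qed

text \<open>
  The target spaces in the Dunford-Pettis property have their carriers in a prescribed type, so the
  sequences are transported there by an injection.  The operators used below have values in the null
  sequences; in the larger space of bounded sequences completeness is easier to check, and weak
  compactness of sets of null sequences is the same.\<close>

definition bounded_sequences :: "((nat \<Rightarrow> 'k) \<Rightarrow> 'w) \<Rightarrow> ('k::real_or_complex, 'w) nspace" where
  "bounded_sequences \<iota> =
     \<lparr>pts = \<iota> ` {a. bounded (range a)}, vadd = (\<lambda>u v. \<iota> (\<lambda>n. inv \<iota> u n + inv \<iota> v n)), vzero = \<iota> (\<lambda>n. 0),
      vscale = (\<lambda>c u. \<iota> (\<lambda>n. c * inv \<iota> u n)), vnorm = (\<lambda>u. SUP n. norm (inv \<iota> u n))\<rparr>"

context
  fixes \<iota> :: "(nat \<Rightarrow> 'k::real_or_complex) \<Rightarrow> 'w"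
  assumes inj: "inj \<iota>"
begin

lemma bounded_sequences_simps [simp]:
  "\<iota> a \<in> pts (bounded_sequences \<iota>) \<longleftrightarrow> bounded (range a)"
  "vadd (bounded_sequences \<iota>) (\<iota> a) (\<iota> b) = \<iota> (\<lambda>n. a n + b n)"
  "vzero (bounded_sequences \<iota>) = \<iota> (\<lambda>n. 0)"
  "vscale (bounded_sequences \<iota>) c (\<iota> a) = \<iota> (\<lambda>n. c * a n)"
  "vminus (bounded_sequences \<iota>) (\<iota> a) (\<iota> b) = \<iota> (\<lambda>n. a n - b n)"
  using inj by (auto simp: bounded_sequences_def vminus_def inj_image_mem_iff)

lemma bounded_sequences_norm: "vnorm (bounded_sequences \<iota>) (\<iota> a) = (SUP n. norm (a n))"
  using inj by (simp add: bounded_sequences_def)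

lemma bounded_sequences_cases:
  assumes "u \<in> pts (bounded_sequences \<iota>)"
  obtains a where "u = \<iota> a" "bounded (range a)"
  using assms by (auto simp: bounded_sequences_def)

lemma bounded_sequences_coordinate_le:
  assumes "bounded (range a)"
  shows "norm (a n) \<le> vnorm (bounded_sequences \<iota>) (\<iota> a)"
proof -
  have "bdd_above (range (\<lambda>n. norm (a n)))" using assms by (auto simp: bounded_iff intro: bdd_aboveI2)
  then show ?thesis unfolding bounded_sequences_norm by (intro cSUP_upper) auto
qed

lemma bounded_sequences_norm_le: "(\<And>n. norm (a n) \<le> C) \<Longrightarrow> vnorm (bounded_sequences \<iota>) (\<iota> a) \<le> C"
  unfolding bounded_sequences_norm by (intro cSUP_least) auto

lemma normed_vspace_bounded_sequences: "normed_vspace (bounded_sequences \<iota>)" (is "normed_vspace ?L")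
proof (rule normed_vspace_of_functions[where \<iota>=\<iota> and A="{a. bounded (range a)}"])
  show "pts ?L = \<iota> ` {a. bounded (range a)}" by (simp add: bounded_sequences_def)
  have "bounded (range (\<lambda>n. 0 :: 'k))" by simp
  then show "{a. bounded (range (a :: nat \<Rightarrow> 'k))} \<noteq> {}" by blast
  fix a b :: "nat \<Rightarrow> 'k" and c :: 'k assume "a \<in> {a. bounded (range a)}"
  then have a: "bounded (range a)" by simp
  show "(\<lambda>n. c * a n) \<in> {a. bounded (range a)}"
    using bounded_scaleR_comp[of a UNIV "norm c"] a unfolding bounded_iff by (simp add: norm_mult)
  show "0 \<le> vnorm ?L (\<iota> a)"
    using bounded_sequences_coordinate_le[OF a, of 0] norm_ge_zero[of "a 0"] by linarith
  show "a n = 0" if "vnorm ?L (\<iota> a) = 0" for n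
    using bounded_sequences_coordinate_le[OF a, of n] that by simp
  show "vnorm ?L (\<iota> (\<lambda>n. c * a n)) \<le> norm c * vnorm ?L (\<iota> a)"
    using bounded_sequences_coordinate_le[OF a]
    by (intro bounded_sequences_norm_le) (auto simp: norm_mult intro!: mult_left_mono)
  assume "b \<in> {a. bounded (range a)}"
  then have b: "bounded (range b)" by simp
  show "(\<lambda>n. a n + b n) \<in> {a. bounded (range a)}" using bounded_plus_comp[OF a b] by simp
  show "vnorm ?L (\<iota> (\<lambda>n. a n + b n)) \<le> vnorm ?L (\<iota> a) + vnorm ?L (\<iota> b)"
  proof (rule bounded_sequences_norm_le)
    fix n show "norm (a n + b n) \<le> vnorm ?L (\<iota> a) + vnorm ?L (\<iota> b)"
      using norm_triangle_ineq[of "a n" "b n"] bounded_sequences_coordinate_le[OF a, of n]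
        bounded_sequences_coordinate_le[OF b, of n] by simp
  qed
qed simp_all

lemma banach_bounded_sequences: "banach_space (bounded_sequences \<iota>)"
proof -
  let ?L = "bounded_sequences \<iota>"
  interpret L: normed_vspace ?L by (rule normed_vspace_bounded_sequences)
  interpret M: Metric_space "pts ?L" "vdist ?L" by (rule L.metric)
  have "\<exists>u. limitin M.mtopology \<sigma> u sequentially" if C: "M.MCauchy \<sigma>" for \<sigma>
  proof -
    have \<sigma>p: "\<sigma> k \<in> pts ?L" for k using C unfolding M.MCauchy_def by blast
    then have "\<exists>a. \<sigma> k = \<iota> a \<and> bounded (range a)" for k by (meson bounded_sequences_cases)
    then obtain a where a: "\<And>k. \<sigma> k = \<iota> (a k)" "\<And>k. bounded (range (a k))" by metis
    have dist: "vdist ?L (\<iota> b) (\<iota> c) = vnorm ?L (\<iota> (\<lambda>n. b n - c n))" if "bounded (range b)" "bounded (range c)" for b c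
      using that by (simp add: vdist_def)
    have bdiff: "bounded (range (\<lambda>n. b n - c n))" if "bounded (range b)" "bounded (range c)" for b c :: "nat \<Rightarrow> 'k"
      using that by (rule bounded_minus_comp)
    have cauchy: "\<exists>N. \<forall>k\<ge>N. \<forall>l\<ge>N. \<forall>n. norm (a k n - a l n) < e" if e: "0 < e" for e
    proof -
      obtain N where N: "\<forall>k l. N \<le> k \<longrightarrow> N \<le> l \<longrightarrow> vdist ?L (\<sigma> k) (\<sigma> l) < e"
        using C e unfolding M.MCauchy_def by blast
      have "norm (a k n - a l n) < e" if "N \<le> k" "N \<le> l" for k l n
      proof -
        have "norm (a k n - a l n) \<le> vdist ?L (\<sigma> k) (\<sigma> l)"
          unfolding a(1) dist[OF a(2) a(2)] by (rule bounded_sequences_coordinate_le[OF bdiff[OF a(2) a(2)]])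
        then show ?thesis using N that by (meson le_less_trans)
      qed
      then show ?thesis by blast
    qed
    have "Cauchy (\<lambda>k. a k n)" for n
      unfolding Cauchy_def dist_norm using cauchy by meson
    then have "\<exists>l. (\<lambda>k. a k n) \<longlonglongrightarrow> l" for n by (meson Cauchy_scalars_convergent)
    then obtain b where b: "\<And>n. (\<lambda>k. a k n) \<longlonglongrightarrow> b n" by metis
    have close: "\<exists>N. \<forall>k\<ge>N. \<forall>n. norm (a k n - b n) \<le> e" if e: "0 < e" for e
    proof -
      obtain N where N: "\<forall>k\<ge>N. \<forall>l\<ge>N. \<forall>n. norm (a k n - a l n) < e" using cauchy[OF e] by blast
      have "norm (a k n - b n) \<le> e" if "k \<ge> N" for k n
      proof (rule LIMSEQ_le_const2)
        show "(\<lambda>l. norm (a k n - a l n)) \<longlonglongrightarrow> norm (a k n - b n)" by (intro tendsto_intros b)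
        show "\<exists>M. \<forall>l\<ge>M. norm (a k n - a l n) \<le> e" using N that by (intro exI[of _ N]) (auto intro: less_imp_le)
      qed
      then show ?thesis by blast
    qed
    have bb: "bounded (range b)"
    proof -
      obtain k where k: "\<And>n. norm (a k n - b n) \<le> 1" using close[of 1] by auto
      obtain R where R: "\<And>n. norm (a k n) \<le> R" using a(2)[of k] unfolding bounded_iff by auto
      have "norm (b n) \<le> R + 1" for n
        using norm_triangle_ineq4[of "a k n" "a k n - b n"] k[of n] R[of n] by simp
      then show ?thesis unfolding bounded_iff by auto
    qed
    have "limitin M.mtopology \<sigma> (\<iota> b) sequentially"
      unfolding M.limit_metric_sequentially
    proof (intro conjI allI impI)
      show "\<iota> b \<in> pts ?L" using bb by simp
      fix e :: real assume e: "0 < e"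
      then obtain N where N: "\<forall>k\<ge>N. \<forall>n. norm (a k n - b n) \<le> e / 2" using close[of "e / 2"] by auto
      have "vdist ?L (\<sigma> k) (\<iota> b) < e" if "k \<ge> N" for k
      proof -
        have "vdist ?L (\<sigma> k) (\<iota> b) \<le> e / 2"
          unfolding a(1) dist[OF a(2) bb] using N that by (intro bounded_sequences_norm_le) blast
        then show ?thesis using e by simp
      qed
      then show "\<exists>N. \<forall>k\<ge>N. \<sigma> k \<in> pts ?L \<and> vdist ?L (\<sigma> k) (\<iota> b) < e" using \<sigma>p by blast
    qed
    then show ?thesis by blast
  qed
  then have "M.mcomplete" unfolding M.mcomplete_def by blast
  then show ?thesis using L.normed_vspace_axioms by (simp add: banach_space_def banach_space_axioms_def)
qed

lemma coordinate_in_ball: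
  "(\<lambda>u. if u \<in> pts (bounded_sequences \<iota>) then inv \<iota> u k else 0) \<in> unit_ball (dual (bounded_sequences \<iota>))"
proof -
  let ?L = "bounded_sequences \<iota>"
  interpret L: normed_vspace ?L by (rule normed_vspace_bounded_sequences)
  show ?thesis
  proof (rule L.dual_ballI)
    fix u assume u: "u \<in> pts ?L"
    then obtain a where a: "u = \<iota> a" "bounded (range a)" by (rule bounded_sequences_cases)
    show "norm (if u \<in> pts ?L then inv \<iota> u k else 0) \<le> vnorm ?L u"
      using a inj bounded_sequences_coordinate_le[OF a(2), of k] by simp
    show "(if vscale ?L c u \<in> pts ?L then inv \<iota> (vscale ?L c u) k else 0)
        = c * (if u \<in> pts ?L then inv \<iota> u k else 0)" for c
      using L.scale_closed[OF u, of c] u a inj by simp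
    fix v assume v: "v \<in> pts ?L"
    then obtain b where b: "v = \<iota> b" "bounded (range b)" by (rule bounded_sequences_cases)
    show "(if vadd ?L u v \<in> pts ?L then inv \<iota> (vadd ?L u v) k else 0)
        = (if u \<in> pts ?L then inv \<iota> u k else 0) + (if v \<in> pts ?L then inv \<iota> v k else 0)"
      using L.add_closed[OF u v] u v a b inj by simp
  qed simp
qed

text \<open>
  A null sequence is the norm limit of its finite sections, and the values of \<open>\<psi>\<close> at the unit vectors
  are absolutely summable because \<open>\<psi>\<close> is bounded on sections with entries of modulus 1.\<close>

lemma functional_on_null_sequences:
  assumes \<psi>: "\<psi> \<in> pts (dual (bounded_sequences \<iota>))"
  obtains b where "summable (\<lambda>n. norm (b n))" "\<And>a. a \<longlonglongrightarrow> 0 \<Longrightarrow> (\<lambda>n. a n * b n) sums \<psi> (\<iota> a)"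
proof -
  let ?L = "bounded_sequences \<iota>"
  interpret L: normed_vspace ?L by (rule normed_vspace_bounded_sequences)
  define b where "b = (\<lambda>k. \<psi> (\<iota> (\<lambda>n. if n = k then 1 else 0)))"
  define K where "K = vnorm (dual ?L) \<psi>"
  have K: "0 \<le> K" using L.dual_norm_nonneg[OF \<psi>] by (simp add: K_def)
  have finb: "bounded (range (\<lambda>n. if n < N then a n else (0::'k)))" for N :: nat and a
  proof -
    have "finite (range (\<lambda>n. if n < N then a n else (0::'k)))"
      by (rule finite_subset[of _ "insert 0 (a ` {..<N})"]) auto
    then show ?thesis by (rule finite_imp_bounded)
  qed
  have fin: "\<psi> (\<iota> (\<lambda>n. if n < N then a n else 0)) = (\<Sum>n<N. a n * b n)" for N a
  proof (induction N)
    case 0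
    then show ?case using L.dual_vzero[OF \<psi>] by simp
  next
    case (Suc N)
    have e: "bounded (range (\<lambda>n. if n = N then 1 else (0::'k)))"
      by (rule finite_imp_bounded, rule finite_subset[of _ "{0, 1}"]) auto
    have "(\<lambda>n. if n < Suc N then a n else 0) = (\<lambda>n. (if n < N then a n else 0) + a N * (if n = N then 1 else 0))"
      by (auto simp: less_Suc_eq)
    then have "\<iota> (\<lambda>n. if n < Suc N then a n else 0)
        = vadd ?L (\<iota> (\<lambda>n. if n < N then a n else 0)) (vscale ?L (a N) (\<iota> (\<lambda>n. if n = N then 1 else 0)))"
      by simp
    then have "\<psi> (\<iota> (\<lambda>n. if n < Suc N then a n else 0)) = \<psi> (\<iota> (\<lambda>n. if n < N then a n else 0)) + a N * b N"
      using finb[of N a] e L.dual_add[OF \<psi>] L.dual_scale[OF \<psi>] L.scale_closed[of "\<iota> (\<lambda>n. if n = N then 1 else 0)" "a N"]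
      by (simp only: bounded_sequences_simps(1) b_def)
    then show ?case using Suc.IH by simp
  qed
  show ?thesis
  proof (rule that[of b])
    show "summable (\<lambda>n. norm (b n))"
    proof (rule summableI_nonneg_bounded)
      fix N
      have "\<exists>c. norm c = 1 \<and> c * b n = of_real (norm (b n))" for n
        by (meson exists_unit_rotation)
      then obtain c where c: "\<And>n. norm (c n) = 1" "\<And>n. c n * b n = of_real (norm (b n))" by metis
      have "(\<Sum>n<N. norm (b n)) = norm (\<psi> (\<iota> (\<lambda>n. if n < N then c n else 0)))"
        unfolding fin c(2) by (simp only: of_real_sum[symmetric] norm_of_real) (simp add: sum_nonneg)
      also have "\<dots> \<le> K * vnorm ?L (\<iota> (\<lambda>n. if n < N then c n else 0))"
        unfolding K_def by (rule L.dual_bound[OF \<psi>]) (simp only: bounded_sequences_simps(1) finb)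
      also have "\<dots> \<le> K * 1"
        by (intro mult_left_mono bounded_sequences_norm_le K) (simp add: c)
      finally show "(\<Sum>n<N. norm (b n)) \<le> K" by simp
    qed simp
    fix a :: "nat \<Rightarrow> 'k" assume a0: "a \<longlonglongrightarrow> 0"
    have ab: "bounded (range a)" using a0 by (rule convergent_imp_bounded)
    show "(\<lambda>n. a n * b n) sums \<psi> (\<iota> a)"
      unfolding sums_def
    proof (rule LIMSEQ_I)
      fix e :: real assume e: "0 < e"
      define d where "d = e / (K + 1)"
      have d: "0 < d" "K * d < e" using e K by (auto simp: d_def field_simps)
      obtain N where N: "\<And>n. n \<ge> N \<Longrightarrow> norm (a n) < d" using LIMSEQ_D[OF a0 d(1)] by auto
      have "norm ((\<Sum>n<m. a n * b n) - \<psi> (\<iota> a)) < e" if "m \<ge> N" for m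
      proof -
        have "(\<Sum>n<m. a n * b n) - \<psi> (\<iota> a) = \<psi> (vminus ?L (\<iota> (\<lambda>n. if n < m then a n else 0)) (\<iota> a))"
          using L.dual_vminus[OF \<psi>, of "\<iota> (\<lambda>n. if n < m then a n else 0)" "\<iota> a"] finb[of m a] ab fin[of m a]
          by (simp del: bounded_sequences_simps(5))
        also have "norm \<dots> \<le> K * vnorm ?L (vminus ?L (\<iota> (\<lambda>n. if n < m then a n else 0)) (\<iota> a))"
          unfolding K_def using finb[of m a] ab by (intro L.dual_bound[OF \<psi>] L.vminus_closed) simp_all
        also have "\<dots> \<le> K * d"
        proof (intro mult_left_mono K)
          have "norm ((if n < m then a n else 0) - a n) \<le> d" for n
            using N[of n] that d(1) by (cases "n < m") auto
          then show "vnorm ?L (vminus ?L (\<iota> (\<lambda>n. if n < m then a n else 0)) (\<iota> a)) \<le> d"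
            unfolding bounded_sequences_simps by (rule bounded_sequences_norm_le)
        qed
        finally show ?thesis using d(2) by linarith
      qed
      then show "\<exists>N. \<forall>m\<ge>N. norm ((\<Sum>n<m. a n * b n) - \<psi> (\<iota> a)) < e" by blast
    qed
  qed
qed

text \<open>
  The operator extends to the bidual by \<open>\<phi> \<mapsto> (\<phi> (g k))\<^sub>k\<close>, with values in the null sequences.  For a
  functional \<open>\<psi>\<close> the composite \<open>\<phi> \<mapsto> \<Sum>\<^sub>k \<phi> (g k) * b k\<close> is a uniform limit, on the bidual ball, of weak-star
  continuous functions.  So the image of the bidual ball is weakly compact, and it contains the image of
  the ball of \<open>X\<close>.\<close>

lemma weakly_null_functionals_operator:
  assumes X: "banach_space X" and g: "\<And>k. g k \<in> pts (dual X)"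
    and null: "\<And>\<phi>. \<phi> \<in> pts (dual (dual X)) \<Longrightarrow> (\<lambda>k. \<phi> (g k)) \<longlonglongrightarrow> 0"
  shows "weakly_compact_operator X (bounded_sequences \<iota>) (\<lambda>x. \<iota> (\<lambda>k. g k x))"
proof -
  interpret X: banach_space X by fact
  interpret DX: normed_vspace "dual X" by (rule X.normed_vspace_dual)
  let ?L = "bounded_sequences \<iota>"
  interpret L: normed_vspace ?L by (rule normed_vspace_bounded_sequences)
  have pointwise: "(\<lambda>k. g k x) \<longlonglongrightarrow> 0" if "x \<in> pts X" for x
    using null[OF X.evaluation_in_bidual[OF that]] g by (simp add: X.evaluation_def)
  have bdd: "\<exists>R. \<forall>n. norm (g n x) \<le> R" if "x \<in> pts X" for x
    using convergent_imp_bounded[OF pointwise[OF that]] unfolding bounded_iff by auto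
  obtain M where M: "0 < M" "\<And>n x. x \<in> pts X \<Longrightarrow> norm (g n x) \<le> M * vnorm X x"
    using X.uniform_boundedness[OF g bdd] by blast
  have gM: "vnorm (dual X) (g n) \<le> M" for n using M by (intro X.dual_norm_le) auto
  define T where "T = (\<lambda>x. \<iota> (\<lambda>k. g k x))"
  have op: "operator X ?L T"
    unfolding operator_iff_bounded[OF X.normed_vspace_axioms L.normed_vspace_axioms]
  proof (intro conjI ballI allI exI)
    have "bounded (range (\<lambda>k. g k x))" if "x \<in> pts X" for x by (rule convergent_imp_bounded[OF pointwise[OF that]])
    then show "T \<in> pts X \<rightarrow> pts ?L" by (auto simp: T_def)
    show "vnorm ?L (T x) \<le> M * vnorm X x" if "x \<in> pts X" for x
      unfolding T_def using M(2)[OF that] by (rule bounded_sequences_norm_le)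
  qed (simp_all add: T_def X.dual_add[OF g] X.dual_scale[OF g])
  define B where "B = unit_ball (dual (dual X))"
  define \<Theta> where "\<Theta> = (\<lambda>\<phi>. \<iota> (\<lambda>k. \<phi> (g k)))"
  have Bnull: "(\<lambda>k. \<phi> (g k)) \<longlonglongrightarrow> 0" if "\<phi> \<in> B" for \<phi>
    using null ball_subset_pts that unfolding B_def by metis
  have "continuous_map (top_of_set B) (weak_topology ?L) \<Theta>"
    unfolding L.continuous_map_into_weak
  proof (intro conjI ballI)
    have "bounded (range (\<lambda>k. \<phi> (g k)))" if "\<phi> \<in> B" for \<phi> by (rule convergent_imp_bounded[OF Bnull[OF that]])
    then show "\<Theta> ` topspace (top_of_set B) \<subseteq> pts ?L" by (auto simp: \<Theta>_def)
    fix \<psi> assume "\<psi> \<in> pts (dual ?L)"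
    then obtain b where b: "summable (\<lambda>n. norm (b n))" "\<And>a. a \<longlonglongrightarrow> 0 \<Longrightarrow> (\<lambda>n. a n * b n) sums \<psi> (\<iota> a)"
      using functional_on_null_sequences by blast
    have "uniform_limit B (\<lambda>N \<phi>. \<Sum>n<N. emb (\<phi> (g n) * b n)) (\<lambda>\<phi>. \<Sum>n. emb (\<phi> (g n) * b n)) sequentially"
    proof (rule Weierstrass_m_test)
      show "summable (\<lambda>n. M * norm (b n))" by (rule summable_mult[OF b(1)])
      fix n \<phi> assume "\<phi> \<in> B"
      then have "norm (\<phi> (g n)) \<le> M" using DX.dual_ball_bound[OF _ g] gM unfolding B_def by (meson order_trans)
      then show "norm (emb (\<phi> (g n) * b n)) \<le> M * norm (b n)" by (simp add: norm_mult mult_right_mono)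
    qed
    moreover have "\<forall>\<^sub>F N in sequentially. continuous_on B (\<lambda>\<phi>. \<Sum>n<N. emb (\<phi> (g n) * b n))"
      unfolding emb_sum[symmetric] continuous_on_emb_iff
      by (intro always_eventually allI continuous_intros continuous_on_subset[OF continuous_on_product_coordinates]) simp
    ultimately have "continuous_on B (\<lambda>\<phi>. \<Sum>n. emb (\<phi> (g n) * b n))"
      by (intro uniform_limit_theorem[rotated]) auto
    moreover have "(\<Sum>n. emb (\<phi> (g n) * b n)) = emb (\<psi> (\<Theta> \<phi>))" if "\<phi> \<in> B" for \<phi>
    proof -
      have "(\<lambda>n. emb (\<phi> (g n) * b n)) sums emb (\<psi> (\<Theta> \<phi>))"
        using b(2)[OF Bnull[OF that]] unfolding sums_def emb_sum[symmetric] tendsto_emb_iff \<Theta>_def .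
      then show ?thesis by (rule sums_unique[symmetric])
    qed
    ultimately have "continuous_on B (\<lambda>\<phi>. emb (\<psi> (\<Theta> \<phi>)))" by (rule continuous_on_eq)
    then have "continuous_on B (\<lambda>\<phi>. \<psi> (\<Theta> \<phi>))" unfolding continuous_on_emb_iff .
    then show "continuous_map (top_of_set B) euclidean (\<lambda>\<phi>. \<psi> (\<Theta> \<phi>))" by simp
  qed
  moreover have "compactin (top_of_set B) B"
    using DX.Alaoglu by (simp add: compactin_subtopology B_def)
  ultimately have comp: "compactin (weak_topology ?L) (\<Theta> ` B)" by (rule image_compactin[rotated])
  have sub: "T ` unit_ball X \<subseteq> \<Theta> ` B"
  proof
    fix u assume "u \<in> T ` unit_ball X"
    then obtain x where x: "x \<in> unit_ball X" "u = T x" by blast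
    have "u = \<Theta> (X.evaluation x)" using x g by (simp add: T_def \<Theta>_def X.evaluation_def)
    then show "u \<in> \<Theta> ` B" using X.evaluation_in_ball[OF x(1)] by (simp add: B_def)
  qed
  have "Hausdorff_space (weak_topology ?L)" by (rule L.Hausdorff_weak)
  then have "closedin (weak_topology ?L) (\<Theta> ` B)" using comp by (rule compactin_imp_closedin)
  then have "weak_topology ?L closure_of (T ` unit_ball X) \<subseteq> \<Theta> ` B" using sub by (rule closure_of_minimal[rotated])
  then have "compactin (weak_topology ?L) (weak_topology ?L closure_of (T ` unit_ball X))"
    using comp by (intro closed_compactin[OF comp]) auto
  then show ?thesis using op by (simp add: weakly_compact_operator_def T_def)
qed

end

section \<open>Weakly summable sequences and operators from sequence spaces\<close>

lemma (in normed_vspace) weakly_p_summable_bound: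
  assumes p: "0 < p" and wps: "weakly_p_summable p X x"
  obtains C where "0 \<le> C"
    "\<And>f M N. \<lbrakk>f \<in> pts (dual X); 0 < M; vnorm (dual X) f \<le> M\<rbrakk> \<Longrightarrow> (\<Sum>n<N. norm (f (x n)) powr p) \<le> (M * C) powr p"
proof -
  obtain C where C: "0 \<le> C" "\<forall>f\<in>unit_ball (dual X). \<forall>N. (\<Sum>n<N. norm (f (x n)) powr p) \<le> C powr p"
    using wps unfolding weakly_p_summable_iff[OF p] by blast
  have "(\<Sum>n<N. norm (f (x n)) powr p) \<le> (M * C) powr p"
    if f: "f \<in> pts (dual X)" "0 < M" "vnorm (dual X) f \<le> M" for f M N
  proof -
    have "(\<Sum>n<N. norm (of_real (1 / M) * f (x n)) powr p) \<le> C powr p"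
      using bspec[OF C(2) scaled_dual_in_ball[OF f]] by simp
    then have "M powr p * (\<Sum>n<N. norm (of_real (1 / M) * f (x n)) powr p) \<le> M powr p * C powr p"
      by (intro mult_left_mono) auto
    moreover have "M powr p * norm (of_real (1 / M) * f (x n)) powr p = norm (f (x n)) powr p" for n
      using f(2) by (simp add: norm_mult norm_divide powr_divide)
    ultimately show ?thesis using f(2) C(1) by (simp add: sum_distrib_left powr_mult)
  qed
  then show ?thesis using that C(1) by blast
qed

lemma (in normed_vspace) weakly_p_summable_imp_weakly_null:
  assumes p: "0 < p" and wps: "weakly_p_summable p X x" and f: "f \<in> pts (dual X)"
  shows "(\<lambda>n. f (x n)) \<longlonglongrightarrow> 0"
proof -
  obtain C where C: "0 \<le> C"
    "\<And>f M N. \<lbrakk>f \<in> pts (dual X); 0 < M; vnorm (dual X) f \<le> M\<rbrakk> \<Longrightarrow> (\<Sum>n<N. norm (f (x n)) powr p) \<le> (M * C) powr p"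
    using weakly_p_summable_bound[OF p wps] by blast
  define M where "M = vnorm (dual X) f + 1"
  have M: "0 < M" "vnorm (dual X) f \<le> M" using dual_norm_nonneg[OF f] by (auto simp: M_def)
  have "summable (\<lambda>n. norm (f (x n)) powr p)"
    by (rule summableI_nonneg_bounded[of _ "(M * C) powr p"]) (use C(2)[OF f M] in auto)
  then have lim: "(\<lambda>n. norm (f (x n)) powr p) \<longlonglongrightarrow> 0" by (rule summable_LIMSEQ_zero)
  show ?thesis
  proof (rule LIMSEQ_I)
    fix e :: real assume e: "0 < e"
    then have "0 < e powr p" by simp
    then obtain N where N: "\<And>n. n \<ge> N \<Longrightarrow> norm (f (x n)) powr p < e powr p"
      using LIMSEQ_D[OF lim] by fastforce
    have "norm (f (x n)) < e" if "n \<ge> N" for n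
      using N[OF that] powr_le_powr_iff[of e "norm (f (x n))" p] e p by (simp add: not_le[symmetric])
    then show "\<exists>N. \<forall>n\<ge>N. norm (f (x n) - 0) < e" by auto
  qed
qed

abbreviation unit_vector :: "nat \<Rightarrow> nat \<Rightarrow> 'k::real_or_complex" where
  "unit_vector k \<equiv> (\<lambda>n. if n = k then 1 else 0)"

lemma combination_unit_vectors:
  "combination (lp_space q) a unit_vector N = (\<lambda>n. if n < N then a n else 0)"
  by (induction N) (auto simp: less_Suc_eq)

lemma lp_functional_series:
  fixes \<psi> :: "(nat \<Rightarrow> 'k::real_or_complex) \<Rightarrow> 'k"
  assumes q: "1 \<le> q" and \<psi>: "\<psi> \<in> pts (dual (lp_space q))" and a: "a \<in> pts (lp_space q)"
  shows "(\<lambda>n. a n * \<psi> (unit_vector n)) sums \<psi> a"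
proof -
  let ?L = "lp_space q :: ('k, nat \<Rightarrow> 'k) nspace"
  interpret L: normed_vspace ?L by (rule normed_vspace_lp[OF q])
  have q0: "0 < q" using q by simp
  have e: "range unit_vector \<subseteq> pts ?L" using ball_subset_pts[OF lp_unit_vector[OF q0]] by blast
  define K where "K = vnorm (dual ?L) \<psi> + 1"
  have K: "0 < K" "vnorm (dual ?L) \<psi> \<le> K" using L.dual_norm_nonneg[OF \<psi>] by (auto simp: K_def)
  show ?thesis
    unfolding sums_def L.dual_combination[OF \<psi> e, symmetric] combination_unit_vectors
  proof (rule LIMSEQ_I)
    fix \<epsilon> :: real assume \<epsilon>: "0 < \<epsilon>"
    define d where "d = \<epsilon> / (2 * K)"
    have d: "0 < d" "K * d < \<epsilon>" using \<epsilon> K by (auto simp: d_def)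
    obtain N where N: "(\<lambda>n. if n < N then 0 else a n) \<in> pts ?L" "vnorm ?L (\<lambda>n. if n < N then 0 else a n) \<le> d"
      using lp_tail_small[OF q0 a d(1)] by blast
    have N': "(\<Sum>n<m. norm (if n < N then 0 else a n) powr q) \<le> d powr q" for m
      by (rule iffD1[OF lp_space_norm_le_iff[OF q0 less_imp_le[OF d(1)]] conjI[OF N], rule_format])
    have "norm (\<psi> (\<lambda>n. if n < M then a n else 0) - \<psi> a) < \<epsilon>" if M: "M \<ge> N" for M
    proof -
      have "(\<Sum>n<m. norm ((if n < M then a n else 0) - a n) powr q) \<le> d powr q" for m
      proof -
        have "(\<Sum>n<m. norm ((if n < M then a n else 0) - a n) powr q) \<le> (\<Sum>n<m. norm (if n < N then 0 else a n) powr q)"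
          using M by (intro sum_mono) auto
        then show ?thesis using N'[of m] by linarith
      qed
      note t = lp_spaceI[OF q0 less_imp_le[OF d(1)] this]
      have c: "(\<lambda>n. if n < M then a n else 0) \<in> pts ?L"
        using L.combination_closed[OF e, of a M] unfolding combination_unit_vectors .
      have "norm (\<psi> (\<lambda>n. if n < M then a n else 0) - \<psi> a) = norm (\<psi> (\<lambda>n. (if n < M then a n else 0) - a n))"
        using L.dual_vminus[OF \<psi> c a] by simp
      also have "\<dots> \<le> vnorm (dual ?L) \<psi> * vnorm ?L (\<lambda>n. (if n < M then a n else 0) - a n)"
        by (rule L.dual_bound[OF \<psi> t(1)])
      also have "\<dots> \<le> K * d" using K t(2) lp_space_norm_nonneg by (intro mult_mono) auto
      finally show ?thesis using d(2) by linarith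
    qed
    then show "\<exists>N. \<forall>M\<ge>N. norm (\<psi> (\<lambda>n. if n < M then a n else 0) - \<psi> a) < \<epsilon>" by blast
  qed
qed

lemma operator_series:
  fixes X :: "('k::real_or_complex, 'v) nspace"
  assumes q: "1 \<le> q" and X: "normed_vspace X" and S: "operator (lp_space q) X S"
    and f: "f \<in> pts (dual X)" and a: "a \<in> pts (lp_space q)"
  shows "(\<lambda>n. a n * f (S (unit_vector n))) sums f (S a)"
proof -
  have "unit_vector n \<in> pts (lp_space q :: ('k, nat \<Rightarrow> 'k) nspace)" for n
    using q by (intro ball_subset_pts lp_unit_vector) simp
  then show ?thesis
    using lp_functional_series[OF q dual_operator_in_dual[OF normed_vspace_lp[OF q] X S f] a] a by simp
qed

text \<open>
  For \<open>f\<close> in the dual ball, the \<open>p\<close>-sums of the values \<open>f (S e\<^sub>n)\<close> are recovered by evaluating \<open>f \<circ> S\<close> at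
  the extremal vectors of Hoelder's inequality, which lie in the unit ball.\<close>

lemma operator_unit_vectors_summable:
  fixes X :: "('k::real_or_complex, 'v) nspace"
  assumes p: "1 < p" and X: "normed_vspace X" and S: "operator (lp_space (conjugate_exponent p)) X S"
  shows "weakly_p_summable p X (\<lambda>n. S (unit_vector n))"
proof -
  interpret X: normed_vspace X by fact
  define q where "q = conjugate_exponent p"
  have p0: "0 < p" and q: "1 < q" "1 \<le> q" "0 < q" using p conjugate_exponent(1)[OF p] by (auto simp: q_def)
  note S = S[folded q_def]
  let ?L = "lp_space q :: ('k, nat \<Rightarrow> 'k) nspace"
  interpret L: normed_vspace ?L by (rule normed_vspace_lp[OF q(2)])
  have Sp: "S a \<in> pts X" if "a \<in> pts ?L" for a using S that by (auto simp: operator_def)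
  obtain C where C: "\<And>a. a \<in> pts ?L \<Longrightarrow> vnorm X (S a) \<le> C * vnorm ?L a"
    using S unfolding operator_iff_bounded[OF L.normed_vspace_axioms X] by blast
  have e: "range unit_vector \<subseteq> pts ?L" using ball_subset_pts[OF lp_unit_vector[OF q(3)]] by blast
  have "(\<Sum>n<N. norm (f (S (unit_vector n))) powr p) \<le> \<bar>C\<bar> powr p" if f: "f \<in> unit_ball (dual X)" for f N
  proof -
    define s where "s = (\<Sum>n<N. norm (f (S (unit_vector n))) powr p)"
    have s0: "0 \<le> s" unfolding s_def by (intro sum_nonneg) auto
    obtain a where a: "(\<Sum>n<N. norm (a n) powr q) \<le> 1" "(\<Sum>n<N. a n * f (S (unit_vector n))) = of_real (s powr (1 / p))"
      using Holder_extremal[OF p finite_lessThan, of N "\<lambda>n. f (S (unit_vector n))"] unfolding q_def s_def by blast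
    define c where "c = (\<lambda>n. if n < N then a n else 0)"
    have "(\<Sum>n<m. norm (c n) powr q) \<le> 1 powr q" for m
    proof -
      have "(\<Sum>n<m. norm (c n) powr q) \<le> (\<Sum>n<m + N. norm (c n) powr q)" by (intro sum_mono2) auto
      also have "\<dots> = (\<Sum>n<N. norm (c n) powr q)"
        using q by (intro sum.mono_neutral_right) (auto simp: c_def)
      also have "\<dots> = (\<Sum>n<N. norm (a n) powr q)" by (intro sum.cong) (auto simp: c_def)
      finally show ?thesis using a(1) by simp
    qed
    note c = lp_spaceI[OF q(3) zero_le_one this]
    have "f (S c) = (\<Sum>n<N. a n * f (S (unit_vector n)))"
      using L.dual_combination[OF dual_operator_in_dual[OF L.normed_vspace_axioms X S ball_subset_pts[OF f]] e, of a N]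
        c(1) e unfolding combination_unit_vectors c_def[symmetric] by (simp add: image_subset_iff)
    then have "s powr (1 / p) = norm (f (S c))" using a(2) by simp
    also have "\<dots> \<le> vnorm X (S c)" by (rule X.dual_ball_bound[OF f Sp[OF c(1)]])
    also have "\<dots> \<le> C * vnorm ?L c" by (rule C[OF c(1)])
    also have "\<dots> \<le> \<bar>C\<bar> * 1" using c(2) lp_space_norm_nonneg[of q c] by (intro mult_mono) auto
    finally have "(s powr (1 / p)) powr p \<le> \<bar>C\<bar> powr p" using p0 by (intro powr_mono2) auto
    then show ?thesis using s0 p0 by (simp add: powr_powr s_def)
  qed
  moreover have "range (\<lambda>n. S (unit_vector n)) \<subseteq> pts X" using Sp e by auto
  ultimately show ?thesis unfolding weakly_p_summable_iff[OF p0] by (auto intro!: exI[of _ "\<bar>C\<bar>"])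
qed

section \<open>The seminorms of the Right topology and of \<open>\<rho>\<^sub>p\<^sup>*\<close>\<close>

lemma SUP_norm_triangle:
  fixes u v :: "'i \<Rightarrow> 'a::real_normed_vector"
  assumes "F \<noteq> {}" and u: "\<And>i. i \<in> F \<Longrightarrow> norm (u i) \<le> M" and v: "\<And>i. i \<in> F \<Longrightarrow> norm (v i) \<le> M'"
  shows "(SUP i\<in>F. norm (u i + v i)) \<le> (SUP i\<in>F. norm (u i)) + (SUP i\<in>F. norm (v i))"
proof (rule cSUP_least[OF assms(1)])
  fix i assume i: "i \<in> F"
  have "norm (u i) \<le> (SUP i\<in>F. norm (u i))" using u i by (intro cSUP_upper bdd_aboveI2[of _ _ M]) auto
  moreover have "norm (v i) \<le> (SUP i\<in>F. norm (v i))" using v i by (intro cSUP_upper bdd_aboveI2[of _ _ M']) auto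
  ultimately show "norm (u i + v i) \<le> (SUP i\<in>F. norm (u i)) + (SUP i\<in>F. norm (v i))"
    using norm_triangle_ineq[of "u i" "v i"] by linarith
qed

lemma (in normed_vspace) limitin_right_topology_zero:
  assumes x: "range x \<subseteq> pts X"
  shows "limitin (right_topology X) x (vzero X) sequentially \<longleftrightarrow>
     (\<forall>F. F \<noteq> {} \<and> F \<subseteq> unit_ball (dual X) \<and> compactin (weak_topology (dual X)) F \<longrightarrow>
       (\<forall>e>0. \<forall>\<^sub>F n in sequentially. (SUP f\<in>F. norm (f (x n))) < e))"
proof -
  interpret D: normed_vspace "dual X" by (rule normed_vspace_dual)
  define Q where "Q = {(\<lambda>x. SUP f\<in>F. norm (f x)) | F.
       F \<noteq> {} \<and> F \<subseteq> unit_ball (dual X) \<and> compactin (weak_topology (dual X)) F}"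
  have xp: "x n \<in> pts X" for n using x by auto
  have "compactin (weak_topology (dual X)) {vzero (dual X)}"
    using D.zero_closed by (intro finite_imp_compactin) (simp_all add: D.topspace_weak del: dual_simps)
  then have "(\<lambda>x. SUP f\<in>{vzero (dual X)}. norm (f x)) \<in> Q"
    unfolding Q_def using D.zero_in_ball by blast
  then have "Q \<noteq> {}" by blast
  then have "limitin (seminorm_topology X Q) x (vzero X) sequentially \<longleftrightarrow>
     (\<forall>q\<in>Q. \<forall>e>0. \<forall>\<^sub>F n in sequentially. q (vminus X (x n) (vzero X)) < e)"
  proof (rule limitin_seminorm_topology[OF _ _ _ x zero_closed])
    fix q assume "q \<in> Q"
    then obtain F where F: "q = (\<lambda>x. SUP f\<in>F. norm (f x))" "F \<noteq> {}" "F \<subseteq> unit_ball (dual X)" unfolding Q_def by blast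
    have Fp: "f \<in> pts (dual X)" if "f \<in> F" for f by (rule ball_subset_pts[OF subsetD[OF F(3) that]])
    have "(SUP f\<in>F. norm (f (vzero X))) = (SUP f\<in>F. 0)"
      by (intro SUP_cong refl) (simp add: dual_vzero Fp)
    then show "q (vzero X) = 0" using F(1,2) by simp
    fix u v assume uv: "u \<in> pts X" "v \<in> pts X"
    have "(SUP f\<in>F. norm (f (vadd X u v))) = (SUP f\<in>F. norm (f u + f v))"
      using uv by (intro SUP_cong refl) (simp add: dual_add Fp)
    also have "\<dots> \<le> (SUP f\<in>F. norm (f u)) + (SUP f\<in>F. norm (f v))"
      using F(3) uv by (intro SUP_norm_triangle[OF F(2), of _ "vnorm X u" _ "vnorm X v"] dual_ball_bound) auto
    finally show "q (vadd X u v) \<le> q u + q v" by (simp add: F(1))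
  qed
  then have "limitin (seminorm_topology X Q) x (vzero X) sequentially \<longleftrightarrow>
     (\<forall>q\<in>Q. \<forall>e>0. \<forall>\<^sub>F n in sequentially. q (x n) < e)" using xp by simp
  then show ?thesis unfolding right_topology_def Q_def[symmetric] by (auto simp: Q_def)
qed

lemma relatively_weakly_p_compact_bounded:
  fixes X :: "('k::real_or_complex, 'v) nspace"
  assumes p: "1 < p" and X: "normed_vspace X" and F: "relatively_weakly_p_compact p X F"
  obtains C where "0 \<le> C" "\<And>x. x \<in> F \<Longrightarrow> x \<in> pts X \<and> vnorm X x \<le> C"
proof -
  let ?L = "lp_space (conjugate_exponent p) :: ('k, nat \<Rightarrow> 'k) nspace"
  have L: "normed_vspace ?L" using conjugate_exponent(1)[OF p] by (intro normed_vspace_lp) simp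
  obtain S where S: "operator ?L X S" "F \<subseteq> S ` unit_ball ?L"
    using F unfolding relatively_weakly_p_compact_def by blast
  obtain C where C: "\<And>a. a \<in> pts ?L \<Longrightarrow> vnorm X (S a) \<le> C * vnorm ?L a"
    using S(1) unfolding operator_iff_bounded[OF L X] by blast
  have "x \<in> pts X \<and> vnorm X x \<le> \<bar>C\<bar>" if "x \<in> F" for x
  proof -
    obtain a where a: "a \<in> unit_ball ?L" "x = S a" using S(2) \<open>x \<in> F\<close> by blast
    have "vnorm X x \<le> C * vnorm ?L a" using C[OF ball_subset_pts[OF a(1)]] a(2) by simp
    also have "\<dots> \<le> \<bar>C\<bar> * 1" using a(1) lp_space_norm_nonneg[of _ a] by (intro mult_mono) (auto simp: unit_ball_def)
    finally show ?thesis using S(1) ball_subset_pts[OF a(1)] a(2) by (auto simp: operator_def)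
  qed
  then show ?thesis using that[of "\<bar>C\<bar>"] by simp
qed

lemma (in banach_space) limitin_rho_star_topology:
  assumes p: "1 < p" and f: "range f \<subseteq> pts (dual X)"
  shows "limitin (rho_star_topology p X) f h sequentially \<longleftrightarrow> h \<in> pts (dual X) \<and>
     (\<forall>F. F \<noteq> {} \<and> relatively_weakly_p_compact p X F \<longrightarrow>
       (\<forall>e>0. \<forall>\<^sub>F n in sequentially. (SUP x\<in>F. norm (f n x - h x)) < e))"
proof -
  interpret D: normed_vspace "dual X" by (rule normed_vspace_dual)
  have p0: "0 < p" using p by simp
  define Q where "Q = {(\<lambda>f :: 'b \<Rightarrow> 'a. SUP x\<in>F. norm (f x)) | F. F \<noteq> {} \<and> relatively_weakly_p_compact p X F}"
  have "weakly_p_summable p X (\<lambda>n::nat. vzero X)"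
    unfolding weakly_p_summable_iff[OF p0]
  proof (intro conjI exI[of _ 0] ballI allI)
    fix f and N :: nat assume "f \<in> unit_ball (dual X)"
    then show "(\<Sum>n<N. norm (f (vzero X)) powr p) \<le> 0 powr p" using dual_vzero[OF ball_subset_pts[of f]] by simp
  qed (use zero_closed in auto)
  then have "relatively_weakly_p_compact p X (range (\<lambda>n::nat. vzero X))" by (rule range_relatively_weakly_p_compact[OF p])
  then have ne: "Q \<noteq> {}" unfolding Q_def by blast
  have iff: "limitin (seminorm_topology (dual X) Q) f h sequentially \<longleftrightarrow>
     (\<forall>q\<in>Q. \<forall>e>0. \<forall>\<^sub>F n in sequentially. q (vminus (dual X) (f n) h) < e)" if h: "h \<in> pts (dual X)"
  proof (rule D.limitin_seminorm_topology[OF ne _ _ f h])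
    fix q assume "q \<in> Q"
    then obtain F where F: "q = (\<lambda>f. SUP x\<in>F. norm (f x))" "F \<noteq> {}" "relatively_weakly_p_compact p X F" unfolding Q_def by blast
    show "q (vzero (dual X)) = 0" using F(2) by (simp add: F(1))
    obtain C where C: "0 \<le> C" "\<And>x. x \<in> F \<Longrightarrow> x \<in> pts X \<and> vnorm X x \<le> C"
      using relatively_weakly_p_compact_bounded[OF p normed_vspace_axioms F(3)] by blast
    fix u v assume uv: "u \<in> pts (dual X)" "v \<in> pts (dual X)"
    have bd: "norm (w x) \<le> vnorm (dual X) w * C" if "w \<in> pts (dual X)" "x \<in> F" for w x
    proof -
      have "norm (w x) \<le> vnorm (dual X) w * vnorm X x" using dual_bound[OF that(1)] C(2)[OF that(2)] by blast
      also have "\<dots> \<le> vnorm (dual X) w * C" using C(2)[OF that(2)] by (intro mult_left_mono dual_norm_nonneg that(1)) simp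
      finally show ?thesis .
    qed
    show "q (vadd (dual X) u v) \<le> q u + q v"
      unfolding F(1) dual_simps by (rule SUP_norm_triangle[OF F(2) bd[OF uv(1)] bd[OF uv(2)]])
  qed
  have top: "topspace (seminorm_topology (dual X) Q) \<subseteq> pts (dual X)"
    unfolding seminorm_topology_def topology_generated_by_topspace by blast
  have "limitin (seminorm_topology (dual X) Q) f h sequentially \<longleftrightarrow> h \<in> pts (dual X) \<and>
     (\<forall>q\<in>Q. \<forall>e>0. \<forall>\<^sub>F n in sequentially. q (vminus (dual X) (f n) h) < e)"
  proof (cases "h \<in> pts (dual X)")
    case True then show ?thesis using iff by simp
  next
    case False
    then have "\<not> limitin (seminorm_topology (dual X) Q) f h sequentially"
      using top limitin_topspace[of "seminorm_topology (dual X) Q" f h sequentially] by auto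
    then show ?thesis using False by simp
  qed
  then show ?thesis unfolding rho_star_topology_def Q_def[symmetric] by (auto simp: Q_def)
qed

section \<open>The three implications\<close>

text \<open>The unconditional summability of the images under \<open>x \<mapsto> (g k x)\<^sub>k\<close>, tested on the coordinate
  functionals, is a bound for the tails that does not depend on \<open>k\<close>.  A nonzero \<open>X\<close> contains a copy of the
  scalar field, so the given type is large enough for all scalar sequences; for \<open>X = 0\<close> it may have a
  single element, but then all values are 0.\<close>

lemma DPP_uniform_tails:
  fixes X :: "('k::real_or_complex, 'v) nspace" and g :: "nat \<Rightarrow> 'v \<Rightarrow> 'k"
  assumes X: "banach_space X" and p: "0 < p" and universe: "pts X \<lesssim> (UNIV :: 'w set)"
    and DPP: "DPP TYPE('w) p X" and g: "\<And>k. g k \<in> pts (dual X)"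
    and null: "\<And>\<phi>. \<phi> \<in> pts (dual (dual X)) \<Longrightarrow> (\<lambda>k. \<phi> (g k)) \<longlonglongrightarrow> 0"
    and wps: "weakly_p_summable p X x" and e: "0 < e"
  shows "\<exists>m. \<forall>k N. (\<Sum>n<N. norm (g k (x (m + n))) powr p) \<le> e powr p"
proof -
  interpret X: banach_space X by fact
  have xp: "x n \<in> pts X" for n using wps by (auto simp: weakly_p_summable_def)
  show ?thesis
  proof (cases "pts X = {vzero X}")
    case True
    then have "g k (x n) = 0" for k n using X.dual_vzero[OF g] xp by fastforce
    then show ?thesis by simp
  next
    case False
    then obtain x0 where x0: "x0 \<in> pts X" "x0 \<noteq> vzero X" using X.zero_closed by blast
    have "(UNIV :: 'k set) \<lesssim> pts X"
      unfolding lepoll_def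
    proof (intro exI conjI)
      show "inj_on (\<lambda>c. vscale X c x0) UNIV"
      proof (rule inj_onI)
        fix a b assume "vscale X a x0 = vscale X b x0"
        then have "vscale X (a - b) x0 = vzero X"
          using x0 X.scale_add_left[of x0 a "- b"] X.scale_add_left[of x0 b "- b"] by simp
        then have "norm (a - b) * vnorm X x0 = 0" using X.norm_scale[OF x0(1), of "a - b"] by simp
        then show "a = b" using x0 X.norm_eq_zero[OF x0(1)] by simp
      qed
      show "range (\<lambda>c. vscale X c x0) \<subseteq> pts X" using x0 X.scale_closed by blast
    qed
    from lepoll_trans[OF lepoll_trans[OF sequences_lepoll_scalars this] universe]
    have "(UNIV :: (nat \<Rightarrow> 'k) set) \<lesssim> (UNIV :: 'w set)" .
    then obtain \<iota> :: "(nat \<Rightarrow> 'k) \<Rightarrow> 'w" where \<iota>: "inj \<iota>" unfolding lepoll_def by blast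
    let ?L = "bounded_sequences \<iota>"
    define T where "T = (\<lambda>x. \<iota> (\<lambda>k. g k x))"
    have T: "weakly_compact_operator X ?L T"
      unfolding T_def by (rule weakly_null_functionals_operator[where g=g, OF \<iota> X g null])
    then have "unconditionally_p_converging p X ?L T"
      using DPP banach_bounded_sequences[OF \<iota>] unfolding DPP_def by blast
    then have "unconditionally_p_summable p ?L (\<lambda>n. T (x n))"
      using wps unfolding unconditionally_p_converging_def by blast
    then obtain m where m: "\<forall>f\<in>unit_ball (dual ?L). \<forall>N. (\<Sum>n<N. norm (f (T (x (m + n)))) powr p) \<le> e powr p"
      using e unfolding unconditionally_p_summable_iff[OF p] by blast
    have "(\<Sum>n<N. norm (g k (x (m + n))) powr p) \<le> e powr p" for k N
    proof -
      have "T (x n) \<in> pts ?L" for n using T xp by (auto simp: weakly_compact_operator_def operator_def)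
      then show ?thesis
        using bspec[OF m coordinate_in_ball[OF \<iota>, of k], THEN spec, of N] by (simp add: T_def \<iota>)
    qed
    then show ?thesis by blast
  qed
qed

text \<open>On \<open>F \<subseteq> S ` unit_ball\<close> the value of \<open>f k - g\<close> at \<open>S a\<close> is the series \<open>\<Sum>\<^sub>n a\<^sub>n (f k - g) (S e\<^sub>n)\<close>: its tail
  is small uniformly in \<open>a\<close> and \<open>k\<close>, its head tends to 0 because \<open>|a\<^sub>n| \<le> 1\<close>.\<close>

lemma DPP_imp_rho_star_convergent:
  fixes X :: "('k::real_or_complex, 'v) nspace"
  assumes X: "banach_space X" and p: "1 < p" and universe: "pts X \<lesssim> (UNIV :: 'w set)"
    and DPP: "DPP TYPE('w) p X" and f: "range f \<subseteq> pts (dual X)"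
    and lim: "limitin (weak_topology (dual X)) f g sequentially"
  shows "limitin (rho_star_topology p X) f g sequentially"
proof -
  interpret X: banach_space X by fact
  interpret D: normed_vspace "dual X" by (rule X.normed_vspace_dual)
  define q where "q = conjugate_exponent p"
  have p0: "0 < p" and q: "1 < q" "1 \<le> q" "0 < q" using p conjugate_exponent(1)[OF p] by (auto simp: q_def)
  have g: "g \<in> pts (dual X)" and f_lim: "\<And>\<phi>. \<phi> \<in> pts (dual (dual X)) \<Longrightarrow> (\<lambda>k. \<phi> (f k)) \<longlonglongrightarrow> \<phi> g"
    using lim unfolding D.limitin_weak_iff[OF f] by auto
  have fp: "f k \<in> pts (dual X)" for k using f by auto
  define G where "G = (\<lambda>k x. f k x - g x)"
  have G: "G k \<in> pts (dual X)" for k using D.vminus_closed[OF fp g, of k] by (simp add: G_def)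
  have null: "(\<lambda>k. \<phi> (G k)) \<longlonglongrightarrow> 0" if "\<phi> \<in> pts (dual (dual X))" for \<phi>
  proof -
    have "\<phi> (G k) = \<phi> (f k) - \<phi> g" for k using D.dual_vminus[OF that fp g, of k] by (simp add: G_def)
    then show ?thesis using f_lim[OF that] by (simp add: LIM_zero_iff)
  qed
  have "\<forall>\<^sub>F k in sequentially. (SUP x\<in>F. norm (f k x - g x)) < e"
    if F: "F \<noteq> {}" "relatively_weakly_p_compact p X F" and e: "0 < e" for F e
  proof -
    obtain S where S: "operator (lp_space q) X S" "F \<subseteq> S ` unit_ball (lp_space q)"
      using F(2) unfolding relatively_weakly_p_compact_def q_def by blast
    define x where "x = (\<lambda>n. S (unit_vector n))"
    have wps: "weakly_p_summable p X x"
      unfolding x_def by (rule operator_unit_vectors_summable[OF p X.normed_vspace_axioms S(1)[unfolded q_def]])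
    then have xp: "x n \<in> pts X" for n by (auto simp: weakly_p_summable_def)
    obtain m where m: "\<And>k N. (\<Sum>n<N. norm (G k (x (m + n))) powr p) \<le> (e / 4) powr p"
      using DPP_uniform_tails[where g=G, OF X p0 universe DPP G null wps, of "e / 4"] e by auto
    have "(\<lambda>k. \<Sum>n<m. norm (G k (x n))) \<longlonglongrightarrow> (\<Sum>n<m. 0)"
    proof (rule tendsto_sum)
      fix n
      have "(\<lambda>k. G k (x n)) \<longlonglongrightarrow> 0"
        using null[OF X.evaluation_in_bidual[OF xp[of n]]] G by (simp add: X.evaluation_def)
      then show "(\<lambda>k. norm (G k (x n))) \<longlonglongrightarrow> 0" by (rule tendsto_norm_zero)
    qed
    then have "\<forall>\<^sub>F k in sequentially. (\<Sum>n<m. norm (G k (x n))) < e / 4"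
      using e by (intro order_tendstoD(2)) auto
    then show ?thesis
    proof (rule eventually_mono)
      fix k assume head: "(\<Sum>n<m. norm (G k (x n))) < e / 4"
      have "norm (f k y - g y) \<le> e / 2" if "y \<in> F" for y
      proof -
        obtain a where a: "a \<in> unit_ball (lp_space q)" and y: "y = S a" using S(2) \<open>y \<in> F\<close> by blast
        have ap: "a \<in> pts (lp_space q)" "vnorm (lp_space q) a \<le> 1" using a by (auto simp: unit_ball_def)
        have asum: "(\<Sum>n<N. norm (a n) powr q) \<le> 1" for N
          using lp_space_norm_le_iff[OF q(3) zero_le_one, of a] ap by simp
        have a1: "norm (a n) \<le> 1" for n
        proof -
          have "norm (a n) powr q \<le> (\<Sum>i<Suc n. norm (a i) powr q)" by (rule member_le_sum) auto
          then have "norm (a n) powr q \<le> 1 powr q" using asum[of "Suc n"] by simp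
          then show ?thesis using powr_le_powr_iff[of "norm (a n)" 1 q] q by simp
        qed
        define h where "h = (\<Sum>n<m. a n * G k (x n))"
        have "(\<lambda>n. a n * G k (x n)) sums G k y"
          unfolding x_def y by (rule operator_series[OF q(2) X.normed_vspace_axioms S(1) G ap(1)])
        then have "(\<lambda>n. a (n + m) * G k (x (n + m))) sums (G k y - h)"
          unfolding h_def using sums_iff_shift[of "\<lambda>n. a n * G k (x n)" m "G k y - h"] by (simp add: h_def)
        then have tail_lim: "(\<lambda>N. norm (\<Sum>n<N. a (n + m) * G k (x (n + m)))) \<longlonglongrightarrow> norm (G k y - h)"
          unfolding sums_def by (rule tendsto_norm)
        have "norm (\<Sum>n<N. a (n + m) * G k (x (n + m))) \<le> e / 4" for N
        proof -
          have "(\<Sum>n<N. norm (a (n + m)) powr q) = (\<Sum>n\<in>{m..<N + m}. norm (a n) powr q)"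
            using sum.shift_bounds_nat_ivl[of "\<lambda>n. norm (a n) powr q" 0 m N] by (simp add: lessThan_atLeast0)
          also have "\<dots> \<le> (\<Sum>n<N + m. norm (a n) powr q)" by (intro sum_mono2) auto
          finally have "(\<Sum>n<N. norm (a (n + m)) powr q) \<le> 1 powr q" using asum[of "N + m"] by simp
          then have "(\<Sum>n<N. norm (a (n + m)) * norm (G k (x (n + m)))) \<le> 1 * (e / 4)"
            using m[of k N] e by (intro finite_Holder[OF p]) (auto simp: q_def add.commute)
          then show ?thesis
            using norm_sum[of "\<lambda>n. a (n + m) * G k (x (n + m))" "{..<N}"] by (simp add: norm_mult)
        qed
        then have "norm (G k y - h) \<le> e / 4" using tail_lim by (meson LIMSEQ_le_const2)
        moreover have "norm h \<le> (\<Sum>n<m. norm (G k (x n)))"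
          unfolding h_def
        proof (rule sum_norm_le)
          fix n show "norm (a n * G k (x n)) \<le> norm (G k (x n))"
            using mult_right_mono[OF a1[of n], of "norm (G k (x n))"] by (simp add: norm_mult)
        qed
        ultimately have "norm (G k y) \<le> e / 2" using head norm_triangle_ineq[of "G k y - h" h] by simp
        then show ?thesis by (simp add: G_def)
      qed
      then have "(SUP y\<in>F. norm (f k y - g y)) \<le> e / 2" by (rule cSUP_least[OF F(1)])
      then show "(SUP y\<in>F. norm (f k y - g y)) < e" using e by simp
    qed
  qed
  then show ?thesis unfolding X.limitin_rho_star_topology[OF p f] using g by blast
qed

text \<open>
  Functionals \<open>f k\<close> in a weakly compact set that stay away from 0 along a subsequence of \<open>x\<close> have, after
  passing to a further subsequence, a \<open>\<rho>\<^sub>p\<^sup>*\<close>-limit \<open>h\<close>.  The convergence is uniform on the range of \<open>x\<close>, and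
  the functional \<open>h\<close> tends to 0 along \<open>x\<close>.\<close>

lemma rho_star_convergent_imp_right_null:
  fixes X :: "('k::real_or_complex, 'v) nspace"
  assumes X: "banach_space X" and p: "1 < p"
    and conv: "\<And>f g. \<lbrakk>range f \<subseteq> pts (dual X); limitin (weak_topology (dual X)) f g sequentially\<rbrakk> \<Longrightarrow>
       \<exists>h. limitin (rho_star_topology p X) f h sequentially"
    and wps: "weakly_p_summable p X x"
  shows "limitin (right_topology X) x (vzero X) sequentially"
proof -
  interpret X: banach_space X by fact
  interpret D: normed_vspace "dual X" by (rule X.normed_vspace_dual)
  have p0: "0 < p" using p by simp
  have x: "range x \<subseteq> pts X" using wps by (auto simp: weakly_p_summable_def)
  then have xp: "x n \<in> pts X" for n by auto
  have "\<forall>\<^sub>F n in sequentially. (SUP f\<in>F. norm (f (x n))) < e"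
    if F: "F \<noteq> {}" "F \<subseteq> unit_ball (dual X)" "compactin (weak_topology (dual X)) F" and e: "0 < e" for F e
  proof (rule ccontr)
    assume "\<not> (\<forall>\<^sub>F n in sequentially. (SUP f\<in>F. norm (f (x n))) < e)"
    then have "infinite {n. \<not> (SUP f\<in>F. norm (f (x n))) < e}"
      unfolding eventually_sequentially infinite_nat_iff_unbounded_le by auto
    from infinite_enumerate[OF this] obtain r :: "nat \<Rightarrow> nat"
      where r: "strict_mono r" "\<And>k. \<not> (SUP f\<in>F. norm (f (x (r k)))) < e" by auto
    have "\<exists>f\<in>F. e / 2 < norm (f (x (r k)))" for k
    proof -
      have "bdd_above ((\<lambda>f. norm (f (x (r k)))) ` F)"
        using F(2) X.dual_ball_bound[OF _ xp] by (intro bdd_aboveI2[of _ _ "vnorm X (x (r k))"]) auto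
      moreover have "e / 2 < (SUP f\<in>F. norm (f (x (r k))))" using r(2)[of k] e by simp
      ultimately show ?thesis using less_cSUP_iff[OF F(1)] by blast
    qed
    then obtain f where f: "\<And>k. f k \<in> F" "\<And>k. e / 2 < norm (f k (x (r k)))" by metis
    have "range f \<subseteq> F" using f(1) by blast
    then obtain s l where s: "strict_mono s" "l \<in> F" "\<And>\<phi>. \<phi> \<in> pts (dual (dual X)) \<Longrightarrow> (\<lambda>k. \<phi> (f (s k))) \<longlonglongrightarrow> \<phi> l"
      using D.weakly_compact_imp_sequentially[OF F(3)] by blast
    have Fp: "F \<subseteq> pts (dual X)" using F(2) by (auto simp: unit_ball_def)
    have fs: "range (\<lambda>k. f (s k)) \<subseteq> pts (dual X)" using f(1) Fp by blast
    have "limitin (weak_topology (dual X)) (\<lambda>k. f (s k)) l sequentially"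
      unfolding D.limitin_weak_iff[OF fs] using s(2,3) Fp by blast
    then obtain h where "limitin (rho_star_topology p X) (\<lambda>k. f (s k)) h sequentially" using conv[OF fs] by blast
    then have h: "h \<in> pts (dual X)"
      and unif: "\<And>F d. \<lbrakk>F \<noteq> {}; relatively_weakly_p_compact p X F; 0 < d\<rbrakk> \<Longrightarrow>
        \<forall>\<^sub>F k in sequentially. (SUP y\<in>F. norm (f (s k) y - h y)) < d"
      unfolding X.limitin_rho_star_topology[OF p fs] by blast+
    have "\<forall>\<^sub>F k in sequentially. (SUP y\<in>range x. norm (f (s k) y - h y)) < e / 4"
      by (rule unif[OF _ X.range_relatively_weakly_p_compact[OF p wps]]) (use e in auto)
    moreover have "\<forall>\<^sub>F k in sequentially. norm (h (x (r (s k)))) < e / 4"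
    proof -
      have "(\<lambda>n. h (x n)) \<longlonglongrightarrow> 0" by (rule X.weakly_p_summable_imp_weakly_null[OF p0 wps h])
      from LIMSEQ_subseq_LIMSEQ[OF this strict_mono_o[OF r(1) s(1)]]
      have "(\<lambda>k. norm (h (x (r (s k))))) \<longlonglongrightarrow> 0" by (intro tendsto_norm_zero) (simp add: o_def)
      then show ?thesis using e by (intro order_tendstoD(2)) auto
    qed
    ultimately have "\<forall>\<^sub>F k in sequentially. (SUP y\<in>range x. norm (f (s k) y - h y)) < e / 4 \<and> norm (h (x (r (s k)))) < e / 4"
      by (intro eventually_conj)
    then obtain k where k: "(SUP y\<in>range x. norm (f (s k) y - h y)) < e / 4" "norm (h (x (r (s k)))) < e / 4"
      using eventually_happens'[OF sequentially_bot] by blast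
    obtain C where C: "\<And>y. y \<in> range x \<Longrightarrow> y \<in> pts X \<and> vnorm X y \<le> C"
      using relatively_weakly_p_compact_bounded[OF p X.normed_vspace_axioms X.range_relatively_weakly_p_compact[OF p wps]] by blast
    have d: "(\<lambda>y. f (s k) y - h y) \<in> pts (dual X)" using D.vminus_closed[of "f (s k)" h] fs h by auto
    have "bdd_above ((\<lambda>y. norm (f (s k) y - h y)) ` range x)"
    proof (rule bdd_aboveI2)
      fix y assume y: "y \<in> range x"
      have "norm (f (s k) y - h y) \<le> vnorm (dual X) (\<lambda>y. f (s k) y - h y) * vnorm X y"
        using X.dual_bound[OF d] C[OF y] by blast
      also have "\<dots> \<le> vnorm (dual X) (\<lambda>y. f (s k) y - h y) * C"
        using C[OF y] by (intro mult_left_mono X.dual_norm_nonneg d) simp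
      finally show "norm (f (s k) y - h y) \<le> vnorm (dual X) (\<lambda>y. f (s k) y - h y) * C" .
    qed
    then have "norm (f (s k) (x (r (s k))) - h (x (r (s k)))) \<le> (SUP y\<in>range x. norm (f (s k) y - h y))"
      by (intro cSUP_upper) auto
    then have "norm (f (s k) (x (r (s k)))) < e / 2"
      using k norm_triangle_ineq[of "f (s k) (x (r (s k))) - h (x (r (s k)))" "h (x (r (s k)))"] by simp
    then show False using f(2)[of "s k"] by simp
  qed
  then show ?thesis unfolding X.limitin_right_topology_zero[OF x] by blast
qed

text \<open>If the tails of \<open>T x\<close> do not vanish, condense consecutive finite blocks of \<open>x\<close> into single vectors
  \<open>z k\<close> by the extremal coefficients of Hoelder's inequality.  For a functional \<open>h\<close> the number
  \<open>|h (z k)|\<^sup>p\<close> is at most the \<open>p\<close>-sum of \<open>h\<close> over the \<open>k\<close>-th block, so \<open>z\<close> is weakly \<open>p\<close>-summable, while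
  the weakly compact set of the \<open>f \<circ> T\<close> sees each \<open>z k\<close> from a fixed distance.\<close>

lemma right_null_imp_DPP:
  fixes X :: "('k::real_or_complex, 'v) nspace"
  assumes X: "banach_space X" and p: "1 < p"
    and null: "\<And>x. weakly_p_summable p X x \<Longrightarrow> limitin (right_topology X) x (vzero X) sequentially"
  shows "DPP TYPE('w) p X"
  unfolding DPP_def unconditionally_p_converging_def
proof (intro allI impI conjI; elim conjE)
  fix Y :: "('k, 'w) nspace" and T assume Y: "banach_space Y" and T: "weakly_compact_operator X Y T"
  then show op: "operator X Y T" by (simp add: weakly_compact_operator_def)
  fix x assume wps: "weakly_p_summable p X x"
  interpret X: banach_space X by fact
  interpret Y: banach_space Y by fact
  interpret DX: normed_vspace "dual X" by (rule X.normed_vspace_dual)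
  define q where "q = conjugate_exponent p"
  have p0: "0 < p" and q: "1 < q" "0 < q" using p conjugate_exponent(1)[OF p] by (auto simp: q_def)
  have x: "range x \<subseteq> pts X" using wps by (auto simp: weakly_p_summable_def)
  then have xp: "x n \<in> pts X" for n by auto
  have Tp: "T y \<in> pts Y" if "y \<in> pts X" for y using op that by (auto simp: operator_def)
  obtain M0 where M0: "\<And>y. y \<in> pts X \<Longrightarrow> vnorm Y (T y) \<le> M0 * vnorm X y"
    using op unfolding operator_iff_bounded[OF X.normed_vspace_axioms Y.normed_vspace_axioms] by blast
  define M where "M = \<bar>M0\<bar> + 1"
  have M: "0 < M" by (simp add: M_def)
  have adj: "dual_operator X T f \<in> pts (dual X)" "vnorm (dual X) (dual_operator X T f) \<le> M" if f: "f \<in> unit_ball (dual Y)" for f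
  proof -
    show "dual_operator X T f \<in> pts (dual X)"
      by (rule dual_operator_in_dual[OF X.normed_vspace_axioms Y.normed_vspace_axioms op ball_subset_pts[OF f]])
    show "vnorm (dual X) (dual_operator X T f) \<le> M"
    proof (rule X.dual_norm_le[OF less_imp_le[OF M]])
      fix y assume y: "y \<in> pts X"
      have "norm (f (T y)) \<le> vnorm Y (T y)" by (rule Y.dual_ball_bound[OF f Tp[OF y]])
      also have "\<dots> \<le> M0 * vnorm X y" by (rule M0[OF y])
      also have "\<dots> \<le> M * vnorm X y" by (intro mult_right_mono X.norm_nonneg y) (simp add: M_def)
      finally show "norm (dual_operator X T f y) \<le> M * vnorm X y" using y by simp
    qed
  qed
  obtain C where C: "0 \<le> C"
    "\<And>f M N. \<lbrakk>f \<in> pts (dual X); 0 < M; vnorm (dual X) f \<le> M\<rbrakk> \<Longrightarrow> (\<Sum>n<N. norm (f (x n)) powr p) \<le> (M * C) powr p"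
    using X.weakly_p_summable_bound[OF p0 wps] by blast
  have "(\<Sum>n<N. norm (f (T (x n))) powr p) \<le> (M * C) powr p" if f: "f \<in> unit_ball (dual Y)" for f N
    using C(2)[OF adj(1)[OF f] M adj(2)[OF f], of N] xp by simp
  then have wpsT: "weakly_p_summable p Y (\<lambda>n. T (x n))"
    unfolding weakly_p_summable_iff[OF p0] using xp Tp C(1) M by (auto intro!: exI[of _ "M * C"])
  show "unconditionally_p_summable p Y (\<lambda>n. T (x n))"
  proof (rule ccontr)
    assume "\<not> ?thesis"
    then obtain e where e: "0 < e" and
      "\<forall>i. \<exists>m\<ge>i. \<exists>f\<in>unit_ball (dual Y). \<exists>N. e powr p < (\<Sum>n<N. norm (f (T (x (m + n)))) powr p)"
      using wpsT unfolding unconditionally_p_summable_iff[OF p0] by (meson not_le)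
    then obtain m f N where m: "\<And>i. i \<le> m i" and f: "\<And>i. f i \<in> unit_ball (dual Y)"
      and big: "\<And>i. e powr p < (\<Sum>n<N i. norm (f i (T (x (m i + n)))) powr p)" by metis
    \<comment> \<open>The block started after position \<open>i\<close> is \<open>{m i..<m i + N i}\<close>; the next one is sought after its
      end, so that the blocks are disjoint.\<close>
    define s where "s = rec_nat 0 (\<lambda>_ i. m i + N i)"
    have s0: "s 0 = 0" and sS: "s (Suc k) = m (s k) + N (s k)" for k by (auto simp: s_def)
    define I where "I = (\<lambda>k. {m (s k)..<s (Suc k)})"
    have I_sub: "I k \<subseteq> {s k..<s (Suc k)}" "I k \<subseteq> {..<s (Suc k)}" for k using m[of "s k"] by (auto simp: I_def)
    have bigI: "e powr p < (\<Sum>n\<in>I k. norm (f (s k) (T (x n))) powr p)" for k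
      using big[of "s k"] unfolding I_def sS
      by (simp add: sum.atLeastLessThan_shift_0[of _ "m (s k)"] lessThan_atLeast0)
    have "\<exists>a. (\<Sum>n\<in>I k. norm (a n) powr q) \<le> 1 \<and>
        (\<Sum>n\<in>I k. a n * f (s k) (T (x n))) = of_real ((\<Sum>n\<in>I k. norm (f (s k) (T (x n))) powr p) powr (1 / p))" for k
      using Holder_extremal[OF p, of "I k" "\<lambda>n. f (s k) (T (x n))"] unfolding q_def I_def by blast
    from choice[OF allI[OF this]] obtain a where "\<forall>k. (\<Sum>n\<in>I k. norm (a k n) powr q) \<le> 1 \<and>
        (\<Sum>n\<in>I k. a k n * f (s k) (T (x n))) = of_real ((\<Sum>n\<in>I k. norm (f (s k) (T (x n))) powr p) powr (1 / p))" ..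
    then have a: "(\<Sum>n\<in>I k. norm (a k n) powr q) \<le> 1"
      "(\<Sum>n\<in>I k. a k n * f (s k) (T (x n))) = of_real ((\<Sum>n\<in>I k. norm (f (s k) (T (x n))) powr p) powr (1 / p))" for k
      by auto
    define z where "z = (\<lambda>k. combination X (\<lambda>n. if n \<in> I k then a k n else 0) x (s (Suc k)))"
    have zp: "z k \<in> pts X" for k unfolding z_def by (rule X.combination_closed[OF x])
    have hz: "h (z k) = (\<Sum>n\<in>I k. a k n * h (x n))" if h: "h \<in> pts (dual X)" for h k
    proof -
      have "h (z k) = (\<Sum>n<s (Suc k). if n \<in> I k then a k n * h (x n) else 0)"
        unfolding z_def X.dual_combination[OF h x] by (intro sum.cong) auto
      also have "\<dots> = (\<Sum>n\<in>I k. a k n * h (x n))"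
        using I_sub(2)[of k] by (subst sum.inter_restrict[symmetric]) (auto simp: Int_absorb1)
      finally show ?thesis .
    qed
    have "weakly_p_summable p X z"
      unfolding weakly_p_summable_iff[OF p0]
    proof (intro conjI exI[of _ C] ballI allI C(1))
      show "range z \<subseteq> pts X" using zp by blast
      fix h K assume h: "h \<in> unit_ball (dual X)"
      have block: "norm (h (z k)) powr p \<le> (\<Sum>n\<in>I k. norm (h (x n)) powr p)" for k
      proof -
        define b where "b = (\<Sum>n\<in>I k. norm (h (x n)) powr p)"
        have b0: "0 \<le> b" unfolding b_def by (intro sum_nonneg) auto
        have bp: "(b powr (1 / p)) powr p = b" using b0 p0 by (simp add: powr_powr)
        have "(\<Sum>n\<in>I k. norm (a k n) * norm (h (x n))) \<le> 1 * b powr (1 / p)"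
          using a(1)[of k] bp by (intro finite_Holder[OF p]) (auto simp: q_def b_def)
        then have "norm (h (z k)) \<le> b powr (1 / p)"
          unfolding hz[OF ball_subset_pts[OF h]]
          using norm_sum[of "\<lambda>n. a k n * h (x n)" "I k"] by (simp add: norm_mult)
        then have "norm (h (z k)) powr p \<le> (b powr (1 / p)) powr p" using p0 by (intro powr_mono2) auto
        then show ?thesis using bp by (simp add: b_def)
      qed
      have "(\<Sum>k<K. norm (h (z k)) powr p) \<le> (\<Sum>n<s K. norm (h (x n)) powr p)"
      proof (induction K)
        case (Suc K)
        have "(\<Sum>n\<in>I K. norm (h (x n)) powr p) \<le> (\<Sum>n\<in>{s K..<s (Suc K)}. norm (h (x n)) powr p)"
          using I_sub(1) by (intro sum_mono2) auto
        moreover have "s K \<le> s (Suc K)" using m[of "s K"] sS[of K] by simp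
        then have "(\<Sum>n<s (Suc K). norm (h (x n)) powr p)
            = (\<Sum>n<s K. norm (h (x n)) powr p) + (\<Sum>n\<in>{s K..<s (Suc K)}. norm (h (x n)) powr p)"
          unfolding lessThan_atLeast0 by (subst sum.atLeastLessThan_concat) auto
        ultimately show ?case using Suc.IH block[of K] by simp
      qed (simp add: s0)
      also have "\<dots> \<le> (1 * C) powr p"
        using h by (intro C(2)) (auto simp: unit_ball_def)
      finally show "(\<Sum>k<K. norm (h (z k)) powr p) \<le> C powr p" by simp
    qed
    then have znull: "limitin (right_topology X) z (vzero X) sequentially" by (rule null)
    define F where "F = (\<lambda>f y. of_real (1 / M) * dual_operator X T f y) ` unit_ball (dual Y)"
    have Fball: "F \<subseteq> unit_ball (dual X)"
      unfolding F_def by (intro image_subsetI X.scaled_dual_in_ball[OF adj(1) M adj(2)])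
    have "compactin (weak_topology (dual X)) F"
      unfolding F_def by (rule Gantmacher[OF X.normed_vspace_axioms Y.normed_vspace_axioms T])
    moreover have "F \<noteq> {}" using f unfolding F_def by blast
    moreover have "range z \<subseteq> pts X" using zp by blast
    ultimately have "\<forall>\<^sub>F k in sequentially. (SUP h\<in>F. norm (h (z k))) < e / M"
      using znull Fball e M X.limitin_right_topology_zero[of z] by simp
    then obtain k where k: "(SUP h\<in>F. norm (h (z k))) < e / M"
      using eventually_happens'[OF sequentially_bot] by blast
    let ?h = "\<lambda>y. of_real (1 / M) * dual_operator X T (f (s k)) y"
    have "?h \<in> F" unfolding F_def using f by blast
    moreover have "bdd_above ((\<lambda>h. norm (h (z k))) ` F)"
      using Fball X.dual_ball_bound[OF _ zp] by (intro bdd_aboveI2[of _ _ "vnorm X (z k)"]) auto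
    ultimately have "norm (?h (z k)) \<le> (SUP h\<in>F. norm (h (z k)))" by (intro cSUP_upper)
    then have "norm (?h (z k)) < e / M" using k by simp
    then have "norm (dual_operator X T (f (s k)) (z k)) < e" using M by (simp add: norm_mult norm_divide field_simps)
    moreover have "dual_operator X T (f (s k)) (z k) = of_real ((\<Sum>n\<in>I k. norm (f (s k) (T (x n))) powr p) powr (1 / p))"
      using hz[OF adj(1)[OF f], of "s k" k] a(2)[of k] xp by simp
    moreover have "e < (\<Sum>n\<in>I k. norm (f (s k) (T (x n))) powr p) powr (1 / p)"
    proof -
      have "(e powr p) powr (1 / p) < (\<Sum>n\<in>I k. norm (f (s k) (T (x n))) powr p) powr (1 / p)"
        using bigI[of k] p0 by (intro powr_less_mono2) auto
      then show ?thesis using e p0 by (simp add: powr_powr)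
    qed
    ultimately show False by simp
  qed
qed

theorem theorem5p2:
  fixes X :: "('k::real_or_complex, 'v) nspace" and p :: real
  assumes "banach_space X" and "1 < p"
    and universe: "pts X \<lesssim> (UNIV :: 'w set)"
  shows "(DPP TYPE('w) p X \<longleftrightarrow>
            (\<forall>x. weakly_p_summable p X x \<longrightarrow>
               limitin (right_topology X) x (vzero X) sequentially)) \<and>
         (DPP TYPE('w) p X \<longleftrightarrow>
            (\<forall>f. range f \<subseteq> pts (dual X) \<and>
               (\<exists>g. limitin (weak_topology (dual X)) f g sequentially) \<longrightarrow>
               (\<exists>h. limitin (rho_star_topology p X) f h sequentially)))"
    (is "(?one \<longleftrightarrow> ?two) \<and> (?one \<longleftrightarrow> ?three)")
proof -
  have "?three" if ?one
    using DPP_imp_rho_star_convergent[OF assms(1,2) universe that] by blast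
  moreover have "?two" if ?three
    using rho_star_convergent_imp_right_null[OF assms(1,2)] that by blast
  moreover have "?one" if ?two
    using right_null_imp_DPP[OF assms(1,2)] that by blast
  ultimately show ?thesis by blast
qed

end
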